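(* Let $K, K'$ be self-similar Cantor sets such that $\dim_H K + \dim_H K' > 1$. Then, for every $\epsilon > 0$ and $M > 0$, there exist a self-similar Cantor set $\widetilde{K}$ and a (Lebesgue measurable) set $E \subset (M^{-1}, M)$ such that (i) $\left| (M^{-1}, M) \setminus E \right| < \epsilon$; (ii) $\widetilde{K}$ is $\epsilon$-close to $K$; (iii) $\widetilde{K} + r K' = \{ x + r y : x \in \widetilde{K},\ y \in K' \}$ contains an interval (of positive length) for all $r \in E$.
   Context: Write $I = [0,1]$. $|\cdot|$ denotes Lebesgue measure (length, for intervals); $\dim_H$ is Hausdorff dimension; $\mathrm{conv}$ denotes convex hull. A (nonempty compact) set $K \subset \mathbb{R}$ is a self-similar Cantor set if there exist a finite alphabet $\mathcal{A}$ and a set of linear contractions $\mathcal{F} = \{ f_a \}_{a \in \mathcal{A}}$ on $\mathbb{R}$ (contracting similarities, $f_a(x) = \lambda_a x + b_a$ with $0 < |\lambda_a| < 1$) such that (i) $K = \bigcup_{a \in \mathcal{A}} f_a(K)$; (ii) the sets $f_a(\mathrm{conv}(K))$, $a \in \mathcal{A}$, are pairwise disjoint. In that case one says that $\mathcal{F}$ generates $K$. Without loss of generality it is always assumed that $K \subset I$. For $a \in \mathcal{A}$ write $I(a) = f_a(I)$. A given $K$ may be generated by several such families $\mathcal{F}$. Two closed intervals $I_1, I_2 \subset \mathbb{R}$ are $\epsilon$-close if (i) $1 - \epsilon < |I_1|/|I_2| < 1 + \epsilon$, and (ii) the distance between the centers of $I_1$ and $I_2$ is less than $\epsilon \min\{|I_1|,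 |I_2|\}$. Two self-similar Cantor sets $K, \widetilde{K}$ are $\epsilon$-close if there exist sets of contracting similarities $\mathcal{F} = \{f_a\}_{a \in \mathcal{A}}$ generating $K$ and $\widetilde{\mathcal{F}} = \{\tilde{f}_a\}_{a \in \mathcal{A}}$ generating $\widetilde{K}$, indexed by the same alphabet $\mathcal{A}$, such that $I(a) = f_a(I)$ and $\tilde{I}(a) = \tilde{f}_a(I)$ are $\epsilon$-close for all $a \in \mathcal{A}$. *)

theory Defs
  imports "HOL-Analysis.Analysis"
begin

text \<open>
  The contribution of a covering set to the \<open>s\<close>-dimensional Hausdorff sum, with the usual
  conventions \<open>diam {} ^ s = 0\<close> and \<open>0 ^ 0 = 1\<close> (which differ from \<open>0 powr 0 = 0\<close>).
\<close>
definition diam_pow :: "real \<Rightarrow> 'a::metric_space set \<Rightarrow> ennreal" where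
  "diam_pow s U = (if U = {} then 0 else if s = 0 then 1 else ennreal (diameter U powr s))"

text \<open>
  Boundedness is required explicitly because \<^const>\<open>diameter\<close> is unspecified on unbounded sets.
  Finite covers are included, since the \<open>U i\<close> may be empty.
\<close>
definition hausdorff_premeasure :: "real \<Rightarrow> real \<Rightarrow> 'a::metric_space set \<Rightarrow> ennreal" where
  "hausdorff_premeasure \<delta> s S =
    (INF U \<in> {U :: nat \<Rightarrow> 'a set. S \<subseteq> (\<Union>i. U i) \<and> (\<forall>i. bounded (U i) \<and> diameter (U i) \<le> \<delta>)}.
       \<Sum>i. diam_pow s (U i))"

definition hausdorff_measure :: "real \<Rightarrow> 'a::metric_space set \<Rightarrow> ennreal" where
  "hausdorff_measure s S = (SUP \<delta> \<in> {0<..}. hausdorff_premeasure \<delta> s S)"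

definition hausdorff_dim :: "'a::metric_space set \<Rightarrow> ennreal" where
  "hausdorff_dim S = Inf {ennreal s | s. 0 \<le> s \<and> hausdorff_measure s S = 0}"

definition contracting_similarity :: "(real \<Rightarrow> real) \<Rightarrow> bool" where
  "contracting_similarity f \<longleftrightarrow> (\<exists>c b. 0 < \<bar>c\<bar> \<and> \<bar>c\<bar> < 1 \<and> f = (\<lambda>x. c * x + b))"

definition generates :: "'i set \<Rightarrow> ('i \<Rightarrow> real \<Rightarrow> real) \<Rightarrow> real set \<Rightarrow> bool" where
  "generates A f K \<longleftrightarrow>
     finite A \<and> (\<forall>a\<in>A. contracting_similarity (f a)) \<and>
     K = (\<Union>a\<in>A. f a ` K) \<and>
     disjoint_family_on (\<lambda>a. f a ` (convex hull K)) A"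

text \<open>
  Alphabets are finite sets of natural numbers, which loses nothing: any finite alphabet can be
  relabelled. The normalization \<open>K \<subseteq> [0,1]\<close> is part of the definition.
\<close>
definition self_similar_cantor_set :: "real set \<Rightarrow> bool" where
  "self_similar_cantor_set K \<longleftrightarrow>
     compact K \<and> K \<noteq> {} \<and> K \<subseteq> {0..1} \<and>
     (\<exists>(A :: nat set) f. generates A f K)"

definition interval_center :: "real set \<Rightarrow> real" where
  "interval_center J = (Inf J + Sup J) / 2"

text \<open>Only meant for closed intervals of positive length. Not symmetric in the two intervals.\<close>
definition eps_close_intervals :: "real \<Rightarrow> real set \<Rightarrow> real set \<Rightarrow> bool" where
  "eps_close_intervals \<epsilon> J1 J2 \<longleftrightarrow>
     1 - \<epsilon> < measure lborel J1 / measure lborel J2 \<and>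
     measure lborel J1 / measure lborel J2 < 1 + \<epsilon> \<and>
     dist (interval_center J1) (interval_center J2) < \<epsilon> * min (measure lborel J1) (measure lborel J2)"

text \<open>
  Both families use the same alphabet \<open>A\<close>; the generating families are chosen existentially, as a
  set may be generated by several of them.
\<close>
definition eps_close :: "real \<Rightarrow> real set \<Rightarrow> real set \<Rightarrow> bool" where
  "eps_close \<epsilon> K L \<longleftrightarrow>
     (\<exists>(A :: nat set) f g. generates A f K \<and> generates A g L \<and>
        (\<forall>a\<in>A. eps_close_intervals \<epsilon> (f a ` {0..1}) (g a ` {0..1})))"

end

theory Submission
  imports Defs "HOL-Probability.Probability"
begin

text \<open>
  A target \<open>t\<close> lies in \<open>L + r K'\<close> as soon as the pair \<open>(r, t)\<close> belongs to a bounded recurrent set: one from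
  which each pair can be renormalized back into the set by restricting to a piece of \<open>L\<close> and a piece of
  \<open>K'\<close> (\<open>recurrent_set_sum\<close>). The proof produces a recurrent set for a suitable random perturbation of
  \<open>K\<close>, in the manner of Moreira and Yoccoz.

  Let \<open>s\<close>, \<open>s'\<close> be the similarity dimensions. They bound the Hausdorff dimensions from above
  (\<open>hausdorff_dim_le\<close>), so \<open>s + s' > 1\<close>. Cut \<open>K\<close> and \<open>K'\<close> into pieces of size about \<open>\<rho>\<close>. The energy
  estimate of Marstrand's projection theorem (\<open>energy_bound\<close>) shows that for all slopes \<open>r\<close> outside a set of
  small measure the projections \<open>x + r y\<close> of the pairs of pieces do not concentrate. Hence there is a set of
  targets, of measure bounded below, each of which is hit by many pairs; as a piece of \<open>K\<close> has boundedly many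
  partners, at least \<open>c \<rho> ^ (1 - s - s')\<close> distinct pieces of \<open>K\<close> are involved (\<open>transversal_slices\<close>).
  All constants are independent of \<open>\<rho>\<close>.

  Now perturb each piece of \<open>K\<close> independently, in ratio and position, by a small proportion of its size.
  Changing the ratio moves the renormalized slope off the small bad set, and changing the position moves
  the renormalized target across the good targets; so each piece that hits a given target renormalizes it
  to a good pair with probability at least some \<open>p > 0\<close> independent of \<open>\<rho>\<close> (\<open>good_parameters\<close>). All of the
  pieces fail with probability at most \<open>(1 - p) ^ (c \<rho> ^ (1 - s - s'))\<close>, while a net of polynomially many pairs in
  \<open>1 / \<rho>\<close> suffices to control all pairs. For small \<open>\<rho>\<close> some perturbation therefore works for every pair
  (\<open>independent_choice\<close>, \<open>perturbation\<close>). As the good set is thickened, it contains an interval of targets for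
  each good slope.
\<close>

section \<open>Subdivisions of self-similar sets\<close>

text \<open>
  The affine map \<open>x \<mapsto> l x + o\<close> is encoded by the pair \<open>(l, o)\<close>, so that \<open>fst g\<close> is the signed
  ratio of \<open>g\<close>. Finite families of maps then become finite sets, with no index type.
\<close>
definition aff :: "real \<times> real \<Rightarrow> real \<Rightarrow> real" where
  "aff g x = fst g * x + snd g"

text \<open>Composition of encoded maps: first \<open>h\<close>, then \<open>g\<close>.\<close>
definition aff_comp :: "real \<times> real \<Rightarrow> real \<times> real \<Rightarrow> real \<times> real" where
  "aff_comp g h = (fst g * fst h, fst g * snd h + snd g)"

lemma aff_aff_comp: "aff (aff_comp g h) x = aff g (aff h x)"
  by (simp add: aff_def aff_comp_def algebra_simps)

lemma fst_aff_comp [simp]: "fst (aff_comp g h) = fst g * fst h"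
  by (simp add: aff_comp_def)

lemma aff_diff: "aff g x - aff g y = fst g * (x - y)"
  by (simp add: aff_def algebra_simps)

lemma aff_id [simp]: "aff (1, 0) x = x"
  by (simp add: aff_def)

lemma inj_on_aff_comp: "fst g \<noteq> 0 \<Longrightarrow> inj_on (aff_comp g) S"
  by (auto simp: inj_on_def aff_comp_def prod_eq_iff)

lemma aff_image_hull: "aff g ` (convex hull S) = convex hull (aff g ` S)"
proof -
  have "aff g ` T = (\<lambda>x. snd g + x) ` ((\<lambda>x. fst g *\<^sub>R x) ` T)" for T
    by (auto simp: aff_def image_image add.commute)
  then show ?thesis
    by (simp only: convex_hull_translation convex_hull_scaling)
qed

text \<open>
  A finite family of maps that cuts \<open>K\<close> into affine copies of itself with pairwise disjoint hulls.
  Ratios are not restricted: the identity alone is a subdivision.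
\<close>
definition subdivision :: "(real \<times> real) set \<Rightarrow> real set \<Rightarrow> bool" where
  "subdivision G K \<longleftrightarrow> finite G \<and> K = (\<Union>g\<in>G. aff g ` K) \<and>
     disjoint_family_on (\<lambda>g. aff g ` (convex hull K)) G"

lemma subdivision_id: "subdivision {(1, 0)} K"
  by (auto simp: subdivision_def disjoint_family_on_def)

lemma subdivision_hull:
  assumes "subdivision G K" "g \<in> G"
  shows "aff g ` (convex hull K) \<subseteq> convex hull K"
proof -
  have "aff g ` K \<subseteq> K" using assms unfolding subdivision_def by blast
  then show ?thesis by (simp add: aff_image_hull hull_mono)
qed

text \<open>
  Each piece may be subdivided again, by a family that depends on the piece; sums over the refined
  family split accordingly, because distinct compositions remain distinct.
\<close>
lemma
  assumes "subdivision \<Phi> K" "K \<noteq> {}" "\<And>g. g \<in> \<Phi> \<Longrightarrow> fst g \<noteq> 0"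
    and F: "\<And>g. g \<in> \<Phi> \<Longrightarrow> subdivision (F g) K"
  shows subdivision_refine: "subdivision (\<Union>g\<in>\<Phi>. aff_comp g ` F g) K"
    and sum_refine: "(\<Sum>k\<in>(\<Union>g\<in>\<Phi>. aff_comp g ` F g). \<phi> k) = (\<Sum>g\<in>\<Phi>. \<Sum>h\<in>F g. \<phi> (aff_comp g h))"
proof -
  let ?J = "convex hull K"
  have fin: "finite \<Phi>" and K: "K = (\<Union>g\<in>\<Phi>. aff g ` K)"
    and disj: "\<And>g h. \<lbrakk>g \<in> \<Phi>; h \<in> \<Phi>; g \<noteq> h\<rbrakk> \<Longrightarrow> aff g ` ?J \<inter> aff h ` ?J = {}"
    using assms(1) by (auto simp: subdivision_def disjoint_family_on_def)
  have J: "?J \<noteq> {}" using assms(2) by simp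
  have img: "aff (aff_comp g h) ` S = aff g ` (aff h ` S)" for g h S
    by (simp add: image_image aff_aff_comp)
  have inc: "aff (aff_comp g h) ` ?J \<subseteq> aff g ` ?J" if "g \<in> \<Phi>" "h \<in> F g" for g h
    using subdivision_hull[OF F] that by (simp add: img image_mono)
  have finF: "finite (F g)" if "g \<in> \<Phi>" for g using F[OF that] by (simp add: subdivision_def)
  have dj: "aff k ` ?J \<inter> aff k' ` ?J = {}"
    if k: "g \<in> \<Phi>" "h \<in> F g" "k = aff_comp g h" and k': "g' \<in> \<Phi>" "h' \<in> F g'" "k' = aff_comp g' h'"
      and ne: "k \<noteq> k'" for g h k g' h' k'
  proof (cases "g = g'")
    case True
    then have "h \<noteq> h'" using ne k k' by auto
    then have "aff h ` ?J \<inter> aff h' ` ?J = {}"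
      using F[of g] k k' True by (auto simp: subdivision_def disjoint_family_on_def)
    moreover have "inj (aff g)" using assms(3)[OF k(1)] by (auto simp: inj_on_def aff_def)
    ultimately show ?thesis using True k k' by (simp add: img image_Int[symmetric])
  next
    case False
    then show ?thesis using inc[of g h] inc[of g' h'] disj[of g g'] k k' by blast
  qed
  show "subdivision (\<Union>g\<in>\<Phi>. aff_comp g ` F g) K"
    unfolding subdivision_def
  proof (intro conjI)
    show "finite (\<Union>g\<in>\<Phi>. aff_comp g ` F g)" using fin finF by auto
    have "aff g ` K = (\<Union>h\<in>F g. aff (aff_comp g h) ` K)" if "g \<in> \<Phi>" for g
    proof -
      have "K = (\<Union>h\<in>F g. aff h ` K)" using F[OF that] by (simp add: subdivision_def)
      then have "aff g ` K = aff g ` (\<Union>h\<in>F g. aff h ` K)" by simp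
      then show ?thesis by (simp add: img image_UN)
    qed
    then have "(\<Union>g\<in>\<Phi>. aff g ` K) = (\<Union>k\<in>(\<Union>g\<in>\<Phi>. aff_comp g ` F g). aff k ` K)" by simp
    then show "K = (\<Union>k\<in>(\<Union>g\<in>\<Phi>. aff_comp g ` F g). aff k ` K)" using K by simp
    show "disjoint_family_on (\<lambda>g. aff g ` ?J) (\<Union>g\<in>\<Phi>. aff_comp g ` F g)"
      unfolding disjoint_family_on_def using dj by blast
  qed
  have "(\<Sum>k\<in>(\<Union>g\<in>\<Phi>. aff_comp g ` F g). \<phi> k) = (\<Sum>g\<in>\<Phi>. \<Sum>k\<in>aff_comp g ` F g. \<phi> k)"
  proof (rule sum.UNION_disjoint)
    show "\<forall>i\<in>\<Phi>. \<forall>j\<in>\<Phi>. i \<noteq> j \<longrightarrow> aff_comp i ` F i \<inter> aff_comp j ` F j = {}"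
    proof (intro ballI impI, rule ccontr)
      fix i j assume ij: "i \<in> \<Phi>" "j \<in> \<Phi>" "i \<noteq> j" "aff_comp i ` F i \<inter> aff_comp j ` F j \<noteq> {}"
      then obtain h h' where "h \<in> F i" "h' \<in> F j" "aff_comp i h = aff_comp j h'" by (smt (verit) Int_emptyI imageE)
      then have "aff (aff_comp i h) ` ?J \<subseteq> aff i ` ?J \<inter> aff j ` ?J"
        using inc[of i h] inc[of j h'] ij by auto
      then show False using disj[of i j] ij J by auto
    qed
  qed (use fin finF in auto)
  also have "\<dots> = (\<Sum>g\<in>\<Phi>. \<Sum>h\<in>F g. \<phi> (aff_comp g h))"
    by (rule sum.cong[OF refl], subst sum.reindex[OF inj_on_aff_comp]) (simp_all add: assms(3))
  finally show "(\<Sum>k\<in>(\<Union>g\<in>\<Phi>. aff_comp g ` F g). \<phi> k) = (\<Sum>g\<in>\<Phi>. \<Sum>h\<in>F g. \<phi> (aff_comp g h))" .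
qed

text \<open>
  A self-similar Cantor set \<open>K\<close> together with one family \<open>\<Phi>\<close> generating it. A single point, generated
  by a single map, is not excluded.
\<close>
locale ifs =
  fixes \<Phi> :: "(real \<times> real) set" and K :: "real set"
  assumes sub: "subdivision \<Phi> K"
    and ratio: "\<And>g. g \<in> \<Phi> \<Longrightarrow> 0 < \<bar>fst g\<bar> \<and> \<bar>fst g\<bar> < 1"
    and compact_K: "compact K" and K_ne: "K \<noteq> {}" and K_unit: "K \<subseteq> {0..1}"
begin

abbreviation "J \<equiv> convex hull K"

lemma fin: "finite \<Phi>" using sub by (simp add: subdivision_def)

lemma ne: "\<Phi> \<noteq> {}" using sub K_ne by (auto simp: subdivision_def)

lemma J_unit: "J \<subseteq> {0..1}" using K_unit by (simp add: hull_minimal)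

lemma J_ne: "J \<noteq> {}" using K_ne by simp

lemma similarity_dim_ex: "\<exists>s\<ge>0. (\<Sum>g\<in>\<Phi>. \<bar>fst g\<bar> powr s) = 1"
proof -
  let ?f = "\<lambda>s. \<Sum>g\<in>\<Phi>. \<bar>fst g\<bar> powr s"
  have "((\<lambda>s. \<Sum>g\<in>\<Phi>. \<bar>fst g\<bar> powr s) \<longlongrightarrow> (\<Sum>g\<in>\<Phi>. 0)) at_top"
  proof (intro tendsto_sum)
    fix g assume g: "g \<in> \<Phi>"
    from ratio[OF g] show "((\<lambda>s. \<bar>fst g\<bar> powr s) \<longlongrightarrow> 0) at_top" by real_asymp
  qed
  then have "eventually (\<lambda>s. ?f s < 1) at_top" by (intro order_tendstoD(2)[of _ 0]) auto
  then have "eventually (\<lambda>s. ?f s < 1 \<and> s \<ge> 0) at_top"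
    using eventually_ge_at_top by (rule eventually_conj)
  then obtain S where S: "?f S < 1" "S \<ge> 0" by (auto simp: eventually_at_top_linorder)
  have "?f 0 = card \<Phi>" using ratio by (simp add: powr_def cong: sum.cong)
  moreover have "card \<Phi> \<ge> 1" using fin ne by (simp add: Suc_leI card_gt_0_iff)
  ultimately have "?f 0 \<ge> 1" by simp
  moreover have "continuous_on {0..S} ?f" using ratio
    by (intro continuous_intros) force+
  ultimately obtain s where "0 \<le> s" "s \<le> S" "?f s = 1"
    using IVT2'[of ?f S 1 0] S by auto
  then show ?thesis by auto
qed

text \<open>
  The similarity dimension, the solution \<open>s \<ge> 0\<close> of \<open>\<Sum> \<bar>l\<bar> ^ s = 1\<close>.
\<close>
definition sdim :: real where
  "sdim = (SOME s. s \<ge> 0 \<and> (\<Sum>g\<in>\<Phi>. \<bar>fst g\<bar> powr s) = 1)"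

lemma sdim: "sdim \<ge> 0" "(\<Sum>g\<in>\<Phi>. \<bar>fst g\<bar> powr sdim) = 1"
  using someI_ex[of "\<lambda>s. s \<ge> 0 \<and> (\<Sum>g\<in>\<Phi>. \<bar>fst g\<bar> powr s) = 1"] similarity_dim_ex
  unfolding sdim_def by auto

text \<open>The extreme contraction ratios, in absolute value.\<close>
definition rmin :: real where "rmin = Min ((\<lambda>g. \<bar>fst g\<bar>) ` \<Phi>)"
definition rmax :: real where "rmax = Max ((\<lambda>g. \<bar>fst g\<bar>) ` \<Phi>)"

lemma rmin: "0 < rmin" "rmin < 1" "g \<in> \<Phi> \<Longrightarrow> rmin \<le> \<bar>fst g\<bar>"
proof -
  have "rmin \<in> (\<lambda>g. \<bar>fst g\<bar>) ` \<Phi>" unfolding rmin_def using fin ne by (intro Min_in) auto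
  then show "0 < rmin" "rmin < 1" using ratio by auto
  show "g \<in> \<Phi> \<Longrightarrow> rmin \<le> \<bar>fst g\<bar>" unfolding rmin_def using fin by (intro Min_le) auto
qed

lemma rmax: "0 < rmax" "rmax < 1" "g \<in> \<Phi> \<Longrightarrow> \<bar>fst g\<bar> \<le> rmax"
proof -
  have "rmax \<in> (\<lambda>g. \<bar>fst g\<bar>) ` \<Phi>" unfolding rmax_def using fin ne by (intro Max_in) auto
  then show "0 < rmax" "rmax < 1" using ratio by auto
  show "g \<in> \<Phi> \<Longrightarrow> \<bar>fst g\<bar> \<le> rmax" unfolding rmax_def using fin by (intro Max_ge) auto
qed

lemma gap_ex:
  "\<exists>\<gamma>>0. \<gamma> \<le> 1 \<and> (\<forall>g\<in>\<Phi>. \<forall>h\<in>\<Phi>. g \<noteq> h \<longrightarrow> (\<forall>x\<in>J. \<forall>y\<in>J. 2 * \<gamma> < \<bar>aff g x - aff h y\<bar>))"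
proof -
  have "\<exists>d>0. \<forall>x\<in>J. \<forall>y\<in>J. d \<le> \<bar>aff g x - aff h y\<bar>" if "g \<in> \<Phi>" "h \<in> \<Phi>" "g \<noteq> h" for g h
  proof -
    have c: "compact (aff g ` J)" for g
      unfolding aff_def using compact_K
      by (intro compact_continuous_image continuous_intros compact_convex_hull)
    have "aff g ` J \<inter> aff h ` J = {}"
      using sub that by (auto simp: subdivision_def disjoint_family_on_def)
    from separate_compact_closed[OF c compact_imp_closed[OF c] this]
    show ?thesis by (auto simp: dist_real_def)
  qed
  then obtain d where d: "\<And>g h. \<lbrakk>g \<in> \<Phi>; h \<in> \<Phi>; g \<noteq> h\<rbrakk> \<Longrightarrow> d g h > 0 \<and> (\<forall>x\<in>J. \<forall>y\<in>J. d g h \<le> \<bar>aff g x - aff h y\<bar>)"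
    by metis
  define D where "D = insert 2 ((\<lambda>(g,h). d g h) ` {(g,h) \<in> \<Phi>\<times>\<Phi>. g \<noteq> h})"
  have finD: "finite D" unfolding D_def using fin
    by (intro finite.insertI finite_imageI) (auto intro: finite_subset[of _ "\<Phi>\<times>\<Phi>"])
  have pos: "Min D > 0" using finD d by (subst Min_gr_iff) (auto simp: D_def)
  have le: "Min D \<le> 2" using finD by (intro Min_le) (auto simp: D_def)
  have "2 * (Min D / 3) < \<bar>aff g x - aff h y\<bar>" if "g \<in> \<Phi>" "h \<in> \<Phi>" "g \<noteq> h" "x \<in> J" "y \<in> J" for g h x y
  proof -
    have "Min D \<le> d g h" using finD that by (intro Min_le) (auto simp: D_def)
    then show ?thesis using d[of g h] that pos by force
  qed
  then show ?thesis using pos le by (intro exI[of _ "Min D / 3"]) auto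
qed

text \<open>
  The family of compositions along words stopped as soon as the ratio drops to \<open>\<rho>\<close> or below. The number
  \<open>n\<close> bounds the word length and only serves the recursion; it plays no role once \<open>rmax ^ n \<le> \<rho>\<close>.
\<close>
primrec stop :: "nat \<Rightarrow> real \<Rightarrow> (real \<times> real) set" where
  "stop 0 \<rho> = {(1, 0)}"
| "stop (Suc n) \<rho> = (if \<rho> \<ge> 1 then {(1, 0)} else (\<Union>g\<in>\<Phi>. aff_comp g ` stop n (\<rho> / \<bar>fst g\<bar>)))"

lemma subdivision_stop: "subdivision (stop n \<rho>) K"
proof (induction n arbitrary: \<rho>)
  case (Suc n)
  then show ?case using ratio by (force intro!: subdivision_refine[OF sub K_ne] simp: subdivision_id)
qed (simp add: subdivision_id)

lemma sum_stop_Suc: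
  assumes "\<rho> < 1"
  shows "(\<Sum>k\<in>stop (Suc n) \<rho>. \<phi> k) = (\<Sum>g\<in>\<Phi>. \<Sum>h\<in>stop n (\<rho> / \<bar>fst g\<bar>). \<phi> (aff_comp g h))"
  using assms ratio by (force simp: intro!: sum_refine[OF sub K_ne _ subdivision_stop])

lemma sum_stop_weight: "(\<Sum>h\<in>stop n \<rho>. \<bar>fst h\<bar> powr sdim) = 1"
proof (induction n arbitrary: \<rho>)
  case (Suc n)
  show ?case
  proof (cases "\<rho> < 1")
    case True
    show ?thesis
      unfolding sum_stop_Suc[OF True] using Suc sdim(2)
      by (simp add: abs_mult powr_mult sum_distrib_left[symmetric])
  qed simp
qed simp

lemma stop_ge_1: "\<rho> \<ge> 1 \<Longrightarrow> stop n \<rho> = {(1, 0)}"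
  by (cases n) auto

lemma div_ratio:
  assumes "rmax ^ Suc n \<le> \<rho>" "g \<in> \<Phi>"
  shows "rmax ^ n \<le> \<rho> / \<bar>fst g\<bar>"
proof -
  have "rmax ^ n * \<bar>fst g\<bar> \<le> rmax ^ n * rmax"
    using rmax assms(2) by (intro mult_left_mono) auto
  also have "\<dots> \<le> \<rho>" using assms(1) by (simp add: mult.commute)
  finally show ?thesis using ratio[OF assms(2)] by (simp add: field_simps)
qed

lemma stop_ratio:
  assumes "rmax ^ n \<le> \<rho>" "\<rho> < 1" "h \<in> stop n \<rho>"
  shows "rmin * \<rho> \<le> \<bar>fst h\<bar>" "\<bar>fst h\<bar> \<le> \<rho>"
proof -
  have "rmin * \<rho> \<le> \<bar>fst h\<bar> \<and> \<bar>fst h\<bar> \<le> \<rho>" using assms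
  proof (induction n arbitrary: \<rho> h)
    case (Suc n)
    then obtain g k where gk: "g \<in> \<Phi>" "k \<in> stop n (\<rho> / \<bar>fst g\<bar>)" "h = aff_comp g k" by auto
    have \<rho>: "\<rho> > 0" using Suc.prems rmax(1) by (smt (verit) zero_less_power)
    note g = ratio[OF gk(1)] rmin(3)[OF gk(1)]
    show ?case
    proof (cases "\<rho> / \<bar>fst g\<bar> < 1")
      case True
      from Suc.IH[OF div_ratio[OF Suc.prems(1) gk(1)] True gk(2)]
      show ?thesis using g gk(3) by (simp add: abs_mult field_simps)
    next
      case False
      then have "k = (1, 0)" using gk(2) stop_ge_1 by auto
      moreover have "rmin * \<rho> \<le> \<bar>fst g\<bar>" using g rmin \<rho> Suc.prems
        by (smt (verit) mult_left_le)
      ultimately show ?thesis using g gk(3) False by (simp add: field_simps)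
    qed
  qed simp
  then show "rmin * \<rho> \<le> \<bar>fst h\<bar>" "\<bar>fst h\<bar> \<le> \<rho>" by auto
qed

lemma stop_hull: "h \<in> stop n \<rho> \<Longrightarrow> x \<in> J \<Longrightarrow> aff h x \<in> J"
  using subdivision_hull[OF subdivision_stop] by blast

text \<open>
  Ahlfors regularity of the natural weights \<open>\<bar>l\<bar> ^ s\<close>, from above. Distinct first-level pieces are more
  than \<open>2 \<gamma>\<close> apart, so a ball of radius below \<open>\<gamma>\<close> meets at most one of them; blowing that piece up
  reproduces the statement at scale \<open>\<rho> / \<bar>l\<bar>\<close> with the same constant.
\<close>
lemma stop_regular:
  assumes \<gamma>: "0 < \<gamma>" "\<gamma> \<le> 1"
      "\<And>g h x y. \<lbrakk>g \<in> \<Phi>; h \<in> \<Phi>; g \<noteq> h; x \<in> J; y \<in> J\<rbrakk> \<Longrightarrow> 2 * \<gamma> < \<bar>aff g x - aff h y\<bar>"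
    and "rmax ^ n \<le> \<rho>" "x \<in> J" "0 < R"
  shows "(\<Sum>h\<in>stop n \<rho>. \<bar>fst h\<bar> powr sdim * of_bool (\<bar>aff h x - t\<bar> \<le> R))
         \<le> (1/\<gamma>) powr sdim * max R \<rho> powr sdim"
  using assms(4,6)
proof (induction n arbitrary: \<rho> t R)
  case 0
  have "1 \<le> (1/\<gamma>) powr sdim" "1 \<le> max R \<rho> powr sdim"
    using \<gamma> sdim(1) 0 by (auto intro!: ge_one_powr_ge_zero)
  then have "1 \<le> (1/\<gamma>) powr sdim * max R \<rho> powr sdim" using mult_mono[of 1 "(1/\<gamma>) powr sdim" 1] by simp
  then show ?case by auto
next
  case (Suc n)
  have \<rho>: "\<rho> > 0" using Suc.prems rmax(1) by (smt (verit) zero_less_power)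
  have le1: "(\<Sum>h\<in>stop (Suc n) \<rho>. \<bar>fst h\<bar> powr sdim * of_bool (\<bar>aff h x - t\<bar> \<le> R)) \<le> 1"
    unfolding sum_stop_weight[of "Suc n" \<rho>, symmetric] by (intro sum_mono) auto
  show ?case
  proof (cases "\<rho> \<ge> 1 \<or> R \<ge> \<gamma>")
    case True
    then have "1 \<le> (1/\<gamma>) * max R \<rho>" using \<gamma> \<rho>
      by (auto simp: field_simps max_def)
    then have "1 \<le> ((1/\<gamma>) * max R \<rho>) powr sdim" using sdim(1) by (rule ge_one_powr_ge_zero)
    then have "1 \<le> (1/\<gamma>) powr sdim * max R \<rho> powr sdim"
      using \<gamma> \<rho> Suc.prems by (subst powr_mult[symmetric]) auto
    then show ?thesis using le1 by linarith
  next
    case False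
    define \<psi> where "\<psi> g = (\<Sum>h\<in>stop n (\<rho> / \<bar>fst g\<bar>).
       \<bar>fst (aff_comp g h)\<bar> powr sdim * of_bool (\<bar>aff (aff_comp g h) x - t\<bar> \<le> R))" for g
    have total: "(\<Sum>h\<in>stop (Suc n) \<rho>. \<bar>fst h\<bar> powr sdim * of_bool (\<bar>aff h x - t\<bar> \<le> R)) = (\<Sum>g\<in>\<Phi>. \<psi> g)"
      unfolding \<psi>_def using False by (intro sum_stop_Suc) auto
    have bound: "\<psi> g \<le> (1/\<gamma>) powr sdim * max R \<rho> powr sdim" if g: "g \<in> \<Phi>" for g
    proof -
      let ?l = "\<bar>fst g\<bar>"
      have l: "?l > 0" using ratio[OF g] by simp
      have eq: "\<bar>aff (aff_comp g h) x - t\<bar> \<le> R \<longleftrightarrow> \<bar>aff h x - (t - snd g) / fst g\<bar> \<le> R / ?l" for h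
      proof -
        have "aff (aff_comp g h) x - t = fst g * aff h x - (t - snd g)"
            by (simp add: aff_aff_comp aff_def[of g])
          also have "\<dots> = fst g * (aff h x - (t - snd g) / fst g)"
            using l by (subst right_diff_distrib) simp
          finally have d: "aff (aff_comp g h) x - t = fst g * (aff h x - (t - snd g) / fst g)" .
        show ?thesis unfolding d using l by (simp add: abs_mult pos_le_divide_eq mult.commute)
      qed
      have "\<psi> g = ?l powr sdim * (\<Sum>h\<in>stop n (\<rho> / ?l).
          \<bar>fst h\<bar> powr sdim * of_bool (\<bar>aff h x - (t - snd g) / fst g\<bar> \<le> R / ?l))"
        unfolding \<psi>_def eq by (simp add: abs_mult powr_mult sum_distrib_left mult.assoc)
      also have "\<dots> \<le> ?l powr sdim * ((1/\<gamma>) powr sdim * max (R / ?l) (\<rho> / ?l) powr sdim)"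
        using Suc.prems l div_ratio[OF _ g]
        by (intro mult_left_mono Suc.IH) auto
      also have "\<dots> = (1/\<gamma>) powr sdim * (?l * max (R / ?l) (\<rho> / ?l)) powr sdim"
        using Suc.prems l \<rho> by (subst powr_mult) (auto simp: max_def)
      also have "?l * max (R / ?l) (\<rho> / ?l) = max R \<rho>" using l by (auto simp: max_def field_simps)
      finally show ?thesis .
    qed
    have zero: "\<psi> g = 0" if "\<not> (\<exists>h\<in>stop n (\<rho> / \<bar>fst g\<bar>). \<bar>aff (aff_comp g h) x - t\<bar> \<le> R)" for g
      unfolding \<psi>_def using that by (intro sum.neutral) auto
    show ?thesis
    proof (cases "\<exists>g\<in>\<Phi>. \<psi> g \<noteq> 0")
      case True
      then obtain g where g: "g \<in> \<Phi>" "\<psi> g \<noteq> 0" by blast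
      have "\<psi> g' = 0" if g': "g' \<in> \<Phi> - {g}" for g'
      proof (rule ccontr)
        assume "\<psi> g' \<noteq> 0"
        with zero g obtain h h' where h: "h \<in> stop n (\<rho> / \<bar>fst g\<bar>)" "\<bar>aff (aff_comp g h) x - t\<bar> \<le> R"
          "h' \<in> stop n (\<rho> / \<bar>fst g'\<bar>)" "\<bar>aff (aff_comp g' h') x - t\<bar> \<le> R" by meson
        then have "2 * \<gamma> < \<bar>aff g (aff h x) - aff g' (aff h' x)\<bar>"
          using g g' stop_hull assms(5) by (intro \<gamma>(3)) auto
        then show False using h(2,4) False unfolding aff_aff_comp by (smt (verit))
      qed
      then have "(\<Sum>g\<in>\<Phi>. \<psi> g) = \<psi> g" using g fin by (simp add: sum.remove[OF fin g(1)])
      then show ?thesis using total bound[OF g(1)] by simp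
    next
      case False
      then show ?thesis using total by simp
    qed
  qed
qed

text \<open>
  The pieces close to the fixed point of a generator carry at least the weight of the corresponding
  cylinder, at every scale \<open>\<rho>\<close> not above the size of that cylinder.
\<close>
lemma stop_local:
  assumes "g \<in> \<Phi>" "aff g x1 = x1" "x1 \<in> J" "x \<in> J" "\<rho> \<le> \<bar>fst g\<bar> ^ k" "rmax ^ n \<le> \<rho>"
  shows "(\<bar>fst g\<bar> ^ k) powr sdim
         \<le> (\<Sum>h\<in>stop n \<rho>. \<bar>fst h\<bar> powr sdim * of_bool (\<bar>aff h x - x1\<bar> \<le> \<bar>fst g\<bar> ^ k))"
  using assms(5,6)
proof (induction k arbitrary: n \<rho>)
  case 0
  have "\<bar>aff h x - x1\<bar> \<le> 1" if "h \<in> stop n \<rho>" for h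
  proof -
    have "aff h x \<in> {0..1}" "x1 \<in> {0..1}" using stop_hull[OF that assms(4)] assms(3) J_unit by auto
    then show ?thesis by auto
  qed
  then have "(\<Sum>h\<in>stop n \<rho>. \<bar>fst h\<bar> powr sdim * of_bool (\<bar>aff h x - x1\<bar> \<le> \<bar>fst g\<bar> ^ 0))
      = (\<Sum>h\<in>stop n \<rho>. \<bar>fst h\<bar> powr sdim)"
    by (intro sum.cong) simp_all
  then show ?case by (simp add: sum_stop_weight)
next
  case (Suc k)
  let ?l = "\<bar>fst g\<bar>"
  have l: "?l > 0" "?l < 1" using ratio[OF assms(1)] by auto
  have "?l ^ Suc k < 1" using l by (intro power_Suc_less_one) auto
  then have \<rho>1: "\<rho> < 1" using Suc.prems by simp
  then obtain m where m: "n = Suc m" using Suc.prems by (cases n) auto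
  have eq: "\<bar>aff (aff_comp g h) x - x1\<bar> \<le> ?l ^ Suc k \<longleftrightarrow> \<bar>aff h x - x1\<bar> \<le> ?l ^ k" for h
  proof -
    have "aff (aff_comp g h) x - x1 = fst g * (aff h x - x1)"
      using assms(2) aff_diff[of g "aff h x" x1] by (simp add: aff_aff_comp)
    then show ?thesis using l by (simp add: abs_mult)
  qed
  have "(?l ^ Suc k) powr sdim = ?l powr sdim * (?l ^ k) powr sdim"
    using l by (simp add: powr_mult)
  also have "\<dots> \<le> ?l powr sdim * (\<Sum>h\<in>stop m (\<rho> / ?l). \<bar>fst h\<bar> powr sdim * of_bool (\<bar>aff h x - x1\<bar> \<le> ?l ^ k))"
    using Suc.prems l m div_ratio[OF _ assms(1)]
    by (intro mult_left_mono Suc.IH) (auto simp: field_simps)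
  also have "\<dots> = (\<Sum>h\<in>stop m (\<rho> / ?l). \<bar>fst (aff_comp g h)\<bar> powr sdim * of_bool (\<bar>aff (aff_comp g h) x - x1\<bar> \<le> ?l ^ Suc k))"
    unfolding eq by (simp add: abs_mult powr_mult sum_distrib_left mult.assoc)
  also have "\<dots> \<le> (\<Sum>g\<in>\<Phi>. \<Sum>h\<in>stop m (\<rho> / \<bar>fst g\<bar>). \<bar>fst (aff_comp g h)\<bar> powr sdim * of_bool (\<bar>aff (aff_comp g h) x - x1\<bar> \<le> ?l ^ Suc k))"
    using fin by (intro member_le_sum[OF assms(1)] sum_nonneg) auto
  also have "\<dots> = (\<Sum>h\<in>stop n \<rho>. \<bar>fst h\<bar> powr sdim * of_bool (\<bar>aff h x - x1\<bar> \<le> ?l ^ Suc k))"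
    unfolding m sum_stop_Suc[OF \<rho>1] ..
  finally show ?case .
qed

end

section \<open>Similarity dimension and Hausdorff dimension\<close>

text \<open>
  A subdivision into pieces of size comparable to \<open>\<rho>\<close> whose natural weights \<open>\<bar>l\<bar> ^ sdim\<close> form a probability
  that is regular from above (with constant \<open>C\<close>) down to scale \<open>\<rho>\<close> and charges the neighbourhoods of the
  fixed points of the generators. The position of a piece is read off at an arbitrary reference point
  \<open>x\<close> of the hull.
\<close>
definition (in ifs) scale_subdivision :: "real \<Rightarrow> real \<Rightarrow> (real \<times> real) set \<Rightarrow> bool" where
  "scale_subdivision C \<rho> G \<longleftrightarrow> subdivision G K \<and>
      (\<forall>h\<in>G. rmin * \<rho> \<le> \<bar>fst h\<bar> \<and> \<bar>fst h\<bar> \<le> \<rho>) \<and>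
      (\<Sum>h\<in>G. \<bar>fst h\<bar> powr sdim) = 1 \<and>
      (\<forall>x\<in>J. \<forall>t. \<forall>R>0.
         (\<Sum>h\<in>G. \<bar>fst h\<bar> powr sdim * of_bool (\<bar>aff h x - t\<bar> \<le> R)) \<le> C * max R \<rho> powr sdim) \<and>
      (\<forall>g\<in>\<Phi>. \<forall>x1\<in>J. \<forall>x\<in>J. \<forall>k. aff g x1 = x1 \<longrightarrow> \<rho> \<le> \<bar>fst g\<bar> ^ k \<longrightarrow>
         (\<bar>fst g\<bar> ^ k) powr sdim
         \<le> (\<Sum>h\<in>G. \<bar>fst h\<bar> powr sdim * of_bool (\<bar>aff h x - x1\<bar> \<le> \<bar>fst g\<bar> ^ k)))"

lemma (in ifs) scale_subdivision_ex:
  "\<exists>C\<ge>1. \<forall>\<rho>. 0 < \<rho> \<longrightarrow> \<rho> < 1 \<longrightarrow> (\<exists>G. scale_subdivision C \<rho> G)"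
proof -
  obtain \<gamma> where \<gamma>: "0 < \<gamma>" "\<gamma> \<le> 1"
      "\<And>g h x y. \<lbrakk>g \<in> \<Phi>; h \<in> \<Phi>; g \<noteq> h; x \<in> J; y \<in> J\<rbrakk> \<Longrightarrow> 2 * \<gamma> < \<bar>aff g x - aff h y\<bar>"
    using gap_ex by metis
  have "scale_subdivision ((1/\<gamma>) powr sdim) \<rho> (stop n \<rho>)" if \<rho>: "\<rho> < 1" and n: "rmax ^ n \<le> \<rho>" for \<rho> n
    unfolding scale_subdivision_def
    using subdivision_stop[of n \<rho>] stop_ratio[OF n \<rho>] sum_stop_weight[of n \<rho>]
      stop_regular[OF \<gamma> n] stop_local[OF _ _ _ _ _ n] by auto
  moreover have "\<exists>n. rmax ^ n \<le> \<rho>" if "0 < \<rho>" for \<rho>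
    using real_arch_pow_inv[OF that rmax(2)] less_imp_le by blast
  moreover have "1 \<le> (1/\<gamma>) powr sdim" using \<gamma> sdim(1) by (auto intro!: ge_one_powr_ge_zero)
  ultimately show ?thesis by blast
qed

lemma (in ifs) hausdorff_measure_zero:
  assumes "t > sdim"
  shows "hausdorff_measure t K = 0"
proof -
  have "hausdorff_premeasure \<delta> t K \<le> 0" if \<delta>: "\<delta> > 0" for \<delta>
  proof (rule ennreal_le_epsilon)
    fix e :: real assume e: "0 < e"
    have "((\<lambda>\<rho>. \<rho> powr (t - sdim)) \<longlongrightarrow> 0) (at_right 0)" using assms by real_asymp
    then have "eventually (\<lambda>\<rho>. \<rho> powr (t - sdim) < e) (at_right 0)"
      using e by (rule order_tendstoD(2))
    moreover have "eventually (\<lambda>\<rho>::real. \<rho> < min \<delta> 1) (at_right 0)"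
      using \<delta> by (intro eventually_at_rightI[of 0 "min \<delta> 1"]) auto
    moreover have "eventually (\<lambda>\<rho>::real. \<rho> > 0) (at_right 0)"
      by (rule eventually_at_right_less)
    ultimately have "eventually (\<lambda>\<rho>. \<rho> powr (t - sdim) < e \<and> \<rho> < min \<delta> 1 \<and> \<rho> > 0) (at_right 0)"
      by eventually_elim auto
    then obtain \<rho> where \<rho>: "\<rho> powr (t - sdim) < e" "\<rho> < \<delta>" "\<rho> < 1" "\<rho> > 0"
      using eventually_happens'[of "at_right (0::real)"] by (auto simp: trivial_limit_at_right_real)
    obtain n where "rmax ^ n < \<rho>" using real_arch_pow_inv[OF \<rho>(4) rmax(2)] by blast
    then have n: "rmax ^ n \<le> \<rho>" by simp
    define G where "G = stop n \<rho>"
    have G: "subdivision G K" "\<And>h. h \<in> G \<Longrightarrow> \<bar>fst h\<bar> \<le> \<rho>"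
        "(\<Sum>h\<in>G. \<bar>fst h\<bar> powr sdim) = 1"
      unfolding G_def using subdivision_stop stop_ratio[OF n \<rho>(3)] sum_stop_weight by auto
    have finG: "finite G" and KG: "K = (\<Union>g\<in>G. aff g ` K)" using G(1) by (auto simp: subdivision_def)
    obtain e' where e': "bij_betw e' {0..<card G} G" using ex_bij_betw_nat_finite[OF finG] by blast
    define U where "U i = (if i < card G then aff (e' i) ` K else {})" for i
    have diam: "bounded (aff g ` K) \<and> diameter (aff g ` K) \<le> \<bar>fst g\<bar>" for g
    proof
      show "bounded (aff g ` K)" unfolding aff_def
        using compact_K by (intro compact_imp_bounded compact_continuous_image continuous_intros)
      have "dist x y \<le> 1" if "x \<in> K" "y \<in> K" for x y
      proof -
        have "x \<in> {0..1}" "y \<in> {0..1}" using K_unit that by auto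
        then show ?thesis by (auto simp: dist_real_def)
      qed
      then show "diameter (aff g ` K) \<le> \<bar>fst g\<bar>" using K_ne
        by (intro diameter_le) (auto simp: aff_diff abs_mult dist_real_def intro!: mult_left_le)
    qed
    have "(\<Sum>i. diam_pow t (U i)) = (\<Sum>i\<in>{0..<card G}. diam_pow t (U i))"
      by (intro suminf_finite) (auto simp: U_def diam_pow_def)
    also have "\<dots> = (\<Sum>i\<in>{0..<card G}. diam_pow t (aff (e' i) ` K))"
      by (intro sum.cong) (auto simp: U_def)
    also have "\<dots> = (\<Sum>g\<in>G. diam_pow t (aff g ` K))"
      by (rule sum.reindex_bij_betw[OF e'])
    also have "\<dots> \<le> (\<Sum>g\<in>G. ennreal (\<rho> powr (t - sdim) * \<bar>fst g\<bar> powr sdim))"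
    proof (rule sum_mono)
      fix g assume g: "g \<in> G"
      have "diameter (aff g ` K) powr t \<le> \<bar>fst g\<bar> powr t"
        using diam[of g] assms sdim(1) diameter_ge_0[of "aff g ` K"] by (intro powr_mono2) auto
      also have "\<dots> = \<bar>fst g\<bar> powr (t - sdim) * \<bar>fst g\<bar> powr sdim"
        by (simp add: powr_add[symmetric])
      also have "\<dots> \<le> \<rho> powr (t - sdim) * \<bar>fst g\<bar> powr sdim"
        using G(2)[OF g] assms by (intro mult_right_mono powr_mono2) auto
      finally show "diam_pow t (aff g ` K) \<le> ennreal (\<rho> powr (t - sdim) * \<bar>fst g\<bar> powr sdim)"
        using assms sdim(1) K_ne by (auto simp: diam_pow_def intro: ennreal_leI)
    qed
    also have "\<dots> = ennreal (\<rho> powr (t - sdim) * (\<Sum>g\<in>G. \<bar>fst g\<bar> powr sdim))"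
      by (simp add: sum_ennreal sum_distrib_left)
    also have "\<dots> \<le> ennreal e" using \<rho> G(3) by (intro ennreal_leI) simp
    finally have le: "(\<Sum>i. diam_pow t (U i)) \<le> ennreal e" .
    have "K \<subseteq> (\<Union>i. U i)"
    proof
      fix x assume "x \<in> K"
      then obtain g where g: "g \<in> G" "x \<in> aff g ` K" using KG by blast
      then have "g \<in> e' ` {0..<card G}" using e' by (simp add: bij_betw_def)
      then obtain i where "i < card G" "e' i = g" by auto
      then have "x \<in> U i" using g by (simp add: U_def)
      then show "x \<in> (\<Union>i. U i)" by blast
    qed
    moreover have "bounded (U i) \<and> diameter (U i) \<le> \<delta>" for i
    proof (cases "i < card G")
      case True
      then have "e' i \<in> G" using e' by (auto simp: bij_betw_def)
      then show ?thesis using diam[of "e' i"] G(2)[of "e' i"] \<rho> True by (auto simp: U_def)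
    qed (use \<delta> in \<open>auto simp: U_def diameter_def\<close>)
    ultimately have "hausdorff_premeasure \<delta> t K \<le> (\<Sum>i. diam_pow t (U i))"
      unfolding hausdorff_premeasure_def by (intro INF_lower) auto
    then show "hausdorff_premeasure \<delta> t K \<le> 0 + ennreal e" using le by simp
  qed
  then have "hausdorff_measure t K \<le> 0" unfolding hausdorff_measure_def by (intro SUP_least) auto
  then show ?thesis by simp
qed

lemma (in ifs) hausdorff_dim_le: "hausdorff_dim K \<le> ennreal sdim"
proof (rule ennreal_le_epsilon)
  fix e :: real assume e: "0 < e"
  have "hausdorff_dim K \<le> ennreal (sdim + e)"
    unfolding hausdorff_dim_def using hausdorff_measure_zero[of "sdim + e"] sdim(1) e
    by (intro Inf_lower CollectI exI[of _ "sdim + e"]) auto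
  then show "hausdorff_dim K \<le> ennreal sdim + ennreal e" using sdim(1) e by simp
qed

lemma (in ifs) J_Icc: obtains \<alpha> \<beta> where "J = {\<alpha>..\<beta>}" "0 \<le> \<alpha>" "\<alpha> \<le> \<beta>" "\<beta> \<le> 1"
proof -
  have "connected J" "compact J" using compact_K by (auto intro: convex_connected compact_convex_hull)
  then obtain \<alpha> \<beta> where J: "J = {\<alpha>..\<beta>}" using connected_compact_interval_1 by blast
  then have "\<alpha> \<le> \<beta>" using J_ne by auto
  then have "{\<alpha>, \<beta>} \<subseteq> J" using J by auto
  then have "{\<alpha>, \<beta>} \<subseteq> {0..1}" using J_unit by blast
  with J \<open>\<alpha> \<le> \<beta>\<close> show ?thesis by (intro that[of \<alpha> \<beta>]) auto
qed

lemma measure_aff: "measure lborel (aff g ` {\<alpha>..\<beta>}) = \<bar>fst g\<bar> * measure lborel {\<alpha>..\<beta>}"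
proof (cases "fst g = 0")
  case True
  then have "aff g ` {\<alpha>..\<beta>} \<subseteq> {snd g}" by (auto simp: aff_def)
  then have "aff g ` {\<alpha>..\<beta>} = {} \<or> aff g ` {\<alpha>..\<beta>} = {snd g}" by (rule subset_singletonD)
  then show ?thesis using True by auto
next
  case False
  have "aff g ` {\<alpha>..\<beta>} = (\<lambda>x. snd g + x) ` ((\<lambda>x. fst g *\<^sub>R x) ` {\<alpha>..\<beta>})"
    by (auto simp: aff_def image_image add.commute)
  also have "measure lebesgue \<dots> = \<bar>fst g\<bar> * measure lebesgue {\<alpha>..\<beta>}"
    using measure_translation[of "snd g" "(\<lambda>x. fst g *\<^sub>R x) ` {\<alpha>..\<beta>}"] measure_lebesgue_affine[of "fst g" 0 "{\<alpha>..\<beta>}"]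
    by (simp add: image_image add.commute)
  finally show ?thesis
    by (simp add: aff_def image_affinity_atLeastAtMost split: if_splits)
qed

text \<open>A hull reduced to a point leaves room for a single map, whose similarity dimension is 0.\<close>
lemma (in ifs) hull_nondegenerate:
  assumes "sdim > 0" "J = {\<alpha>..\<beta>}" shows "\<alpha> < \<beta>"
proof (rule ccontr)
  assume "\<not> \<alpha> < \<beta>"
  then have KJ: "J = {\<alpha>}" using assms J_ne by auto
  have disj: "disjoint_family_on (\<lambda>g. aff g ` J) \<Phi>" using sub by (simp add: subdivision_def)
  have "aff g ` J = {\<alpha>}" if "g \<in> \<Phi>" for g
    using subdivision_hull[OF sub that] KJ by auto
  then have "g = h" if "g \<in> \<Phi>" "h \<in> \<Phi>" for g h
    using disj that unfolding disjoint_family_on_def by (metis inf.idem insert_not_empty)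
  then obtain g where "\<Phi> = {g}" using ne by blast
  then show False using ratio[of g] assms(1) powr_less_mono'[of "\<bar>fst g\<bar>" 0 sdim] sdim by auto
qed

text \<open>The images of the hull are disjoint subintervals of it, so their lengths add up to at most its length.\<close>
lemma (in ifs) sdim_le_1: "sdim \<le> 1"
proof (rule ccontr)
  assume s: "\<not> sdim \<le> 1"
  obtain \<alpha> \<beta> where J: "J = {\<alpha>..\<beta>}" "0 \<le> \<alpha>" "\<alpha> \<le> \<beta>" "\<beta> \<le> 1" by (rule J_Icc)
  have disj: "disjoint_family_on (\<lambda>g. aff g ` J) \<Phi>" using sub by (simp add: subdivision_def)
  have \<alpha>\<beta>: "\<alpha> < \<beta>" using s hull_nondegenerate[OF _ J(1)] by simp
  have "compact (aff g ` J)" for g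
    unfolding aff_def J by (intro compact_continuous_image continuous_intros) auto
  then have im: "aff g ` J \<in> sets lborel \<and> emeasure lborel (aff g ` J) < \<infinity>" for g
    using borel_compact[of "aff g ` J"] emeasure_compact_finite[of "aff g ` J"] by simp
  have "(\<Sum>g\<in>\<Phi>. \<bar>fst g\<bar> * (\<beta> - \<alpha>)) = (\<Sum>g\<in>\<Phi>. measure lborel (aff g ` J))"
    using J by (simp add: measure_aff)
  also have "\<dots> = measure lborel (\<Union>g\<in>\<Phi>. aff g ` J)"
    using fin disj im by (intro measure_finite_Union[symmetric]) (simp_all add: image_subset_iff less_top)
  also have "\<dots> \<le> measure lborel J"
  proof (rule measure_mono_fmeasurable)
    show "(\<Union>g\<in>\<Phi>. aff g ` J) \<subseteq> J" using subdivision_hull[OF sub] by blast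
    show "(\<Union>g\<in>\<Phi>. aff g ` J) \<in> sets lborel" using fin im by (auto intro!: sets.finite_UN)
    show "J \<in> fmeasurable lborel" using J by (simp add: fmeasurable_def)
  qed
  also have "\<dots> = \<beta> - \<alpha>" using J by simp
  finally have "(\<Sum>g\<in>\<Phi>. \<bar>fst g\<bar>) \<le> 1"
    using \<alpha>\<beta> by (simp add: sum_distrib_right[symmetric])
  moreover have "(\<Sum>g\<in>\<Phi>. \<bar>fst g\<bar> powr sdim) < (\<Sum>g\<in>\<Phi>. \<bar>fst g\<bar>)"
    using ratio s powr_less_mono'[of _ 1 sdim] fin ne by (intro sum_strict_mono) force+
  ultimately have "(\<Sum>g\<in>\<Phi>. \<bar>fst g\<bar> powr sdim) < 1" by simp
  then show False using sdim(2) by simp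
qed

lemma self_similar_ifs:
  assumes "self_similar_cantor_set K"
  shows "\<exists>\<Phi>. ifs \<Phi> K"
proof -
  obtain A :: "nat set" and f where g: "generates A f K"
    and K: "compact K" "K \<noteq> {}" "K \<subseteq> {0..1}"
    using assms by (auto simp: self_similar_cantor_set_def)
  have "\<forall>a\<in>A. \<exists>p. 0 < \<bar>fst p\<bar> \<and> \<bar>fst p\<bar> < 1 \<and> f a = aff p"
    using g by (fastforce simp: generates_def contracting_similarity_def aff_def fun_eq_iff)
  then obtain p where p: "\<And>a. a \<in> A \<Longrightarrow> 0 < \<bar>fst (p a)\<bar> \<and> \<bar>fst (p a)\<bar> < 1 \<and> f a = aff (p a)"
    by metis
  have "subdivision (p ` A) K"
    unfolding subdivision_def
  proof (intro conjI)
    show "finite (p ` A)" using g by (simp add: generates_def)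
    have "K = (\<Union>a\<in>A. f a ` K)" using g by (simp add: generates_def)
    also have "\<dots> = (\<Union>g\<in>p ` A. aff g ` K)" using p by auto
    finally show "K = (\<Union>g\<in>p ` A. aff g ` K)" .
    have "aff (p a) ` (convex hull K) \<inter> aff (p b) ` (convex hull K) = {}"
      if "a \<in> A" "b \<in> A" "p a \<noteq> p b" for a b
      using g p that unfolding generates_def disjoint_family_on_def by metis
    then show "disjoint_family_on (\<lambda>g. aff g ` (convex hull K)) (p ` A)"
      by (auto simp: disjoint_family_on_def)
  qed
  then have "ifs (p ` A) K" using p K by unfold_locales auto
  then show ?thesis by blast
qed

lemma (in ifs) fixed_point:
  assumes "g \<in> \<Phi>"
  obtains x where "x \<in> J" "aff g x = x"
proof -
  have "compact J" using compact_K by (rule compact_convex_hull)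
  moreover have "continuous_on J (aff g)" unfolding aff_def by (intro continuous_intros)
  ultimately show ?thesis
    using brouwer[of J "aff g"] J_ne subdivision_hull[OF sub assms] that by (auto simp: convex_convex_hull)
qed

section \<open>Energy of projections\<close>

lemma powr_le_dyadic_sum:
  fixes D \<rho> s :: real
  assumes "0 < D" "D \<le> 1" "s \<le> 1" "(1/2) ^ Suc J < D"
  shows "D powr (s - 1) \<le> (\<Sum>j\<le>J. 2 powr ((real j + 1) * (1 - s)) * of_bool (D \<le> (1/2) ^ j))"
proof -
  define n where "n = (LEAST n. (1/2::real) ^ n < D)"
  have n: "(1/2) ^ n < D" unfolding n_def using assms(4) by (rule LeastI)
  have "n \<le> Suc J" unfolding n_def using assms(4) by (rule Least_le)
  moreover have "n \<noteq> 0" using n assms(2) by (cases n) auto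
  ultimately obtain j where j: "n = Suc j" "j \<le> J" by (cases n) auto
  have "\<not> (1/2) ^ j < D" using not_less_Least[of j "\<lambda>n. (1/2::real) ^ n < D"] j(1) by (simp add: n_def)
  then have Dj: "D \<le> (1/2) ^ j" by simp
  have "D powr (s - 1) \<le> ((1/2) ^ n) powr (s - 1)"
    using n assms by (intro powr_mono2') auto
  also have "(1/2::real) ^ n = 2 powr (- real n)"
    by (simp add: powr_minus powr_realpow power_one_over inverse_eq_divide)
  also have "(2 powr (- real n)) powr (s - 1) = 2 powr ((real j + 1) * (1 - s))"
    using j by (simp add: powr_powr algebra_simps)
  also have "\<dots> = 2 powr ((real j + 1) * (1 - s)) * of_bool (D \<le> (1/2) ^ j)" using Dj by simp
  also have "\<dots> \<le> (\<Sum>j\<le>J. 2 powr ((real j + 1) * (1 - s)) * of_bool (D \<le> (1/2) ^ j))"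
    using j(2) by (intro member_le_sum) auto
  finally show ?thesis .
qed

text \<open>
  Potential estimate: for weights that are \<open>s'\<close>-regular from above, the kernel \<open>\<bar>y\<bar> ^ (s - 1)\<close>, cut off at
  \<open>\<rho>\<close>, has a bounded sum as soon as \<open>s + s' > 1\<close>. The proof sums over dyadic shells.
\<close>
lemma singular_sum_bound:
  fixes y :: "'b \<Rightarrow> real"
  assumes B: "finite B" "\<And>b. b \<in> B \<Longrightarrow> 0 \<le> v b" "\<And>b. b \<in> B \<Longrightarrow> y b \<in> {0..1}"
    and reg: "\<And>t R. \<rho> \<le> R \<Longrightarrow> (\<Sum>b\<in>B. v b * of_bool (\<bar>y b - t\<bar> \<le> R)) \<le> C * R powr s'"
    and \<rho>: "0 < \<rho>" "\<rho> \<le> 1" and s: "s \<le> 1" "1 < s + s'" "0 \<le> s" and C: "0 \<le> C"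
    and c: "c \<in> B"
  shows "(\<Sum>b\<in>B. v b * max \<bar>y c - y b\<bar> \<rho> powr (s - 1)) \<le> 2 * C / (1 - 2 powr (1 - s - s'))"
proof -
  let ?D = "\<lambda>b. max \<bar>y c - y b\<bar> \<rho>"
  let ?q = "2 powr (1 - s - s')"
  have q: "0 < ?q" "?q < 1" using s powr_less_cancel_iff[of 2 "1 - s - s'" 0] by auto
  obtain J where "(1/2) ^ J < \<rho>" using real_arch_pow_inv[OF \<rho>(1), of "1/2"] by auto
  moreover have "(1/2::real) ^ Suc J \<le> (1/2) ^ J" by simp
  ultimately have J: "(1/2) ^ Suc J < \<rho>" by linarith
  have "v b * ?D b powr (s - 1)
      \<le> (\<Sum>j\<le>J. 2 powr ((real j + 1) * (1 - s)) * (v b * of_bool (?D b \<le> (1/2) ^ j)))" if b: "b \<in> B" for b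
  proof -
    have "\<bar>y c - y b\<bar> \<le> 1" using B(3)[OF c] B(3)[OF b] by auto
    then have "?D b powr (s - 1) \<le> (\<Sum>j\<le>J. 2 powr ((real j + 1) * (1 - s)) * of_bool (?D b \<le> (1/2) ^ j))"
      using \<rho> J s less_le_trans[OF J max.cobounded2[of \<rho> "\<bar>y c - y b\<bar>"]]
      by (intro powr_le_dyadic_sum) auto
    then have "v b * ?D b powr (s - 1) \<le> v b * (\<Sum>j\<le>J. 2 powr ((real j + 1) * (1 - s)) * of_bool (?D b \<le> (1/2) ^ j))"
      using B(2)[OF b] by (intro mult_left_mono)
    then show ?thesis unfolding sum_distrib_left by (simp only: mult.left_commute)
  qed
  then have "(\<Sum>b\<in>B. v b * ?D b powr (s - 1))
      \<le> (\<Sum>b\<in>B. \<Sum>j\<le>J. 2 powr ((real j + 1) * (1 - s)) * (v b * of_bool (?D b \<le> (1/2) ^ j)))"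
    by (rule sum_mono)
  also have "\<dots> = (\<Sum>j\<le>J. 2 powr ((real j + 1) * (1 - s)) * (\<Sum>b\<in>B. v b * of_bool (?D b \<le> (1/2) ^ j)))"
    by (subst sum.swap) (simp add: sum_distrib_left)
  also have "\<dots> \<le> (\<Sum>j\<le>J. 2 * C * ?q ^ j)"
  proof (rule sum_mono)
    fix j assume "j \<in> {..J}"
    have half: "(1/2::real) ^ j = 2 powr (- real j)"
      by (simp add: powr_minus powr_realpow power_one_over inverse_eq_divide)
    have "(\<Sum>b\<in>B. v b * of_bool (?D b \<le> (1/2) ^ j)) \<le> C * ((1/2) ^ j) powr s'"
    proof (cases "\<rho> \<le> (1/2) ^ j")
      case True
      have "(\<Sum>b\<in>B. v b * of_bool (?D b \<le> (1/2) ^ j)) \<le> (\<Sum>b\<in>B. v b * of_bool (\<bar>y b - y c\<bar> \<le> (1/2) ^ j))"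
        using B(2) by (intro sum_mono mult_left_mono) (auto simp: abs_minus_commute)
      then show ?thesis using reg[OF True, of "y c"] by linarith
    next
      case False
      then show ?thesis using C by simp
    qed
    then have "2 powr ((real j + 1) * (1 - s)) * (\<Sum>b\<in>B. v b * of_bool (?D b \<le> (1/2) ^ j))
        \<le> 2 powr ((real j + 1) * (1 - s)) * (C * ((1/2) ^ j) powr s')"
      by (intro mult_left_mono) auto
    also have "\<dots> = C * (2 powr ((real j + 1) * (1 - s)) * 2 powr (- real j * s'))"
      unfolding half by (simp add: powr_powr)
    also have "2 powr ((real j + 1) * (1 - s)) * 2 powr (- real j * s') = 2 powr (1 - s) * ?q ^ j"
      by (simp add: powr_add[symmetric] powr_realpow[symmetric] powr_powr algebra_simps)
    also have "C * (2 powr (1 - s) * ?q ^ j) \<le> C * (2 * ?q ^ j)"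
      using C s powr_mono[of "1 - s" 1 2] by (intro mult_left_mono mult_right_mono) auto
    finally show "2 powr ((real j + 1) * (1 - s)) * (\<Sum>b\<in>B. v b * of_bool (?D b \<le> (1/2) ^ j)) \<le> 2 * C * ?q ^ j"
      by (simp add: mult_ac)
  qed
  also have "\<dots> = 2 * C * (\<Sum>j\<le>J. ?q ^ j)" by (simp add: sum_distrib_left)
  also have "\<dots> \<le> 2 * C * (1 / (1 - ?q))"
  proof -
    have "(\<Sum>j\<le>J. ?q ^ j) \<le> (\<Sum>j. ?q ^ j)" using q by (intro sum_le_suminf summable_geometric) auto
    also have "\<dots> = 1 / (1 - ?q)" using q by (intro suminf_geometric) auto
    finally show ?thesis using C by (intro mult_left_mono) auto
  qed
  finally show ?thesis by simp
qed

text \<open>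
  Transversality: the slopes \<open>r\<close> for which two points at horizontal and vertical displacement \<open>X\<close>, \<open>Y\<close>
  have nearly the same projection \<open>x + r y\<close> form a set of measure at most of order \<open>\<rho> / \<bar>Y\<bar>\<close>,
  which is empty unless \<open>\<bar>X\<bar>\<close> is dominated by \<open>\<bar>Y\<bar>\<close> (with \<open>\<bar>Y\<bar>\<close> cut off at \<open>\<rho>\<close>).
\<close>
lemma slope_measure_bound:
  fixes X Y N \<delta> \<rho> :: real
  assumes "1 \<le> N" "0 < \<delta>" "\<delta> \<le> \<rho>"
  shows "measure lborel {r \<in> {-N..N}. \<bar>X + r * Y\<bar> \<le> 2 * \<delta>}
    \<le> 4 * N * \<rho> / max \<bar>Y\<bar> \<rho> * of_bool (\<bar>X\<bar> \<le> (N + 2) * max \<bar>Y\<bar> \<rho>)"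
proof (cases "{r \<in> {-N..N}. \<bar>X + r * Y\<bar> \<le> 2 * \<delta>} = {}")
  case True
  have "0 \<le> 4 * N * \<rho> / max \<bar>Y\<bar> \<rho> * of_bool (\<bar>X\<bar> \<le> (N + 2) * max \<bar>Y\<bar> \<rho>)" using assms by simp
  then show ?thesis by (subst True) simp
next
  case False
  define D where "D = max \<bar>Y\<bar> \<rho>"
  have D: "D > 0" "\<bar>Y\<bar> \<le> D" "\<rho> \<le> D" using assms by (auto simp: D_def)
  from False obtain r where "r \<in> {-N..N}" and r2: "\<bar>X + r * Y\<bar> \<le> 2 * \<delta>" by blast
  then have r: "\<bar>r\<bar> \<le> N" "\<bar>X + r * Y\<bar> \<le> 2 * \<delta>" by auto
  have "\<bar>r * Y\<bar> \<le> N * D" unfolding abs_mult using r D by (intro mult_mono) auto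
  then have XN: "\<bar>X\<bar> \<le> (N + 2) * D" using r(2) assms D by (simp add: algebra_simps)
  have meas: "measure lborel {r \<in> {-N..N}. \<bar>X + r * Y\<bar> \<le> 2 * \<delta>} \<le> u - l"
    if "{r \<in> {-N..N}. \<bar>X + r * Y\<bar> \<le> 2 * \<delta>} \<subseteq> {l..u}" "l \<le> u" for l u
  proof -
    have "measure lborel {r \<in> {-N..N}. \<bar>X + r * Y\<bar> \<le> 2 * \<delta>} \<le> measure lborel {l..u}"
      using that by (intro measure_mono_fmeasurable) (auto simp: fmeasurable_def)
    then show ?thesis using that by simp
  qed
  have "measure lborel {r \<in> {-N..N}. \<bar>X + r * Y\<bar> \<le> 2 * \<delta>} \<le> 4 * N * \<rho> / D"
  proof (cases "\<bar>Y\<bar> \<le> \<rho>")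
    case True
    then have "D = \<rho>" by (simp add: D_def)
    moreover have "measure lborel {r \<in> {-N..N}. \<bar>X + r * Y\<bar> \<le> 2 * \<delta>} \<le> N - (- N)"
      using assms by (intro meas) auto
    ultimately show ?thesis using assms by simp
  next
    case False
    then have DY: "D = \<bar>Y\<bar>" by (simp add: D_def)
    have "{r \<in> {-N..N}. \<bar>X + r * Y\<bar> \<le> 2 * \<delta>} \<subseteq> {- X / Y - 2 * \<delta> / D .. - X / Y + 2 * \<delta> / D}"
    proof
      fix r assume "r \<in> {r \<in> {-N..N}. \<bar>X + r * Y\<bar> \<le> 2 * \<delta>}"
      moreover have "X + r * Y = Y * (r - (- X / Y))" using D DY by (simp add: field_simps)
      ultimately have "D * \<bar>r - (- X / Y)\<bar> \<le> 2 * \<delta>" by (simp add: abs_mult DY)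
      then have "\<bar>r - (- X / Y)\<bar> \<le> 2 * \<delta> / D" using D by (simp add: field_simps)
      then show "r \<in> {- X / Y - 2 * \<delta> / D .. - X / Y + 2 * \<delta> / D}"
        unfolding atLeastAtMost_iff by (smt (verit))
    qed
    then have "measure lborel {r \<in> {-N..N}. \<bar>X + r * Y\<bar> \<le> 2 * \<delta>} \<le> - X / Y + 2 * \<delta> / D - (- X / Y - 2 * \<delta> / D)"
      using D assms by (intro meas) auto
    also have "\<dots> = 4 * \<delta> / D" by simp
    also have "\<dots> \<le> 4 * N * \<rho> / D"
      using assms D mult_mono[of 1 N \<delta> \<rho>] by (intro divide_right_mono) auto
    finally show ?thesis .
  qed
  then show ?thesis using XN by (simp add: D_def)
qed

text \<open>
  The energy estimate behind Marstrand's projection theorem, at a finite scale: summed over pairs of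
  points of a product of two regular weighted sets, the measure of the slopes that identify the pair
  up to \<open>\<delta> \<le> \<rho>\<close> is of order \<open>\<rho>\<close>.
\<close>
lemma energy_bound:
  fixes x :: "'a \<Rightarrow> real" and y :: "'b \<Rightarrow> real"
  assumes A: "finite A" "\<And>a. a \<in> A \<Longrightarrow> 0 \<le> w a" "(\<Sum>a\<in>A. w a) = 1"
    and B: "finite B" "\<And>b. b \<in> B \<Longrightarrow> 0 \<le> v b" "(\<Sum>b\<in>B. v b) = 1" "\<And>b. b \<in> B \<Longrightarrow> y b \<in> {0..1}"
    and regA: "\<And>t R. \<rho> \<le> R \<Longrightarrow> (\<Sum>a\<in>A. w a * of_bool (\<bar>x a - t\<bar> \<le> R)) \<le> Ca * R powr s"
    and regB: "\<And>t R. \<rho> \<le> R \<Longrightarrow> (\<Sum>b\<in>B. v b * of_bool (\<bar>y b - t\<bar> \<le> R)) \<le> Cb * R powr s'"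
    and \<rho>: "0 < \<rho>" "\<rho> \<le> 1" and s: "0 \<le> s" "s \<le> 1" "1 < s + s'" and C: "0 \<le> Ca" "0 \<le> Cb"
    and N: "1 \<le> N" and \<delta>: "0 < \<delta>" "\<delta> \<le> \<rho>"
  shows "(\<Sum>(a,b)\<in>A\<times>B. \<Sum>(a',b')\<in>A\<times>B. (w a * v b) * (w a' * v b') *
            measure lborel {r \<in> {-N..N}. \<bar>x a - x a' + r * (y b - y b')\<bar> \<le> 2 * \<delta>})
         \<le> 8 * N * (N + 2) powr s * Ca * Cb / (1 - 2 powr (1 - s - s')) * \<rho>"
proof -
  define D where "D b b' = max \<bar>y b - y b'\<bar> \<rho>" for b b'
  have D: "D b b' > 0" "\<rho> \<le> D b b'" for b b' using \<rho> by (auto simp: D_def)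
  let ?c = "4 * N * \<rho> * (Ca * (N + 2) powr s)"
  have inner: "(\<Sum>a'\<in>A. w a' * measure lborel {r \<in> {-N..N}. \<bar>x a - x a' + r * (y b - y b')\<bar> \<le> 2 * \<delta>})
     \<le> ?c * D b b' powr (s - 1)" for a b b'
  proof -
    have "(\<Sum>a'\<in>A. w a' * measure lborel {r \<in> {-N..N}. \<bar>x a - x a' + r * (y b - y b')\<bar> \<le> 2 * \<delta>})
        \<le> (\<Sum>a'\<in>A. w a' * (4 * N * \<rho> / D b b' * of_bool (\<bar>x a' - x a\<bar> \<le> (N + 2) * D b b')))"
      unfolding D_def abs_minus_commute[of "x _" "x a"]
      using A(2) slope_measure_bound[OF N \<delta>] by (intro sum_mono mult_left_mono) auto
    also have "\<dots> = 4 * N * \<rho> / D b b' * (\<Sum>a'\<in>A. w a' * of_bool (\<bar>x a' - x a\<bar> \<le> (N + 2) * D b b'))"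
      unfolding sum_distrib_left by (intro sum.cong refl) simp
    also have "\<dots> \<le> 4 * N * \<rho> / D b b' * (Ca * ((N + 2) * D b b') powr s)"
      using D[of b b'] N \<rho> mult_mono[of 1 "N + 2" \<rho> "D b b'"] by (intro mult_left_mono regA) auto
    also have "\<dots> = ?c * (D b b' powr s / D b b')" using D[of b b'] N by (simp add: powr_mult)
    also have "D b b' powr s / D b b' = D b b' powr (s - 1)" using D[of b b'] by (simp add: powr_diff)
    finally show ?thesis .
  qed
  have "(\<Sum>(a,b)\<in>A\<times>B. \<Sum>(a',b')\<in>A\<times>B. (w a * v b) * (w a' * v b') *
            measure lborel {r \<in> {-N..N}. \<bar>x a - x a' + r * (y b - y b')\<bar> \<le> 2 * \<delta>})
      = (\<Sum>a\<in>A. w a * (\<Sum>b\<in>B. v b * (\<Sum>b'\<in>B. v b' *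
          (\<Sum>a'\<in>A. w a' * measure lborel {r \<in> {-N..N}. \<bar>x a - x a' + r * (y b - y b')\<bar> \<le> 2 * \<delta>}))))"
    unfolding sum.cartesian_product[symmetric] sum_distrib_left
    by (intro sum.cong refl, subst sum.swap) (simp add: mult_ac)
  also have "\<dots> \<le> (\<Sum>a\<in>A. w a * (\<Sum>b\<in>B. v b * (\<Sum>b'\<in>B. v b' * (?c * D b b' powr (s - 1)))))"
    using A(2) B(2) inner by (intro sum_mono mult_left_mono) auto
  also have "\<dots> = ?c * (\<Sum>b\<in>B. v b * (\<Sum>b'\<in>B. v b' * D b b' powr (s - 1)))"
    unfolding sum_distrib_right[symmetric] A(3) by (simp add: sum_distrib_left mult_ac)
  also have "\<dots> \<le> ?c * (\<Sum>b\<in>B. v b * (2 * Cb / (1 - 2 powr (1 - s - s'))))"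
    unfolding D_def
    using B C N \<rho> s by (intro mult_left_mono sum_mono singular_sum_bound[OF B(1,2,4) regB]) auto
  also have "\<dots> = ?c * (2 * Cb / (1 - 2 powr (1 - s - s')))"
    unfolding sum_distrib_right[symmetric] B(3) by simp
  finally show ?thesis by (simp add: mult_ac)
qed

section \<open>Slopes with spread-out projections\<close>

text \<open>
  The weight of the pairs of points that the projection \<open>x + r y\<close> brings within distance \<open>2 \<delta>\<close>.
\<close>
definition close_mass :: "'p set \<Rightarrow> ('p \<Rightarrow> real) \<Rightarrow> ('p \<Rightarrow> real) \<Rightarrow> ('p \<Rightarrow> real) \<Rightarrow> real \<Rightarrow> real \<Rightarrow> real" where
  "close_mass P w X Y \<delta> r =
     (\<Sum>p\<in>P. \<Sum>q\<in>P. w p * w q * of_bool (\<bar>X p - X q + r * (Y p - Y q)\<bar> \<le> 2 * \<delta>))"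

text \<open>
  The weight of the points projected into the \<open>\<delta>\<close>-neighbourhood of \<open>t\<close>; up to a factor \<open>2 \<delta>\<close>, a smoothed
  density of the projected measure.
\<close>
definition local_mass :: "'p set \<Rightarrow> ('p \<Rightarrow> real) \<Rightarrow> ('p \<Rightarrow> real) \<Rightarrow> ('p \<Rightarrow> real) \<Rightarrow> real \<Rightarrow> real \<Rightarrow> real \<Rightarrow> real" where
  "local_mass P w X Y \<delta> r t = (\<Sum>p\<in>P. w p * of_bool (\<bar>t - (X p + r * Y p)\<bar> \<le> \<delta>))"

lemma sum_sum_ennreal:
  assumes "\<And>p q. p \<in> P \<Longrightarrow> q \<in> P \<Longrightarrow> 0 \<le> f p q"
  shows "(\<Sum>p\<in>P. \<Sum>q\<in>P. ennreal (f p q)) = ennreal (\<Sum>p\<in>P. \<Sum>q\<in>P. f p q)"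
proof -
  have "(\<Sum>p\<in>P. \<Sum>q\<in>P. ennreal (f p q)) = (\<Sum>p\<in>P. ennreal (\<Sum>q\<in>P. f p q))"
    using assms by (intro sum.cong refl sum_ennreal)
  also have "\<dots> = ennreal (\<Sum>p\<in>P. \<Sum>q\<in>P. f p q)"
    using assms by (intro sum_ennreal sum_nonneg)
  finally show ?thesis .
qed

lemma bad_slopes_measure:
  assumes P: "finite P" "\<And>p. p \<in> P \<Longrightarrow> 0 \<le> w p" and h: "0 < h"
  shows "emeasure lborel {r \<in> {-N..N}. h < close_mass P w X Y \<delta> r}
    \<le> ennreal ((\<Sum>p\<in>P. \<Sum>q\<in>P. w p * w q *
          measure lborel {r \<in> {-N..N}. \<bar>X p - X q + r * (Y p - Y q)\<bar> \<le> 2 * \<delta>}) / h)"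
proof -
  let ?H = "close_mass P w X Y \<delta>"
  let ?S = "\<lambda>p q. {r \<in> {-N..N}. \<bar>X p - X q + r * (Y p - Y q)\<bar> \<le> 2 * \<delta>}"
  have S: "?S p q \<in> sets borel" "emeasure lborel (?S p q) = ennreal (measure lborel (?S p q))" for p q
  proof -
    show m: "?S p q \<in> sets borel" by measurable
    have "?S p q \<subseteq> {-N..N}" by blast
    then have "?S p q \<in> fmeasurable lborel"
      using m by (intro fmeasurableI2[OF fmeasurable_compact[OF compact_Icc[of "-N" N]]]) simp_all
    then show "emeasure lborel (?S p q) = ennreal (measure lborel (?S p q))"
      by (rule emeasure_eq_measure2)
  qed
  have [measurable]: "?H \<in> borel_measurable borel" unfolding close_mass_def by measurable
  have sub: "{r \<in> {-N..N}. h < ?H r} \<subseteq> {r \<in> {-N..N}. 1 \<le> ennreal (1 / h) * ennreal (?H r)}"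
  proof
    fix r assume r: "r \<in> {r \<in> {-N..N}. h < ?H r}"
    then have "1 \<le> 1 / h * ?H r" using h by simp
    then have "ennreal 1 \<le> ennreal (1 / h * ?H r)" by (rule ennreal_leI)
    also have "ennreal (1 / h * ?H r) = ennreal (1 / h) * ennreal (?H r)"
      using h by (intro ennreal_mult') simp
    finally have "1 \<le> ennreal (1 / h) * ennreal (?H r)" by simp
    then show "r \<in> {r \<in> {-N..N}. 1 \<le> ennreal (1 / h) * ennreal (?H r)}"
      using r by blast
  qed
  have "emeasure lborel {r \<in> {-N..N}. h < ?H r} \<le> emeasure lborel {r \<in> {-N..N}. 1 \<le> ennreal (1 / h) * ennreal (?H r)}"
    using sub by (rule emeasure_mono) measurable
  also have "\<dots> \<le> ennreal (1 / h) * (\<integral>\<^sup>+r. ennreal (?H r) * indicator {-N..N} r \<partial>lborel)"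
    by (rule nn_integral_Markov_inequality) measurable
  also have "(\<integral>\<^sup>+r. ennreal (?H r) * indicator {-N..N} r \<partial>lborel)
      = (\<integral>\<^sup>+r. (\<Sum>p\<in>P. \<Sum>q\<in>P. ennreal (w p * w q) * indicator (?S p q) r) \<partial>lborel)"
  proof (intro nn_integral_cong)
    fix r
    have "ennreal (?H r) = (\<Sum>p\<in>P. \<Sum>q\<in>P. ennreal (w p * w q * of_bool (\<bar>X p - X q + r * (Y p - Y q)\<bar> \<le> 2 * \<delta>)))"
      unfolding close_mass_def using P by (intro sum_sum_ennreal[symmetric]) auto
    then show "ennreal (?H r) * indicator {-N..N} r = (\<Sum>p\<in>P. \<Sum>q\<in>P. ennreal (w p * w q) * indicator (?S p q) r)"
      by (auto simp: sum_distrib_right indicator_def intro!: sum.cong)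
  qed
  also have "\<dots> = (\<Sum>p\<in>P. \<Sum>q\<in>P. ennreal (w p * w q) * emeasure lborel (?S p q))"
    using S(1) by (simp add: nn_integral_sum nn_integral_cmult_indicator)
  also have "\<dots> = ennreal (\<Sum>p\<in>P. \<Sum>q\<in>P. w p * w q * measure lborel (?S p q))"
    unfolding S(2) using P by (subst sum_sum_ennreal[symmetric]) (auto simp: ennreal_mult' intro!: sum.cong)
  also have "ennreal (1 / h) * \<dots> = ennreal ((\<Sum>p\<in>P. \<Sum>q\<in>P. w p * w q * measure lborel (?S p q)) / h)"
    using h by (simp add: ennreal_mult'[symmetric])
  finally show ?thesis .
qed

text \<open>
  If few pairs are identified in direction \<open>r\<close>, then the smoothed density has a small second moment and
  hence cannot concentrate: it exceeds half its mean over the window of radius \<open>d\<close> on a set whose measure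
  is bounded below.
\<close>
lemma level_set_measure:
  assumes P: "finite P" "\<And>p. p \<in> P \<Longrightarrow> 0 \<le> w p" and W: "W = (\<Sum>p\<in>P. w p)" "0 < W"
    and \<delta>: "0 < \<delta>" and d: "0 < d"
    and near: "\<And>p. p \<in> P \<Longrightarrow> \<bar>X p + r * Y p - z\<bar> + \<delta> \<le> d"
    and h: "close_mass P w X Y \<delta> r \<le> h" "0 < h"
  shows "{t. \<delta> * W / (2 * d) \<le> local_mass P w X Y \<delta> r t} \<subseteq> {z - d..z + d}"
    and "\<delta> * W\<^sup>2 / (2 * h) \<le> measure lborel {t. \<delta> * W / (2 * d) \<le> local_mass P w X Y \<delta> r t}"
proof -
  define \<theta> where "\<theta> = \<delta> * W / (2 * d)"
  define \<phi> where "\<phi> = local_mass P w X Y \<delta> r"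
  define I where "I p = {X p + r * Y p - \<delta> .. X p + r * Y p + \<delta>}" for p
  define T where "T = {t. \<theta> \<le> \<phi> t}"
  have \<theta>: "\<theta> > 0" using \<delta> W d by (simp add: \<theta>_def)
  have \<phi>: "\<phi> t = (\<Sum>p\<in>P. w p * indicator (I p) t)" for t
    unfolding \<phi>_def local_mass_def I_def by (intro sum.cong refl) (auto simp: indicator_def abs_le_iff)
  have \<phi>0: "0 \<le> \<phi> t" for t unfolding \<phi> using P by (intro sum_nonneg) auto
  have out: "\<phi> t = 0" if "t \<notin> {z - d..z + d}" for t
    unfolding \<phi> using near that by (intro sum.neutral) (fastforce simp: I_def indicator_def abs_le_iff)
  have sub: "T \<subseteq> {z - d..z + d}"
  proof
    fix t assume "t \<in> T"
    then have "\<phi> t \<noteq> 0" using \<theta> by (auto simp: T_def)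
    then show "t \<in> {z - d..z + d}" using out by blast
  qed
  then show "{t. \<delta> * W / (2 * d) \<le> local_mass P w X Y \<delta> r t} \<subseteq> {z - d..z + d}"
    by (simp add: T_def \<theta>_def \<phi>_def)
  have [measurable]: "\<phi> \<in> borel_measurable borel"
    unfolding \<phi>_def local_mass_def by measurable
  have Tm [measurable]: "T \<in> sets borel" unfolding T_def by measurable
  have Tf: "T \<in> fmeasurable lborel"
    using sub Tm by (intro fmeasurableI2[OF fmeasurable_compact[OF compact_Icc[of "z - d" "z + d"]]]) simp_all
  have If: "I p \<in> fmeasurable lborel" for p
    unfolding I_def by (intro fmeasurable_compact compact_Icc)
  have mI: "measure lborel (I p) = 2 * \<delta>" for p using \<delta> by (simp add: I_def)
  have intI: "integrable lborel (indicator (I p) :: real \<Rightarrow> real)" for p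
    using If[of p] by (simp add: integrable_indicator_iff fmeasurable_def)
  have II: "I p \<inter> I q \<in> fmeasurable lborel" for p q
    using fmeasurable.Int[OF If If] .
  have int\<phi>: "integrable lborel \<phi>" "integral\<^sup>L lborel \<phi> = 2 * \<delta> * W"
  proof -
    have e: "\<phi> = (\<lambda>t. \<Sum>p\<in>P. w p * indicator (I p) t)" using \<phi> by auto
    show "integrable lborel \<phi>" unfolding e using intI by (intro Bochner_Integration.integrable_sum integrable_mult_right) auto
    show "integral\<^sup>L lborel \<phi> = 2 * \<delta> * W" unfolding e using intI
      by (subst Bochner_Integration.integral_sum) (auto simp: mI W sum_distrib_left sum_distrib_right mult_ac)
  qed
  have sq: "(\<phi> t)\<^sup>2 = (\<Sum>p\<in>P. \<Sum>q\<in>P. w p * w q * indicator (I p \<inter> I q) t)" for t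
    unfolding \<phi> power2_eq_square sum_product by (simp add: indicator_inter_arith mult_ac)
  have intsq: "integrable lborel (\<lambda>t. (\<phi> t)\<^sup>2)" "(\<integral>t. (\<phi> t)\<^sup>2 \<partial>lborel) \<le> 2 * \<delta> * h"
  proof -
    have i: "integrable lborel (indicator (I p \<inter> I q) :: real \<Rightarrow> real)" for p q
      using II[of p q] by (simp add: integrable_indicator_iff fmeasurable_def)
    show "integrable lborel (\<lambda>t. (\<phi> t)\<^sup>2)" unfolding sq using i by (intro Bochner_Integration.integrable_sum integrable_mult_right) auto
    have "(\<integral>t. (\<phi> t)\<^sup>2 \<partial>lborel) = (\<Sum>p\<in>P. \<Sum>q\<in>P. w p * w q * measure lborel (I p \<inter> I q))"
      unfolding sq using i by (simp add: Bochner_Integration.integral_sum)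
    also have "\<dots> \<le> (\<Sum>p\<in>P. \<Sum>q\<in>P. w p * w q * (2 * \<delta> * of_bool (\<bar>X p - X q + r * (Y p - Y q)\<bar> \<le> 2 * \<delta>)))"
    proof (intro sum_mono mult_left_mono)
      fix p q assume pq: "p \<in> P" "q \<in> P"
      show "0 \<le> w p * w q" using P pq by simp
      have "measure lborel (I p \<inter> I q) \<le> measure lborel (I p)"
        using If II by (intro measure_mono_fmeasurable) auto
      then have le: "measure lborel (I p \<inter> I q) \<le> 2 * \<delta>" by (simp add: mI)
      show "measure lborel (I p \<inter> I q) \<le> 2 * \<delta> * of_bool (\<bar>X p - X q + r * (Y p - Y q)\<bar> \<le> 2 * \<delta>)"
      proof (cases "I p \<inter> I q = {}")
        case False
        then obtain t where t: "t \<in> I p" "t \<in> I q" by auto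
        have "X p - X q + r * (Y p - Y q) = (X p + r * Y p) - (X q + r * Y q)" by (simp add: algebra_simps)
        then have "\<bar>X p - X q + r * (Y p - Y q)\<bar> \<le> 2 * \<delta>" using t unfolding I_def by auto
        then show ?thesis using le by simp
      qed (use \<delta> in auto)
    qed
    also have "\<dots> = 2 * \<delta> * close_mass P w X Y \<delta> r"
      by (simp add: close_mass_def sum_distrib_left mult_ac)
    also have "\<dots> \<le> 2 * \<delta> * h" using h \<delta> by (intro mult_left_mono) auto
    finally show "(\<integral>t. (\<phi> t)\<^sup>2 \<partial>lborel) \<le> 2 * \<delta> * h" .
  qed
  define lam where "lam = 2 * h / W"
  have lam: "lam > 0" using h W by (simp add: lam_def)
  \<comment> \<open>The value of \<open>lam\<close> is chosen so that the second moment below absorbs half of what is left.\<close>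
  have pt: "\<phi> t \<le> \<theta> * indicator {z - d..z + d} t + (\<phi> t)\<^sup>2 / (2 * lam) + lam / 2 * indicator T t" for t
  proof (cases "t \<in> T")
    case True
    have "0 \<le> (\<phi> t - lam)\<^sup>2" by simp
    then have "2 * \<phi> t * lam \<le> (\<phi> t)\<^sup>2 + lam\<^sup>2" by (simp add: power2_diff)
    then have "\<phi> t \<le> (\<phi> t)\<^sup>2 / (2 * lam) + lam / 2"
      using lam by (simp add: field_simps power2_eq_square)
    moreover have "0 \<le> \<theta> * indicator {z - d..z + d} t" using \<theta> by auto
    ultimately show ?thesis using True by simp
  next
    case False
    then have "\<phi> t \<le> \<theta> * indicator {z - d..z + d} t"
      using out[of t] \<phi>0[of t] by (auto simp: T_def indicator_def)
    then show ?thesis using False lam by (simp add: add_increasing2)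
  qed
  have iT: "integrable lborel (indicator T :: real \<Rightarrow> real)"
    using Tf by (simp add: integrable_indicator_iff fmeasurable_def)
  have iw: "integrable lborel (indicator {z - d..z + d} :: real \<Rightarrow> real)"
    using fmeasurable_compact[OF compact_Icc[of "z - d" "z + d"]]
    by (simp add: integrable_indicator_iff fmeasurable_def)
  have "2 * \<delta> * W \<le> (\<integral>t. \<theta> * indicator {z - d..z + d} t + (\<phi> t)\<^sup>2 / (2 * lam) + lam / 2 * indicator T t \<partial>lborel)"
    unfolding int\<phi>(2)[symmetric] using pt
    by (intro integral_mono Bochner_Integration.integrable_add integrable_mult_right integrable_divide int\<phi>(1) intsq(1) iT iw)
  also have "\<dots> = \<theta> * (2 * d) + (\<integral>t. (\<phi> t)\<^sup>2 \<partial>lborel) / (2 * lam) + lam / 2 * measure lborel T"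
    using intsq(1) iT iw d by simp
  also have "\<dots> \<le> \<theta> * (2 * d) + 2 * \<delta> * h / (2 * lam) + lam / 2 * measure lborel T"
    using intsq(2) lam by (intro add_mono divide_right_mono) auto
  also have "\<theta> * (2 * d) = \<delta> * W" using d by (simp add: \<theta>_def)
  also have "2 * \<delta> * h / (2 * lam) = \<delta> * W / 2" using h W by (simp add: lam_def)
  also have "lam / 2 * measure lborel T = h / W * measure lborel T" by (simp add: lam_def)
  finally have "\<delta> * W / 2 \<le> h / W * measure lborel T" by linarith
  then have "\<delta> * W\<^sup>2 / (2 * h) \<le> measure lborel T"
    using h W by (simp add: field_simps power2_eq_square)
  then show "\<delta> * W\<^sup>2 / (2 * h) \<le> measure lborel {t. \<delta> * W / (2 * d) \<le> local_mass P w X Y \<delta> r t}"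
    by (simp add: T_def \<theta>_def \<phi>_def)
qed

section \<open>Independent choices and recurrence\<close>

text \<open>
  Independent random parameters: if each of finitely many demands \<open>u\<close> can be met at any of \<open>m\<close> indices,
  each time with probability at least \<open>p\<close>, and the number of demands is below \<open>(1 - p) ^ (- m)\<close>, then some
  choice of parameters meets all demands simultaneously.
\<close>
lemma independent_choice:
  fixes S :: "'u \<Rightarrow> 'a set" and G :: "'u \<Rightarrow> 'a \<Rightarrow> 'b set"
  assumes "prob_space M" "finite A" "finite U"
    and S: "\<And>u. u \<in> U \<Longrightarrow> S u \<subseteq> A" "\<And>u. u \<in> U \<Longrightarrow> m \<le> card (S u)"
    and G: "\<And>u a. u \<in> U \<Longrightarrow> a \<in> S u \<Longrightarrow> G u a \<in> sets M"
       "\<And>u a. u \<in> U \<Longrightarrow> a \<in> S u \<Longrightarrow> p \<le> measure M (G u a)"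
    and p: "0 \<le> p" "p \<le> 1" "real (card U) * (1 - p) ^ m < 1"
  shows "\<exists>\<omega>. (\<forall>a\<in>A. \<omega> a \<in> space M) \<and> (\<forall>u\<in>U. \<exists>a\<in>S u. \<omega> a \<in> G u a)"
proof -
  interpret M: prob_space M by fact
  interpret Pi: finite_product_prob_space "\<lambda>_. M" A
    by unfold_locales (rule assms(2))
  define X where "X u a = (if a \<in> S u then space M - G u a else space M)" for u a
  define Bad where "Bad u = (\<Pi>\<^sub>E a\<in>A. X u a)" for u
  have X: "X u a \<in> sets M" if "u \<in> U" for u a using G(1) that by (auto simp: X_def)
  have Bad: "Bad u \<in> sets (\<Pi>\<^sub>M a\<in>A. M)" if "u \<in> U" for u
    unfolding Bad_def using X[OF that] assms(2) by (intro sets_PiM_I_finite) auto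
  have "Pi.prob (Bad u) \<le> (1 - p) ^ m" if u: "u \<in> U" for u
  proof -
    have "Pi.prob (Bad u) = (\<Prod>a\<in>A. measure M (X u a))"
      unfolding Bad_def using X[OF u] by (intro Pi.prob_times) auto
    also have "\<dots> \<le> (\<Prod>a\<in>A. if a \<in> S u then 1 - p else 1)"
      using G u by (intro prod_mono) (auto simp: X_def M.prob_compl)
    also have "\<dots> = (1 - p) ^ card (S u)"
      using S(1)[OF u] assms(2) by (simp add: prod.If_cases Int_absorb1)
    also have "\<dots> \<le> (1 - p) ^ m" using S(2)[OF u] p by (intro power_decreasing) auto
    finally show ?thesis .
  qed
  then have "(\<Sum>u\<in>U. Pi.prob (Bad u)) \<le> real (card U) * (1 - p) ^ m"
    using sum_bounded_above[of U "\<lambda>u. Pi.prob (Bad u)" "(1 - p) ^ m"] by simp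
  moreover have "Pi.prob (\<Union>u\<in>U. Bad u) \<le> (\<Sum>u\<in>U. Pi.prob (Bad u))"
    using Bad assms(3) by (intro Pi.finite_measure_subadditive_finite) auto
  ultimately have "Pi.prob (\<Union>u\<in>U. Bad u) \<noteq> Pi.prob (space (\<Pi>\<^sub>M a\<in>A. M))"
    using p(3) prob_space.prob_space[OF prob_space_PiM[of A "\<lambda>_. M"]] assms(1) by simp
  then have "(\<Union>u\<in>U. Bad u) \<noteq> space (\<Pi>\<^sub>M a\<in>A. M)" by metis
  moreover have "(\<Union>u\<in>U. Bad u) \<subseteq> space (\<Pi>\<^sub>M a\<in>A. M)" using Bad sets.sets_into_space by blast
  ultimately obtain \<omega> where \<omega>: "\<omega> \<in> space (\<Pi>\<^sub>M a\<in>A. M)" "\<And>u. u \<in> U \<Longrightarrow> \<omega> \<notin> Bad u" by blast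
  have sp: "\<omega> a \<in> space M" if "a \<in> A" for a using \<omega>(1) that by (auto simp: space_PiM)
  have "\<exists>a\<in>S u. \<omega> a \<in> G u a" if u: "u \<in> U" for u
  proof (rule ccontr)
    assume "\<not> (\<exists>a\<in>S u. \<omega> a \<in> G u a)"
    then have "\<omega> \<in> Bad u" using \<omega>(1) sp by (auto simp: Bad_def X_def space_PiM PiE_def)
    then show False using \<omega>(2)[OF u] by simp
  qed
  then show ?thesis using sp by blast
qed

text \<open>
  The attractor of maps with disjoint images is the decreasing intersection of the iterated images of
  \<open>J\<close>; disjointness and injectivity make the union of images commute with this intersection, so no
  contraction is needed.
\<close>
lemma attractor_exists:
  fixes f :: "'a \<Rightarrow> real \<Rightarrow> real" and J :: "real set"
  assumes A: "finite A" "A \<noteq> {}" and J: "compact J" "J \<noteq> {}"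
    and f: "\<And>a. a \<in> A \<Longrightarrow> continuous_on J (f a)" "\<And>a. a \<in> A \<Longrightarrow> inj (f a)"
      "\<And>a. a \<in> A \<Longrightarrow> f a ` J \<subseteq> J"
    and disj: "disjoint_family_on (\<lambda>a. f a ` J) A"
  shows "\<exists>L. compact L \<and> L \<noteq> {} \<and> L \<subseteq> J \<and> L = (\<Union>a\<in>A. f a ` L)"
proof -
  define S where "S = rec_nat J (\<lambda>_ X. \<Union>a\<in>A. f a ` X)"
  have S: "S 0 = J" "S (Suc n) = (\<Union>a\<in>A. f a ` S n)" for n by (auto simp: S_def)
  have sub: "S n \<subseteq> J" for n using f(3)
  proof (induction n)
    case (Suc n)
    then show ?case using f(3) unfolding S(2) by fast
  qed (simp add: S(1))
  have step: "S (Suc n) \<subseteq> S n" for n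
  proof (induction n)
    case 0
    then show ?case using f(3) by (auto simp: S)
  next
    case (Suc n)
    have "S (Suc (Suc n)) = (\<Union>a\<in>A. f a ` S (Suc n))" by (rule S(2))
    also have "\<dots> \<subseteq> (\<Union>a\<in>A. f a ` S n)" using Suc by blast
    also have "\<dots> = S (Suc n)" by (rule S(2)[symmetric])
    finally show ?case .
  qed
  have cpt: "compact (S n) \<and> S n \<noteq> {}" for n
  proof (induction n)
    case (Suc n)
    have "compact (f a ` S n)" if "a \<in> A" for a
      using Suc by (intro compact_continuous_image[OF continuous_on_subset[OF f(1)[OF that] sub]]) simp
    then show ?case using A Suc by (auto simp: S intro: compact_UN)
  qed (use J in \<open>simp add: S\<close>)
  define L where "L = \<Inter> (range S)"
  have "L \<noteq> {}" unfolding L_def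
    using cpt by (intro compact_nest lift_Suc_antimono_le[of S, OF step]) auto
  moreover have "compact L" unfolding L_def using cpt by (intro compact_Inter) auto
  moreover have "L \<subseteq> J" unfolding L_def using S(1) by blast
  moreover have "L = (\<Union>a\<in>A. f a ` L)"
  proof (intro equalityI subsetI)
    fix y assume y: "y \<in> L"
    then have "y \<in> S (Suc n)" for n by (auto simp: L_def)
    then have "\<exists>a\<in>A. \<exists>x\<in>S n. y = f a x" for n unfolding S(2) by blast
    then obtain a x where ax: "\<And>n. a n \<in> A \<and> x n \<in> S n \<and> y = f (a n) (x n)" by metis
    have "a n = a 0" for n
    proof (rule ccontr)
      assume "a n \<noteq> a 0"
      then have "f (a n) ` J \<inter> f (a 0) ` J = {}"
        using disj ax[of n] ax[of 0] by (auto simp: disjoint_family_on_def)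
      then show False using ax[of n] ax[of 0] sub by blast
    qed
    then have "f (a 0) (x n) = f (a 0) (x 0)" for n using ax by metis
    then have "x n = x 0" for n using f(2)[of "a 0"] ax[of 0] by (simp add: inj_eq)
    then have "x 0 \<in> L" using ax unfolding L_def by (metis INT_I)
    then show "y \<in> (\<Union>a\<in>A. f a ` L)" using ax[of 0] by blast
  next
    fix y assume "y \<in> (\<Union>a\<in>A. f a ` L)"
    then obtain a x where ax: "a \<in> A" "x \<in> L" "y = f a x" by blast
    have "y \<in> S (Suc n)" for n using ax by (auto simp: L_def S)
    then have "y \<in> S n" for n using step by blast
    then show "y \<in> L" by (auto simp: L_def)
  qed
  ultimately show ?thesis by blast
qed

text \<open>
  Let \<open>R\<close> be a bounded set of pairs (slope, target). If every pair of \<open>R\<close> can be renormalized to a pair of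
  \<open>R\<close> so that the error \<open>x + r y - t\<close> shrinks by a factor \<open>\<rho> < 1\<close> when undoing the renormalization, then for
  each pair the target is attained exactly.
\<close>
lemma recurrent_set_sum:
  fixes L K' :: "real set" and R :: "(real \<times> real) set"
  assumes L: "compact L" "L \<noteq> {}" "L \<subseteq> {0..1}" and K': "compact K'" "K' \<noteq> {}" "K' \<subseteq> {0..1}"
    and bdd: "\<And>r t. (r, t) \<in> R \<Longrightarrow> \<bar>r\<bar> \<le> B \<and> \<bar>t\<bar> \<le> B"
    and rec: "\<And>r t. (r, t) \<in> R \<Longrightarrow> \<exists>l r' t'. \<bar>l\<bar> \<le> \<rho> \<and> (r', t') \<in> R \<and>
       (\<forall>x\<in>L. \<forall>y\<in>K'. \<exists>x1\<in>L. \<exists>y1\<in>K'. x1 + r * y1 - t = l * (x + r' * y - t'))"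
    and \<rho>: "0 \<le> \<rho>" "\<rho> < 1"
    and rt: "(r, t) \<in> R"
  shows "t \<in> {x + r * y | x y. x \<in> L \<and> y \<in> K'}"
proof -
  have *: "\<exists>x\<in>L. \<exists>y\<in>K'. \<bar>x + r * y - t\<bar> \<le> \<rho> ^ n * (1 + 2 * B)" if "(r, t) \<in> R" for n r t
    using that
  proof (induction n arbitrary: r t)
    case 0
    obtain x y where xy: "x \<in> L" "y \<in> K'" using L K' by blast
    have "x \<in> {0..1}" "y \<in> {0..1}" using xy L K' by auto
    then have "\<bar>x\<bar> \<le> 1" "\<bar>y\<bar> \<le> 1" "\<bar>r\<bar> \<le> B" "\<bar>t\<bar> \<le> B"
      using bdd[OF 0] by auto
    moreover from this have "\<bar>r * y\<bar> \<le> B * 1" unfolding abs_mult by (intro mult_mono) auto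
    ultimately show ?case using xy by (intro bexI[of _ x] bexI[of _ y]) auto
  next
    case (Suc n)
    from rec[OF Suc.prems] obtain l r' t' where l: "\<bar>l\<bar> \<le> \<rho>" "(r', t') \<in> R"
       "\<And>x y. x \<in> L \<Longrightarrow> y \<in> K' \<Longrightarrow> \<exists>x1\<in>L. \<exists>y1\<in>K'. x1 + r * y1 - t = l * (x + r' * y - t')"
      by blast
    from Suc.IH[OF l(2)] obtain x y where xy: "x \<in> L" "y \<in> K'" "\<bar>x + r' * y - t'\<bar> \<le> \<rho> ^ n * (1 + 2 * B)"
      by blast
    from l(3)[OF xy(1,2)] obtain x1 y1 where x1: "x1 \<in> L" "y1 \<in> K'" "x1 + r * y1 - t = l * (x + r' * y - t')"
      by blast
    have "\<bar>x1 + r * y1 - t\<bar> \<le> \<rho> * (\<rho> ^ n * (1 + 2 * B))"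
      unfolding x1(3) abs_mult using l(1) xy(3) \<rho> by (intro mult_mono) auto
    then show ?case using x1 by (intro bexI[of _ x1] bexI[of _ y1]) (auto simp: mult.assoc)
  qed
  let ?S = "(\<lambda>(x, y). x + r * y) ` (L \<times> K')"
  have "compact ?S" using L K'
    by (intro compact_continuous_image compact_Times) (auto simp: case_prod_unfold intro!: continuous_intros)
  then have "closed ?S" by (rule compact_imp_closed)
  moreover have "\<exists>y\<in>?S. dist y t < e" if e: "e > 0" for e
  proof -
    have "(\<lambda>n. \<rho> ^ n * (1 + 2 * B)) \<longlonglongrightarrow> 0 * (1 + 2 * B)"
      using \<rho> by (intro tendsto_mult LIMSEQ_power_zero tendsto_const) auto
    then have "eventually (\<lambda>n. \<rho> ^ n * (1 + 2 * B) < e) sequentially"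
      using e by (intro order_tendstoD(2)[of _ 0]) auto
    then obtain n where "\<rho> ^ n * (1 + 2 * B) < e" by (auto simp: eventually_sequentially)
    then show ?thesis using *[OF rt, of n] by (force simp: dist_real_def)
  qed
  ultimately have "t \<in> ?S" by (metis closed_approachable)
  then show ?thesis by auto
qed

lemma finite_net:
  fixes R :: "(real \<times> real) set"
  assumes "0 < d" and bdd: "\<And>r t. (r, t) \<in> R \<Longrightarrow> \<bar>r\<bar> \<le> B \<and> \<bar>t\<bar> \<le> B" and "0 \<le> B"
  shows "\<exists>U. finite U \<and> U \<subseteq> R \<and> real (card U) \<le> (2 * B / d + 3)\<^sup>2 \<and>
     (\<forall>r t. (r, t) \<in> R \<longrightarrow> (\<exists>r0 t0. (r0, t0) \<in> U \<and> \<bar>r - r0\<bar> \<le> d \<and> \<bar>t - t0\<bar> \<le> d))"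
proof -
  define cell where "cell u = (\<lfloor>fst u / d\<rfloor>, \<lfloor>snd u / d\<rfloor>)" for u :: "real \<times> real"
  define m where "m = \<lceil>B / d\<rceil>"
  have "0 \<le> B / d" using assms by simp
  then have m0: "m \<ge> 0" unfolding m_def by linarith
  define pick where "pick c = (SOME u. u \<in> R \<and> cell u = c)" for c
  define U where "U = pick ` cell ` R"
  have fl: "\<lfloor>x / d\<rfloor> \<in> {-m..m}" if "\<bar>x\<bar> \<le> B" for x
  proof -
    have "x / d \<le> B / d" "- (B / d) \<le> x / d" using that assms(1) by (auto simp: field_simps)
    then show ?thesis unfolding m_def by (auto, linarith+)
  qed
  have cells: "cell ` R \<subseteq> {-m..m} \<times> {-m..m}" using bdd fl by (fastforce simp: cell_def)
  then have fc: "finite (cell ` R)" by (rule finite_subset) auto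
  have pick: "pick (cell u) \<in> R \<and> cell (pick (cell u)) = cell u" if "u \<in> R" for u
    unfolding pick_def using that by (intro someI[of "\<lambda>v. v \<in> R \<and> cell v = cell u" u]) auto
  have "card U \<le> card (cell ` R)" unfolding U_def using fc by (rule card_image_le)
  also have "\<dots> \<le> card ({-m..m} \<times> {-m..m})" using cells by (intro card_mono) auto
  also have "\<dots> = (nat (2 * m + 1))\<^sup>2" by (simp add: card_cartesian_product power2_eq_square)
  finally have "real (card U) \<le> (real (nat (2 * m + 1)))\<^sup>2" by (metis of_nat_le_iff of_nat_power)
  also have "\<dots> \<le> (2 * B / d + 3)\<^sup>2"
  proof (rule power_mono)
    have "real_of_int m \<le> B / d + 1" unfolding m_def by linarith
    then show "real (nat (2 * m + 1)) \<le> 2 * B / d + 3" using m0 by simp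
  qed simp
  finally have "real (card U) \<le> (2 * B / d + 3)\<^sup>2" .
  moreover
  have close: "\<bar>x - y\<bar> \<le> d" if "\<lfloor>x / d\<rfloor> = \<lfloor>y / d\<rfloor>" for x y
  proof -
    have "\<bar>x / d - y / d\<bar> \<le> 1" using that by linarith
    then show ?thesis using assms(1) by (simp add: diff_divide_distrib[symmetric] abs_divide)
  qed
  have "\<exists>r0 t0. (r0, t0) \<in> U \<and> \<bar>r - r0\<bar> \<le> d \<and> \<bar>t - t0\<bar> \<le> d" if "(r, t) \<in> R" for r t
  proof -
    let ?u = "pick (cell (r, t))"
    have "(fst ?u, snd ?u) \<in> U" using that by (simp add: U_def)
    moreover have "\<bar>r - fst ?u\<bar> \<le> d" "\<bar>t - snd ?u\<bar> \<le> d"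
      using pick[OF that] by (auto simp: cell_def intro!: close)
    ultimately show ?thesis by blast
  qed
  moreover have "U \<subseteq> R" "finite U" using pick fc by (auto simp: U_def)
  ultimately show ?thesis by blast
qed

text \<open>
  Randomizing the ratio by a factor \<open>z\<close> and the position by \<open>v\<close> moves the renormalized pair over a region of
  fixed size, so it falls into the good set \<open>T\<close> with positive probability: \<open>r1 z\<close> avoids the small
  exceptional set of slopes, and for each good slope the translation by \<open>v\<close> sweeps across the whole
  slice of \<open>T\<close>.
\<close>
lemma good_parameters:
  fixes E :: "real set" and T :: "(real \<times> real) set"
  assumes E: "E \<in> sets borel" "E \<subseteq> {-N..N}" "emeasure lborel ({-N..N} - E) \<le> ennreal \<kappa>"
    and T: "T \<in> sets borel"
    and slice: "\<And>r. r \<in> E \<Longrightarrow> {t. (r, t) \<in> T} \<subseteq> {x1 + r * y0 - v0 / 2 .. x1 + r * y0 + v0 / 2}"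
      "\<And>r. r \<in> E \<Longrightarrow> \<tau>0 \<le> measure lborel {t. (r, t) \<in> T}"
    and q: "0 < q" "q \<le> \<bar>r1\<bar>" "\<bar>r1\<bar> \<le> 1" and \<kappa>: "0 \<le> \<kappa>" "\<kappa> \<le> q * \<theta>"
    and \<theta>: "0 < \<theta>" "4 * \<theta> \<le> 1" and N: "2 \<le> N" and v0: "0 < v0" and \<tau>0: "0 \<le> \<tau>0"
    and near: "\<bar>\<tau> - x0 - r1 * y0\<bar> \<le> v0 / 4"
  defines "G \<equiv> {(z, v). z \<in> {1 + 2 * \<theta>..1 + 4 * \<theta>} \<and> v \<in> {-v0..v0} \<and> r1 * z \<in> E \<and>
              (r1 * z, x1 + z * (\<tau> - x0) - v) \<in> T}"
  shows "G \<in> sets borel" "ennreal (\<theta> * \<tau>0) \<le> emeasure lborel G"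
proof -
  note [measurable] = E(1) T
  have m1: "{p. (r1 * fst p, x1 + fst p * (\<tau> - x0) - snd p) \<in> T} \<in> sets borel"
  proof -
    have "(\<lambda>p::real \<times> real. (r1 * fst p, x1 + fst p * (\<tau> - x0) - snd p)) \<in> borel \<rightarrow>\<^sub>M borel"
      by (intro borel_measurable_continuous_onI continuous_intros)
    from measurable_sets[OF this T] show ?thesis by (simp add: vimage_def)
  qed
  show Gm: "G \<in> sets borel"
  proof -
    have "G = {p. (r1 * fst p, x1 + fst p * (\<tau> - x0) - snd p) \<in> T} \<inter>
       {p. fst p \<in> {1 + 2 * \<theta>..1 + 4 * \<theta>} \<and> snd p \<in> {-v0..v0} \<and> r1 * fst p \<in> E}"
      by (auto simp: G_def)
    moreover have "{p :: real \<times> real. fst p \<in> {1 + 2 * \<theta>..1 + 4 * \<theta>} \<and> snd p \<in> {-v0..v0} \<and> r1 * fst p \<in> E}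
        = {z \<in> {1 + 2 * \<theta>..1 + 4 * \<theta>}. r1 * z \<in> E} \<times> {-v0..v0}" by auto
    moreover have "{z \<in> {1 + 2 * \<theta>..1 + 4 * \<theta>}. r1 * z \<in> E} \<in> sets borel" by measurable
    ultimately have "G = {p. (r1 * fst p, x1 + fst p * (\<tau> - x0) - snd p) \<in> T} \<inter>
       ({z \<in> {1 + 2 * \<theta>..1 + 4 * \<theta>}. r1 * z \<in> E} \<times> {-v0..v0})"
      "({z \<in> {1 + 2 * \<theta>..1 + 4 * \<theta>}. r1 * z \<in> E} \<times> {-v0..v0}) \<in> sets borel"
      by (simp, intro borel_Times) simp_all
    then show ?thesis using m1 by simp
  qed
  define Z where "Z = {z \<in> {1 + 2 * \<theta>..1 + 4 * \<theta>}. r1 * z \<in> E}"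
  have Zm [measurable]: "Z \<in> sets borel" unfolding Z_def by measurable
  have r1: "r1 \<noteq> 0" using q by auto
  have Z: "ennreal \<theta> \<le> emeasure lborel Z"
  proof -
    define Y where "Y = {1 + 2 * \<theta>..1 + 4 * \<theta>} - Z"
    have Ym [measurable]: "Y \<in> sets borel" unfolding Y_def by measurable
    have "(\<lambda>z. r1 * z) ` Y \<subseteq> {-N..N} - E"
    proof
      fix r assume "r \<in> (\<lambda>z. r1 * z) ` Y"
      then obtain z where zY: "z \<in> Y" and rz: "r = r1 * z" by blast
      then have z: "r = r1 * z" "1 + 2 * \<theta> \<le> z" "z \<le> 1 + 4 * \<theta>" "r1 * z \<notin> E"
        unfolding Y_def Z_def by auto
      have "\<bar>r\<bar> \<le> 1 * 2" unfolding z(1) abs_mult using q z \<theta> by (intro mult_mono) auto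
      then show "r \<in> {-N..N} - E" using z N by auto
    qed
    then have "emeasure lebesgue ((\<lambda>z. r1 * z) ` Y) \<le> emeasure lebesgue ({-N..N} - E)"
      by (rule emeasure_mono) (use E(1) in \<open>simp add: sets.Diff\<close>)
    also have "\<dots> \<le> ennreal \<kappa>" using E by simp
    finally have "ennreal \<bar>r1\<bar> * emeasure lborel Y \<le> ennreal \<kappa>"
      using emeasure_lebesgue_affine[of r1 0 Y] r1 by (simp add: image_def)
    moreover have "ennreal q * emeasure lborel Y \<le> ennreal \<bar>r1\<bar> * emeasure lborel Y"
      using q by (intro mult_right_mono ennreal_leI) auto
    ultimately have "ennreal q * emeasure lborel Y \<le> ennreal q * ennreal \<theta>"
      using \<kappa> q by (metis ennreal_leI ennreal_mult' less_imp_le order_trans)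
    then have Y: "emeasure lborel Y \<le> ennreal \<theta>"
      using q by (simp add: ennreal_mult_le_mult_iff)
    have "emeasure lborel {1 + 2 * \<theta>..1 + 4 * \<theta>} \<le> emeasure lborel Z + emeasure lborel Y"
    proof -
      have "{1 + 2 * \<theta>..1 + 4 * \<theta>} \<subseteq> Z \<union> Y" by (auto simp: Y_def)
      then have "emeasure lborel {1 + 2 * \<theta>..1 + 4 * \<theta>} \<le> emeasure lborel (Z \<union> Y)"
        by (rule emeasure_mono) measurable
      also have "\<dots> \<le> emeasure lborel Z + emeasure lborel Y" by (rule emeasure_subadditive) auto
      finally show ?thesis .
    qed
    also have "\<dots> \<le> emeasure lborel Z + ennreal \<theta>" using Y by (intro add_left_mono)
    finally have "ennreal \<theta> + ennreal \<theta> \<le> emeasure lborel Z + ennreal \<theta>"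
      using \<theta> by (simp add: ennreal_plus[symmetric] del: ennreal_plus)
    then show ?thesis by (simp add: ennreal_add_left_cancel_le add.commute)
  qed
  have sl: "ennreal \<tau>0 \<le> emeasure lborel (Pair z -` G)" if z: "z \<in> Z" for z
  proof -
    let ?r = "r1 * z" and ?c = "x1 + z * (\<tau> - x0)"
    have zE: "?r \<in> E" and zz: "1 \<le> z" "z \<le> 2" using z \<theta> by (auto simp: Z_def)
    let ?T = "{t. (?r, t) \<in> T}"
    have eq: "Pair z -` G = (\<lambda>t. ?c + (- 1) * t) ` ?T"
    proof (intro equalityI subsetI)
      fix v assume "v \<in> Pair z -` G"
      then have "?c - v \<in> ?T" by (simp add: G_def)
      then show "v \<in> (\<lambda>t. ?c + (- 1) * t) ` ?T" by (intro image_eqI[of _ _ "?c - v"]) auto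
    next
      fix v assume "v \<in> (\<lambda>t. ?c + (- 1) * t) ` ?T"
      then obtain t where t: "v = ?c - t" "(?r, t) \<in> T" by auto
      have "t \<in> {x1 + ?r * y0 - v0 / 2 .. x1 + ?r * y0 + v0 / 2}" using slice(1)[OF zE] t(2) by blast
      then have t2: "\<bar>t - (x1 + ?r * y0)\<bar> \<le> v0 / 2" unfolding atLeastAtMost_iff by linarith
      have "\<bar>z * (\<tau> - x0 - r1 * y0)\<bar> \<le> 2 * (v0 / 4)"
        unfolding abs_mult using near zz by (intro mult_mono) auto
      moreover have "v = z * (\<tau> - x0 - r1 * y0) - (t - (x1 + ?r * y0))" using t by (simp add: algebra_simps)
      ultimately have "\<bar>v\<bar> \<le> v0" using t2 by linarith
      then show "v \<in> Pair z -` G" using z t zE by (auto simp: G_def Z_def)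
    qed
    have "?T \<in> sets borel" by measurable
    have Tm: "?T \<in> fmeasurable lborel"
      using slice(1)[OF zE] \<open>?T \<in> sets borel\<close> by (intro fmeasurableI2[OF fmeasurable_compact[OF compact_Icc[of "x1 + r1 * z * y0 - v0 / 2" "x1 + r1 * z * y0 + v0 / 2"]]]) simp_all
    have "emeasure lborel (Pair z -` G) = emeasure lebesgue (Pair z -` G)"
    proof -
      have "G \<in> sets (borel \<Otimes>\<^sub>M borel)" unfolding borel_prod by (rule Gm)
      then have "Pair z -` G \<in> sets borel" by (rule sets_Pair1)
      then show ?thesis by simp
    qed
    also have "\<dots> = emeasure lebesgue ?T"
      unfolding eq using emeasure_lebesgue_affine[of "-1" ?c ?T] by (simp add: add.commute)
    also have "\<dots> = emeasure lborel ?T" using \<open>?T \<in> sets borel\<close> by simp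
    also have "\<dots> = ennreal (measure lborel ?T)" using Tm by (rule emeasure_eq_measure2)
    finally show ?thesis using slice(2)[OF zE] by (simp add: ennreal_leI)
  qed
  have Gp: "G \<in> sets (borel \<Otimes>\<^sub>M borel)" unfolding borel_prod by (rule Gm)
  have "ennreal (\<theta> * \<tau>0) = ennreal \<tau>0 * ennreal \<theta>" using \<tau>0 by (simp add: ennreal_mult' mult.commute)
  also have "\<dots> \<le> ennreal \<tau>0 * emeasure lborel Z" using Z by (intro mult_left_mono) auto
  also have "\<dots> = (\<integral>\<^sup>+z. ennreal \<tau>0 * indicator Z z \<partial>lborel)"
    by (subst nn_integral_cmult_indicator) auto
  also have "\<dots> \<le> (\<integral>\<^sup>+z. emeasure lborel (Pair z -` G) \<partial>lborel)"
    using sl by (intro nn_integral_mono) (auto simp: indicator_def)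
  also have "\<dots> = emeasure (lborel \<Otimes>\<^sub>M lborel) G"
    by (rule lborel.emeasure_pair_measure_alt[symmetric]) (use Gp in simp)
  also have "\<dots> = emeasure lborel G" by (simp add: lborel_prod)
  finally show "ennreal (\<theta> * \<tau>0) \<le> emeasure lborel G" .
qed

section \<open>Good slopes and targets at a finite scale\<close>

text \<open>
  Two self-similar sets whose similarity dimensions add up to more than 1.
\<close>
locale ifs_pair = X: ifs \<Phi> K + Y: ifs \<Psi> K' for \<Phi> K \<Psi> K' +
  assumes dims: "1 < X.sdim + Y.sdim"
begin

text \<open>
  The data extracted at scale \<open>\<rho>\<close>: subdivisions \<open>A\<close> of \<open>K\<close> and \<open>B\<close> of \<open>K'\<close>, a set \<open>E\<close> of good slopes that
  misses at most measure \<open>\<kappa>\<close> of the range \<open>[-N, N]\<close> (of both signs, as the maps may reverse orientation), and a set \<open>T\<close> of good pairs (slope, target). For good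
  slopes the slice of \<open>T\<close> has measure at least \<open>\<tau>\<close> and lies within \<open>w\<close> of the projection of \<open>(x1, y0)\<close>. For
  each pair close to \<open>T\<close> with slope at least \<open>1 / (2 N)\<close> in absolute value, at least \<open>c \<rho> ^ (1 - s - s')\<close> distinct pieces in \<open>A\<close> hit the target together with some
  piece in \<open>B\<close>. The pieces in \<open>B\<close> are larger than those in \<open>A\<close> by a factor of at least \<open>2 N\<close>, so that their
  ratio relative to a slope of size at least \<open>1 / (2 N)\<close> is at least 1.
\<close>
definition sliced :: "real \<Rightarrow> real \<Rightarrow> real \<Rightarrow> real \<Rightarrow> real \<Rightarrow> real \<Rightarrow> real \<Rightarrow> real \<Rightarrow> real \<Rightarrow> real \<Rightarrow>
    (real \<times> real) set \<Rightarrow> (real \<times> real) set \<Rightarrow> real set \<Rightarrow> (real \<times> real) set \<Rightarrow> bool" where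
  "sliced x0 x1 y0 N w k \<kappa> \<tau> c \<rho> A B E T \<longleftrightarrow>
     subdivision A K \<and> (\<forall>a\<in>A. X.rmin * \<rho> \<le> \<bar>fst a\<bar> \<and> \<bar>fst a\<bar> \<le> \<rho>) \<and>
     subdivision B K' \<and> (\<forall>b\<in>B. 2 * N * \<rho> \<le> \<bar>fst b\<bar> \<and> \<bar>fst b\<bar> \<le> 1) \<and>
     E \<in> sets borel \<and> E \<subseteq> {-N..N} \<and> emeasure lborel ({-N..N} - E) \<le> ennreal \<kappa> \<and>
     T \<in> sets borel \<and>
     (\<forall>r\<in>E. {t. (r, t) \<in> T} \<subseteq> {x1 + r * y0 - w..x1 + r * y0 + w} \<and>
             \<tau> \<le> measure lborel {t. (r, t) \<in> T}) \<and>
     (\<forall>r t r' t'. (r, t) \<in> T \<longrightarrow> \<bar>r' - r\<bar> \<le> k * \<rho> / 2 \<longrightarrow> \<bar>t' - t\<bar> \<le> k * \<rho> / 2 \<longrightarrow> 1 / (2 * N) \<le> \<bar>r'\<bar> \<longrightarrow>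
        c * \<rho> powr (1 - X.sdim - Y.sdim)
        \<le> card {a\<in>A. \<exists>b\<in>B. \<bar>t' - (aff a x0 + r' * aff b y0)\<bar> \<le> 2 * k * \<rho>})"

text \<open>
  The constants \<open>\<tau>\<close> and \<open>c\<close> do not depend on the scale \<open>\<rho>\<close>, which remains free to be taken arbitrarily small.
\<close>
lemma transversal_slices:
  assumes g: "g \<in> \<Phi>" "x1 \<in> X.J" "aff g x1 = x1" and x0: "x0 \<in> X.J"
    and b: "b \<in> \<Psi>" "y0 \<in> Y.J" "aff b y0 = y0"
    and N: "1 \<le> N" and w: "0 < w" and k: "0 < k" "k \<le> 1" "k \<le> w / 2" and \<kappa>: "0 < \<kappa>"
  shows "\<exists>\<tau>>0. \<exists>c>0. \<exists>\<rho>0>0. \<forall>\<rho>. 0 < \<rho> \<longrightarrow> \<rho> < \<rho>0 \<longrightarrow>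
    (\<exists>A B E T. sliced x0 x1 y0 N w k \<kappa> \<tau> c \<rho> A B E T)"
proof -
  let ?s = "X.sdim" and ?s' = "Y.sdim"
  let ?q1 = "\<bar>fst g\<bar>" and ?q2 = "\<bar>fst b\<bar>"
  let ?c2 = "Y.rmin"
  note s = X.sdim(1) Y.sdim(1) X.sdim_le_1 dims
  obtain C1 where C1: "1 \<le> C1" "\<And>\<rho>. 0 < \<rho> \<Longrightarrow> \<rho> < 1 \<Longrightarrow> \<exists>G. X.scale_subdivision C1 \<rho> G"
    using X.scale_subdivision_ex by blast
  obtain C2 where C2: "1 \<le> C2" "\<And>\<rho>. 0 < \<rho> \<Longrightarrow> \<rho> < 1 \<Longrightarrow> \<exists>G. Y.scale_subdivision C2 \<rho> G"
    using Y.scale_subdivision_ex by blast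
  have q: "0 < ?q1" "?q1 < 1" "0 < ?q2" "?q2 < 1" using X.ratio[OF g(1)] Y.ratio[OF b(1)] by auto
  have c2: "0 < ?c2" "?c2 < 1" using Y.rmin by auto
  define w1 where "w1 = w / (2 * (1 + N))"
  have w1: "0 < w1" using w N by (simp add: w1_def)
  obtain k1 where "?q1 ^ k1 < w1" using real_arch_pow_inv[OF w1 q(2)] by blast
  then have k1: "?q1 ^ k1 \<le> w1" by simp
  obtain k2 where "?q2 ^ k2 < w1" using real_arch_pow_inv[OF w1 q(4)] by blast
  then have k2: "?q2 ^ k2 \<le> w1" by simp
  define p where "p = (?q1 ^ k1) powr ?s * (?q2 ^ k2) powr ?s'"
  have p: "0 < p" using q by (simp add: p_def)
  define Cb where "Cb = C2 * (2 * N / ?c2) powr ?s'"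
  have Cb: "0 < Cb" using C2 N c2 by (simp add: Cb_def)
  define CE where "CE = 8 * N * (N + 2) powr ?s * C1 * Cb / (1 - 2 powr (1 - ?s - ?s'))"
  have "2 powr (1 - ?s - ?s') < 2 powr (0::real)" using dims by (subst powr_less_cancel_iff) auto
  then have CE: "0 < CE" using N C1 Cb by (simp add: CE_def)
  define \<tau> where "\<tau> = k * p\<^sup>2 * \<kappa> / (2 * CE)"
  have \<tau>: "0 < \<tau>" using k p \<kappa> CE by (simp add: \<tau>_def)
  define D where "D = C2 * (4 * N / ?c2) powr ?s'"
  have D: "0 < D" using C2 N c2 by (simp add: D_def)
  define c where "c = k * p / (2 * w) / D"
  have c: "0 < c" using k p w D by (simp add: c_def)
  define \<rho>0 where "\<rho>0 = min (?q1 ^ k1) (min 1 (?c2 / (2 * N) * ?q2 ^ k2))"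
  have \<rho>0: "0 < \<rho>0" using q c2 N by (simp add: \<rho>0_def)
  show ?thesis
  proof (rule exI[of _ \<tau>], rule conjI[OF \<tau>], rule exI[of _ c], rule conjI[OF c],
      rule exI[of _ \<rho>0], rule conjI[OF \<rho>0], rule allI, rule impI, rule impI)
    fix \<rho> assume \<rho>: "0 < \<rho>" "\<rho> < \<rho>0"
    then have \<rho>1: "\<rho> < 1" "\<rho> \<le> ?q1 ^ k1" by (auto simp: \<rho>0_def)
    define \<sigma> where "\<sigma> = 2 * N * \<rho> / ?c2"
    have \<sigma>0: "0 < \<sigma>" using N c2 \<rho> by (simp add: \<sigma>_def)
    have "\<rho> < ?c2 / (2 * N) * ?q2 ^ k2" using \<rho> by (simp add: \<rho>0_def)
    then have \<sigma>lt: "\<sigma> < ?q2 ^ k2" using N c2 by (simp add: \<sigma>_def field_simps)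
    then have \<sigma>q: "\<sigma> \<le> ?q2 ^ k2" by simp
    have "?q2 ^ k2 \<le> 1" using q by (intro power_le_one) auto
    then have \<sigma>1: "\<sigma> < 1" using \<sigma>lt by linarith
    obtain A where "X.scale_subdivision C1 \<rho> A" using C1(2)[OF \<rho>(1) \<rho>1(1)] by blast
    then have A: "subdivision A K" "\<And>a. a \<in> A \<Longrightarrow> X.rmin * \<rho> \<le> \<bar>fst a\<bar>" "\<And>a. a \<in> A \<Longrightarrow> \<bar>fst a\<bar> \<le> \<rho>"
        "(\<Sum>a\<in>A. \<bar>fst a\<bar> powr ?s) = 1"
        "\<And>t R. 0 < R \<Longrightarrow> (\<Sum>a\<in>A. \<bar>fst a\<bar> powr ?s * of_bool (\<bar>aff a x0 - t\<bar> \<le> R)) \<le> C1 * max R \<rho> powr ?s"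
        "(?q1 ^ k1) powr ?s \<le> (\<Sum>a\<in>A. \<bar>fst a\<bar> powr ?s * of_bool (\<bar>aff a x0 - x1\<bar> \<le> ?q1 ^ k1))"
      unfolding X.scale_subdivision_def using g x0 \<rho>1(2) by auto
    obtain B where "Y.scale_subdivision C2 \<sigma> B" using C2(2)[OF \<sigma>0 \<sigma>1] by blast
    then have B: "subdivision B K'" "\<And>a. a \<in> B \<Longrightarrow> ?c2 * \<sigma> \<le> \<bar>fst a\<bar>" "\<And>a. a \<in> B \<Longrightarrow> \<bar>fst a\<bar> \<le> \<sigma>"
        "(\<Sum>a\<in>B. \<bar>fst a\<bar> powr ?s') = 1"
        "\<And>t R. 0 < R \<Longrightarrow> (\<Sum>a\<in>B. \<bar>fst a\<bar> powr ?s' * of_bool (\<bar>aff a y0 - t\<bar> \<le> R)) \<le> C2 * max R \<sigma> powr ?s'"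
        "(?q2 ^ k2) powr ?s' \<le> (\<Sum>a\<in>B. \<bar>fst a\<bar> powr ?s' * of_bool (\<bar>aff a y0 - y0\<bar> \<le> ?q2 ^ k2))"
      unfolding Y.scale_subdivision_def using b \<sigma>q by auto
    have finA: "finite A" and finB: "finite B" using A(1) B(1) by (auto simp: subdivision_def)
    have yB: "aff b y0 \<in> {0..1}" if "b \<in> B" for b
      using subdivision_hull[OF B(1) that] b(2) Y.J_unit by blast
    \<comment> \<open>Only pieces near \<open>(x1, y0)\<close> are used, to keep all targets in the window of radius \<open>w\<close>.\<close>
    define P where "P = {(a, b) \<in> A \<times> B. \<bar>aff a x0 - x1\<bar> \<le> w1 \<and> \<bar>aff b y0 - y0\<bar> \<le> w1}"
    define wt where "wt = (\<lambda>(a :: real \<times> real, b :: real \<times> real). \<bar>fst a\<bar> powr ?s * \<bar>fst b\<bar> powr ?s')"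
    define X where "X = (\<lambda>(a, b :: real \<times> real). aff a x0)"
    define Y where "Y = (\<lambda>(a :: real \<times> real, b). aff b y0)"
    have PAB: "P \<subseteq> A \<times> B" by (auto simp: P_def)
    then have finP: "finite P" using finA finB by (auto intro: finite_subset)
    have wt0: "0 \<le> wt q" for q by (auto simp: wt_def split: prod.split)
    define \<delta> where "\<delta> = k * \<rho>"
    have \<delta>: "0 < \<delta>" "\<delta> \<le> \<rho>" using k \<rho> by (auto simp: \<delta>_def intro: mult_left_le_one_le)
    define h where "h = CE * \<rho> / \<kappa>"
    have h: "0 < h" using CE \<rho> \<kappa> by (simp add: h_def)
    define W where "W = (\<Sum>q\<in>P. wt q)"
    have W: "p \<le> W"
    proof -
      have "p \<le> (\<Sum>a\<in>A. \<bar>fst a\<bar> powr ?s * of_bool (\<bar>aff a x0 - x1\<bar> \<le> ?q1 ^ k1)) *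
           (\<Sum>a\<in>B. \<bar>fst a\<bar> powr ?s' * of_bool (\<bar>aff a y0 - y0\<bar> \<le> ?q2 ^ k2))"
        unfolding p_def by (intro mult_mono[OF A(6) B(6)] sum_nonneg) auto
      also have "\<dots> = (\<Sum>q\<in>A\<times>B. wt q * of_bool (\<bar>X q - x1\<bar> \<le> ?q1 ^ k1 \<and> \<bar>Y q - y0\<bar> \<le> ?q2 ^ k2))"
        unfolding sum_product sum.cartesian_product
        by (intro sum.cong refl) (auto simp: wt_def X_def Y_def)
      also have "\<dots> \<le> (\<Sum>q\<in>A\<times>B. wt q * of_bool (q \<in> P))"
      proof (intro sum_mono mult_left_mono wt0)
        fix q assume "q \<in> A \<times> B"
        then show "of_bool (\<bar>X q - x1\<bar> \<le> ?q1 ^ k1 \<and> \<bar>Y q - y0\<bar> \<le> ?q2 ^ k2) \<le> (of_bool (q \<in> P) :: real)"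
          using k1 k2 by (auto simp: P_def X_def Y_def)
      qed
      also have "\<dots> = W"
        unfolding W_def using finA finB PAB
        by (intro sum.mono_neutral_cong_right) auto
      finally show ?thesis .
    qed
    have W0: "0 < W" using W p by simp
    have regA: "(\<Sum>a\<in>A. \<bar>fst a\<bar> powr ?s * of_bool (\<bar>aff a x0 - t\<bar> \<le> R)) \<le> C1 * R powr ?s" if "\<rho> \<le> R" for t R
      using A(5)[of R t] that \<rho> by (simp add: max_absorb1)
    have regB: "(\<Sum>a\<in>B. \<bar>fst a\<bar> powr ?s' * of_bool (\<bar>aff a y0 - t\<bar> \<le> R)) \<le> Cb * R powr ?s'" if R: "\<rho> \<le> R" for t R
    proof -
      have "?c2 * R \<le> 2 * N * R" using c2 N R \<rho> by (intro mult_right_mono) auto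
      then have "R \<le> 2 * N / ?c2 * R" using c2 by (simp add: field_simps)
      moreover have "\<sigma> \<le> 2 * N / ?c2 * R" using R N c2 by (simp add: \<sigma>_def field_simps)
      ultimately have "max R \<sigma> powr ?s' \<le> (2 * N / ?c2 * R) powr ?s'"
        using s R \<rho> by (intro powr_mono2) auto
      also have "\<dots> = (2 * N / ?c2) powr ?s' * R powr ?s'" using N c2 R \<rho> by (subst powr_mult) auto
      finally have "C2 * max R \<sigma> powr ?s' \<le> Cb * R powr ?s'" using C2 by (simp add: Cb_def)
      then show ?thesis using B(5)[of R t] R \<rho> by linarith
    qed
    let ?m = "\<lambda>q q'. measure lborel {r \<in> {-N..N}. \<bar>X q - X q' + r * (Y q - Y q')\<bar> \<le> 2 * \<delta>}"
    have "(\<Sum>q\<in>P. \<Sum>q'\<in>P. wt q * wt q' * ?m q q') \<le> (\<Sum>q\<in>A\<times>B. \<Sum>q'\<in>A\<times>B. wt q * wt q' * ?m q q')"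
      using wt0 PAB finA finB
      by (intro order_trans[OF sum_mono[OF sum_mono2] sum_mono2] sum_nonneg mult_nonneg_nonneg) auto
    also have "\<dots> = (\<Sum>(a,b)\<in>A\<times>B. \<Sum>(a',b')\<in>A\<times>B.
        (\<bar>fst a\<bar> powr ?s * \<bar>fst b\<bar> powr ?s') * (\<bar>fst a'\<bar> powr ?s * \<bar>fst b'\<bar> powr ?s') *
        measure lborel {r \<in> {-N..N}. \<bar>aff a x0 - aff a' x0 + r * (aff b y0 - aff b' y0)\<bar> \<le> 2 * \<delta>})"
      unfolding wt_def X_def Y_def by (simp add: case_prod_unfold)
    also have "\<dots> \<le> CE * \<rho>"
      unfolding CE_def
    proof (rule energy_bound)
      show "\<And>b. b \<in> B \<Longrightarrow> aff b y0 \<in> {0..1}" by (rule yB)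
    qed (fact finA finB A(4) B(4) regA regB | use \<rho> \<rho>1 s C1 Cb N \<delta> in simp)+
    finally have energy: "(\<Sum>q\<in>P. \<Sum>q'\<in>P. wt q * wt q' * ?m q q') / h \<le> \<kappa>"
      using CE \<rho> \<kappa> by (simp add: h_def field_simps)
    define E where "E = {r \<in> {-N..N}. close_mass P wt X Y \<delta> r \<le> h}"
    define T where "T = {(r, t). \<delta> * W / (2 * w) \<le> local_mass P wt X Y \<delta> r t}"
    have Em: "E \<in> sets borel" unfolding E_def close_mass_def by measurable
    have "{-N..N} - E = {r \<in> {-N..N}. h < close_mass P wt X Y \<delta> r}" by (auto simp: E_def)
    then have Ebad: "emeasure lborel ({-N..N} - E) \<le> ennreal \<kappa>"
      using order_trans[OF bad_slopes_measure[OF finP wt0 h] ennreal_leI[OF energy]] by simp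
    have Tm: "T \<in> sets borel"
    proof -
      have "(\<lambda>(r, t). local_mass P wt X Y \<delta> r t) \<in> borel_measurable (borel \<Otimes>\<^sub>M borel)"
        unfolding local_mass_def by measurable
      then have [measurable]: "(\<lambda>(r, t). local_mass P wt X Y \<delta> r t) \<in> borel_measurable borel"
        unfolding borel_prod .
      have "T = {q. \<delta> * W / (2 * w) \<le> (\<lambda>(r, t). local_mass P wt X Y \<delta> r t) q}" by (auto simp: T_def)
      then show ?thesis by simp
    qed
    have slices: "{t. (r, t) \<in> T} \<subseteq> {x1 + r * y0 - w..x1 + r * y0 + w} \<and> \<tau> \<le> measure lborel {t. (r, t) \<in> T}"
      if r: "r \<in> E" for r
    proof -
      have near: "\<bar>X q + r * Y q - (x1 + r * y0)\<bar> + \<delta> \<le> w" if "q \<in> P" for q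
      proof -
        have "\<bar>X q - x1\<bar> \<le> w1" "\<bar>Y q - y0\<bar> \<le> w1" using that by (auto simp: P_def X_def Y_def)
        moreover have "\<bar>r * (Y q - y0)\<bar> \<le> N * w1"
          unfolding abs_mult using calculation(2) r by (intro mult_mono) (auto simp: E_def)
        moreover have "X q + r * Y q - (x1 + r * y0) = X q - x1 + r * (Y q - y0)" by (simp add: algebra_simps)
        ultimately have "\<bar>X q + r * Y q - (x1 + r * y0)\<bar> \<le> w1 + N * w1" by linarith
        also have "w1 + N * w1 = w / 2"
        proof -
          have "2 * (1 + N) \<noteq> 0" using N by simp
          then have "w1 * (2 * (1 + N)) = w" using w1_def by (metis nonzero_eq_divide_eq)
          then show ?thesis by (simp add: algebra_simps)
        qed
        finally have "\<bar>X q + r * Y q - (x1 + r * y0)\<bar> \<le> w / 2" .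
        moreover have "\<delta> \<le> k" using k \<rho>1 unfolding \<delta>_def by (intro mult_left_le) auto
        ultimately show ?thesis using k by linarith
      qed
      have Th: "{t. (r, t) \<in> T} = {t. \<delta> * W / (2 * w) \<le> local_mass P wt X Y \<delta> r t}" by (simp add: T_def)
      have cm: "close_mass P wt X Y \<delta> r \<le> h" using r by (simp add: E_def)
      note lev = level_set_measure[OF finP wt0 W_def W0 \<delta>(1) w near cm h]
      have "\<tau> = \<delta> * p\<^sup>2 / (2 * h)" using \<rho> \<kappa> CE by (simp add: \<tau>_def h_def \<delta>_def)
      also have "\<dots> \<le> \<delta> * W\<^sup>2 / (2 * h)"
        using W p \<delta> h by (intro divide_right_mono mult_left_mono power_mono) auto
      finally show ?thesis using lev unfolding Th by auto
    qed
    have count: "c * \<rho> powr (1 - ?s - ?s') \<le> card {a\<in>A. \<exists>b\<in>B. \<bar>t' - (aff a x0 + r' * aff b y0)\<bar> \<le> 2 * k * \<rho>}"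
      if rt: "(r, t) \<in> T" "\<bar>r' - r\<bar> \<le> k * \<rho> / 2" "\<bar>t' - t\<bar> \<le> k * \<rho> / 2" "1 / (2 * N) \<le> \<bar>r'\<bar>" for r t r' t'
    proof -
      define S where "S = {a\<in>A. \<exists>b\<in>B. \<bar>t' - (aff a x0 + r' * aff b y0)\<bar> \<le> 2 * k * \<rho>}"
      let ?near = "\<lambda>a b. \<bar>t' - (aff a x0 + r' * aff b y0)\<bar> \<le> 2 * \<delta>"
      have finS: "finite S" using finA by (simp add: S_def)
      have "0 < 1 / (2 * N)" using N by simp
      then have r'0: "0 < \<bar>r'\<bar>" using rt(4) by linarith
      \<comment> \<open>Each piece in \<open>A\<close> has only boundedly many partners in \<open>B\<close>, in terms of weight.\<close>
      have inner: "(\<Sum>b\<in>B. \<bar>fst b\<bar> powr ?s' * of_bool (?near a b)) \<le> of_bool (a \<in> S) * (D * \<rho> powr ?s')"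
        if a: "a \<in> A" for a
      proof (cases "a \<in> S")
        case False
        then have "(\<Sum>b\<in>B. \<bar>fst b\<bar> powr ?s' * of_bool (?near a b)) = 0"
          using a by (intro sum.neutral) (auto simp: S_def \<delta>_def)
        then show ?thesis using False by simp
      next
        case True
        have "?near a b \<Longrightarrow> \<bar>aff b y0 - (t' - aff a x0) / r'\<bar> \<le> 4 * N * \<rho>" for b
        proof -
          assume n: "?near a b"
          have "t' - (aff a x0 + r' * aff b y0) = - (r' * (aff b y0 - (t' - aff a x0) / r'))"
          proof -
            have e: "r' * ((t' - aff a x0) / r') = t' - aff a x0" using r'0 by simp
            show ?thesis by (subst right_diff_distrib, subst e) simp
          qed
          then have "\<bar>r'\<bar> * \<bar>aff b y0 - (t' - aff a x0) / r'\<bar> \<le> 2 * \<delta>" using n by (simp add: abs_mult)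
          moreover have "1 / (2 * N) * \<bar>aff b y0 - (t' - aff a x0) / r'\<bar> \<le> \<bar>r'\<bar> * \<bar>aff b y0 - (t' - aff a x0) / r'\<bar>"
            using rt(4) by (intro mult_right_mono) auto
          ultimately have "1 / (2 * N) * \<bar>aff b y0 - (t' - aff a x0) / r'\<bar> \<le> 2 * \<rho>" using \<delta> by linarith
          then show ?thesis using N by (simp add: field_simps)
        qed
        then have "(\<Sum>b\<in>B. \<bar>fst b\<bar> powr ?s' * of_bool (?near a b))
            \<le> (\<Sum>b\<in>B. \<bar>fst b\<bar> powr ?s' * of_bool (\<bar>aff b y0 - (t' - aff a x0) / r'\<bar> \<le> 4 * N * \<rho>))"
          by (intro sum_mono mult_left_mono) auto
        also have "\<dots> \<le> C2 * max (4 * N * \<rho>) \<sigma> powr ?s'" using N \<rho> by (intro B(5)) simp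
        also have "\<dots> \<le> C2 * (4 * N / ?c2 * \<rho>) powr ?s'"
        proof -
          have "?c2 * (4 * N * \<rho>) \<le> 1 * (4 * N * \<rho>)" using c2 N \<rho> by (intro mult_right_mono) auto
          then have "4 * N * \<rho> \<le> 4 * N / ?c2 * \<rho>" using c2 by (simp add: field_simps)
          moreover have "\<sigma> \<le> 4 * N / ?c2 * \<rho>" using N c2 \<rho> by (simp add: \<sigma>_def field_simps)
          ultimately have "max (4 * N * \<rho>) \<sigma> powr ?s' \<le> (4 * N / ?c2 * \<rho>) powr ?s'"
            using s \<sigma>0 by (intro powr_mono2) (auto simp: le_max_iff_disj)
          then show ?thesis using C2 by (intro mult_left_mono) auto
        qed
        also have "\<dots> = D * \<rho> powr ?s'" unfolding D_def using N c2 \<rho> by (subst powr_mult) simp_all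
        finally show ?thesis using True by simp
      qed
      have "k * \<rho> * p / (2 * w) \<le> \<delta> * W / (2 * w)"
        unfolding \<delta>_def using W k \<rho> w by (intro divide_right_mono mult_left_mono) auto
      also have "\<dots> \<le> (\<Sum>q\<in>P. wt q * of_bool (\<bar>t - (X q + r * Y q)\<bar> \<le> \<delta>))"
        using rt(1) by (simp add: T_def local_mass_def)
      also have "\<dots> \<le> (\<Sum>q\<in>A\<times>B. wt q * of_bool (\<bar>t' - (X q + r' * Y q)\<bar> \<le> 2 * \<delta>))"
      proof (rule order_trans[OF sum_mono sum_mono2])
        fix q assume q: "q \<in> P"
        have "Y q \<in> {0..1}" using q PAB yB by (auto simp: Y_def)
        then have "\<bar>(r' - r) * Y q\<bar> \<le> \<delta> / 2 * 1"
          unfolding abs_mult using rt(2) k \<rho> by (intro mult_mono) (auto simp: \<delta>_def)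
        moreover have "t' - (X q + r' * Y q) = t - (X q + r * Y q) + (t' - t) - (r' - r) * Y q"
          by (simp add: algebra_simps)
        ultimately have "\<bar>t - (X q + r * Y q)\<bar> \<le> \<delta> \<Longrightarrow> \<bar>t' - (X q + r' * Y q)\<bar> \<le> 2 * \<delta>"
          using rt(3) unfolding \<delta>_def by linarith
        then show "wt q * of_bool (\<bar>t - (X q + r * Y q)\<bar> \<le> \<delta>) \<le> wt q * of_bool (\<bar>t' - (X q + r' * Y q)\<bar> \<le> 2 * \<delta>)"
          by (intro mult_left_mono wt0) auto
      qed (use PAB finA finB wt0 in auto)
      also have "\<dots> = (\<Sum>a\<in>A. \<bar>fst a\<bar> powr ?s * (\<Sum>b\<in>B. \<bar>fst b\<bar> powr ?s' * of_bool (?near a b)))"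
        unfolding sum.cartesian_product[symmetric] sum_distrib_left
        by (simp add: sum.cartesian_product wt_def X_def Y_def case_prod_unfold mult.assoc)
      also have "\<dots> \<le> (\<Sum>a\<in>A. \<bar>fst a\<bar> powr ?s * (of_bool (a \<in> S) * (D * \<rho> powr ?s')))"
        using inner by (intro sum_mono mult_left_mono) auto
      also have "\<dots> \<le> (\<Sum>a\<in>A. \<rho> powr ?s * (of_bool (a \<in> S) * (D * \<rho> powr ?s')))"
        using A(3) D s by (intro sum_mono mult_right_mono powr_mono2) auto
      also have "\<dots> = (\<Sum>a\<in>S. \<rho> powr ?s * (D * \<rho> powr ?s'))"
        using finA by (intro sum.mono_neutral_cong_right) (auto simp: S_def)
      also have "\<dots> = real (card S) * (\<rho> powr ?s * (D * \<rho> powr ?s'))" by simp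
      finally have fin: "k * \<rho> * p / (2 * w) \<le> real (card S) * (\<rho> powr ?s * (D * \<rho> powr ?s'))" .
      have "\<rho> powr (1 - ?s - ?s') * \<rho> powr ?s * \<rho> powr ?s' = \<rho> powr 1"
        by (simp only: powr_add[symmetric]) simp
      then have pr: "\<rho> powr (1 - ?s - ?s') * \<rho> powr ?s * \<rho> powr ?s' = \<rho>" using \<rho> by simp
      have "c * \<rho> powr (1 - ?s - ?s') * (\<rho> powr ?s * (D * \<rho> powr ?s')) =
          c * D * (\<rho> powr (1 - ?s - ?s') * \<rho> powr ?s * \<rho> powr ?s')" by (simp only: mult_ac)
      also have "\<dots> = k * \<rho> * p / (2 * w)" unfolding pr using D w by (simp add: c_def)
      finally have "c * \<rho> powr (1 - ?s - ?s') * (\<rho> powr ?s * (D * \<rho> powr ?s'))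
          \<le> real (card S) * (\<rho> powr ?s * (D * \<rho> powr ?s'))" using fin by linarith
      then show ?thesis using \<rho> D unfolding S_def by simp
    qed
    have B2: "2 * N * \<rho> \<le> \<bar>fst b\<bar> \<and> \<bar>fst b\<bar> \<le> 1" if "b \<in> B" for b
    proof -
      have "?c2 * \<sigma> = 2 * N * \<rho>" using c2 by (simp add: \<sigma>_def)
      then show ?thesis using B(2)[OF that] B(3)[OF that] \<sigma>1 by linarith
    qed
    have EN: "E \<subseteq> {-N..N}" by (auto simp: E_def)
    show "\<exists>A B E T. sliced x0 x1 y0 N w k \<kappa> \<tau> c \<rho> A B E T"
      unfolding sliced_def
      by (intro exI[of _ A] exI[of _ B] exI[of _ E] exI[of _ T] conjI ballI allI impI A(1) B(1) Em EN Ebad Tm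
          A(2) A(3) B2[THEN conjunct1] B2[THEN conjunct2] slices[THEN conjunct1] slices[THEN conjunct2] count;
          assumption)
  qed
qed

end

section \<open>Inward perturbations\<close>

lemma net_count_vs_decay:
  fixes C P \<eta> :: real
  assumes "0 < C" "0 < P" "0 < \<eta>"
  shows "((\<lambda>\<rho>. (C / \<rho>\<^sup>2 + 3)\<^sup>2 * exp (- P * \<rho> powr (- \<eta>))) \<longlongrightarrow> 0) (at_right 0)"
  using assms by real_asymp

lemma power_normalization:
  fixes x q :: real
  assumes "1 \<le> x" "0 < q" "q < 1"
  shows "\<exists>n. q \<le> x * q ^ n \<and> x * q ^ n \<le> 1"
proof -
  obtain m where "q ^ m < 1 / x" using real_arch_pow_inv[of "1 / x" q] assms by auto
  then have m: "x * q ^ m \<le> 1" using assms by (simp add: field_simps)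
  define n where "n = (LEAST n. x * q ^ n \<le> 1)"
  have n: "x * q ^ n \<le> 1" unfolding n_def using m by (rule LeastI)
  have "q \<le> x * q ^ n"
  proof (cases n)
    case 0
    then show ?thesis using n assms by simp
  next
    case (Suc j)
    then have "1 \<le> x * q ^ j" using not_less_Least[of j "\<lambda>n. x * q ^ n \<le> 1"] by (simp add: n_def)
    then have "q * 1 \<le> q * (x * q ^ j)" using assms by (intro mult_left_mono) auto
    then show ?thesis using Suc by (simp add: mult_ac)
  qed
  with n show ?thesis by blast
qed

text \<open>
  The perturbation inserted before a map of the subdivision: \<open>u = (z, v)\<close> stands for
  \<open>x \<mapsto> x0 + (x - x1 + v) / z\<close>. Perturbing by an inner map keeps the pieces inside the original ones, hence
  disjoint.
\<close>
definition inward :: "real \<Rightarrow> real \<Rightarrow> real \<times> real \<Rightarrow> real \<times> real" where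
  "inward x0 x1 u = (1 / fst u, x0 - (x1 - snd u) / fst u)"

lemma aff_inward: "aff (inward x0 x1 (z, v)) x = x0 + (x - x1 + v) / z"
  by (simp add: aff_def inward_def diff_divide_distrib add_divide_distrib)

text \<open>
  Shifting the reference point \<open>x0\<close> slightly from \<open>x1\<close> towards the midpoint of the hull leaves room for
  translations of both signs, even if \<open>x1\<close> is an endpoint.
\<close>
lemma inward_maps_to:
  assumes \<theta>: "0 < \<theta>" "\<theta> \<le> 1/16" and x1: "x1 \<in> {\<alpha>..\<beta>}" and x: "x \<in> {\<alpha>..\<beta>}"
    and x0: "x0 = (1 - \<theta>) * x1 + \<theta> * ((\<alpha> + \<beta>) / 2)"
    and z: "1 + 2 * \<theta> \<le> z" and v: "\<bar>v\<bar> \<le> \<theta> * (\<beta> - \<alpha>) / 2"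
  shows "aff (inward x0 x1 (z, v)) x \<in> {\<alpha>..\<beta>}"
proof -
  have z1: "1 / z \<le> 1 - \<theta>"
  proof -
    have "1 / z \<le> 1 / (1 + 2 * \<theta>)" using z \<theta> by (intro divide_left_mono) auto
    also have "1 \<le> (1 - \<theta>) * (1 + 2 * \<theta>)"
      using \<theta> mult_left_mono[of "2 * \<theta>" 1 \<theta>] by (simp add: algebra_simps)
    then have "1 / (1 + 2 * \<theta>) \<le> 1 - \<theta>" using \<theta> by (simp add: pos_divide_le_eq)
    finally show ?thesis .
  qed
  have z0: "0 < 1 / z" "1 / z \<le> 1" using z \<theta> by auto
  have vz: "\<bar>v * (1 / z)\<bar> \<le> \<theta> * (\<beta> - \<alpha>) / 2"
  proof -
    have "\<bar>v * (1 / z)\<bar> \<le> \<bar>v\<bar> * 1" unfolding abs_mult using z0 by (intro mult_mono) auto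
    also have "\<dots> \<le> \<theta> * (\<beta> - \<alpha>) / 2" using v by simp
    finally show ?thesis .
  qed
  define i where "i = 1 / z"
  have e: "aff (inward x0 x1 (z, v)) x = x0 + (x - x1) * i + v * i"
    by (simp add: aff_inward add_divide_distrib i_def)
  have le: "(x1 - \<alpha>) * i \<le> (x1 - \<alpha>) * (1 - \<theta>)" "(\<alpha> - x1) * i \<le> (x - x1) * i"
    "(\<beta> - x1) * i \<le> (\<beta> - x1) * (1 - \<theta>)" "(x - x1) * i \<le> (\<beta> - x1) * i"
    using x1 x z0 z1 unfolding i_def by (intro mult_left_mono mult_right_mono; simp)+
  have "x0 - \<alpha> = (x1 - \<alpha>) * (1 - \<theta>) + \<theta> * (\<beta> - \<alpha>) / 2"
    "\<beta> - x0 = (\<beta> - x1) * (1 - \<theta>) + \<theta> * (\<beta> - \<alpha>) / 2"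
    unfolding x0 by (simp_all add: field_simps)
  moreover have "(\<alpha> - x1) * i = - ((x1 - \<alpha>) * i)" by (simp add: algebra_simps)
  moreover have "\<bar>v * i\<bar> \<le> \<theta> * (\<beta> - \<alpha>) / 2" using vz by (simp only: i_def)
  ultimately show ?thesis unfolding e atLeastAtMost_iff using le by linarith
qed

lemma power_of_map:
  assumes "aff b ` S \<subseteq> S" "aff b y = y"
  shows "\<exists>e. aff e ` S \<subseteq> S \<and> aff e y = y \<and> fst e = fst b ^ n"
proof (induction n)
  case 0
  then show ?case by (intro exI[of _ "(1, 0)"]) auto
next
  case (Suc n)
  then obtain e where e: "aff e ` S \<subseteq> S" "aff e y = y" "fst e = fst b ^ n" by blast
  have "aff (aff_comp b e) ` S = aff b ` (aff e ` S)" by (simp add: image_image aff_aff_comp)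
  then have "aff (aff_comp b e) ` S \<subseteq> S" using e(1) assms(1) by blast
  then show ?case using e assms(2) by (intro exI[of _ "aff_comp b e"]) (simp add: aff_aff_comp)
qed

text \<open>
  Appending a power of \<open>b\<close> to \<open>b'\<close> brings the ratio of slopes back into the range \<open>[\<bar>fst b\<bar>, 1]\<close> without
  moving the image of the fixed point \<open>y0\<close> of \<open>b\<close>. This prevents slopes from drifting under repeated
  renormalization.
\<close>
lemma compensating_word:
  assumes b: "aff b ` S \<subseteq> S" "aff b y0 = y0" "0 < \<bar>fst b\<bar>" "\<bar>fst b\<bar> < 1"
    and b': "aff b' ` S \<subseteq> S" "\<bar>fst b'\<bar> \<le> 1" and x: "1 \<le> \<bar>x * fst b'\<bar>"
  shows "\<exists>e. aff e ` S \<subseteq> S \<and> aff e y0 = aff b' y0 \<and> \<bar>fst e\<bar> \<le> 1 \<and> \<bar>fst b\<bar> \<le> \<bar>x * fst e\<bar> \<and> \<bar>x * fst e\<bar> \<le> 1"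
proof -
  obtain n where n: "\<bar>fst b\<bar> \<le> \<bar>x * fst b'\<bar> * \<bar>fst b\<bar> ^ n" "\<bar>x * fst b'\<bar> * \<bar>fst b\<bar> ^ n \<le> 1"
    using power_normalization[OF x b(3,4)] by blast
  obtain e where e: "aff e ` S \<subseteq> S" "aff e y0 = y0" "fst e = fst b ^ n"
    using power_of_map[OF b(1,2)] by blast
  have "aff (aff_comp b' e) ` S = aff b' ` (aff e ` S)" by (simp add: image_image aff_aff_comp)
  then have "aff (aff_comp b' e) ` S \<subseteq> S" using e(1) b'(1) by blast
  moreover have "\<bar>fst b\<bar> ^ n \<le> 1" using b by (intro power_le_one) auto
  then have "\<bar>fst b'\<bar> * \<bar>fst b\<bar> ^ n \<le> 1" using b' by (intro mult_le_one) auto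
  ultimately show ?thesis using e n
    by (intro exI[of _ "aff_comp b' e"]) (auto simp: aff_aff_comp abs_mult power_abs mult.assoc)
qed

lemma measure_box:
  fixes a b c d :: real assumes "a \<le> b" "c \<le> d"
  shows "emeasure lborel ({a..b} \<times> {c..d}) = ennreal ((b - a) * (d - c))"
proof -
  have "emeasure lborel ({a..b} \<times> {c..d}) = emeasure (lborel \<Otimes>\<^sub>M lborel) ({a..b} \<times> {c..d})"
    by (simp add: lborel_prod)
  also have "\<dots> = emeasure lborel {a..b} * emeasure lborel {c..d}"
    by (rule lborel.emeasure_pair_measure_Times) auto
  finally show ?thesis using assms by (simp add: ennreal_mult')
qed

section \<open>Existence of a recurrent perturbation\<close>

context ifs_pair begin

text \<open>
  The perturbed pieces of \<open>K\<close> are chosen at random, independently of each other, and a recurrent set is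
  built for a suitable outcome.
\<close>
lemma perturbation:
  assumes "0 < \<epsilon>" "0 < M" and \<theta>: "0 < \<theta>" "\<theta> \<le> 1/16"
  shows "\<exists>A \<omega> x0 x1 L E. subdivision A K \<and> (\<forall>a\<in>A. 0 < \<bar>fst a\<bar> \<and> \<bar>fst a\<bar> < 1) \<and>
     (\<forall>a\<in>A. fst (\<omega> a) \<in> {1 + 2 * \<theta>..1 + 4 * \<theta>} \<and> \<bar>snd (\<omega> a)\<bar> \<le> \<theta>) \<and>
     x1 \<in> {0..1} \<and> \<bar>x0 - x1\<bar> \<le> \<theta> \<and>
     (\<forall>a\<in>A. aff (inward x0 x1 (\<omega> a)) ` X.J \<subseteq> X.J) \<and>
     compact L \<and> L \<noteq> {} \<and> L \<subseteq> X.J \<and> L = (\<Union>a\<in>A. aff (aff_comp a (inward x0 x1 (\<omega> a))) ` L) \<and>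
     E \<in> sets borel \<and> E \<subseteq> {inverse M<..<M} \<and> emeasure lborel ({inverse M<..<M} - E) < ennreal \<epsilon> \<and>
     (\<forall>r\<in>E. \<exists>a b. a < b \<and> {a..b} \<subseteq> {x + r * y | x y. x \<in> L \<and> y \<in> K'})"
proof -
  obtain g where g: "g \<in> \<Phi>" using X.ne by blast
  obtain x1 where x1: "x1 \<in> X.J" "aff g x1 = x1" using X.fixed_point[OF g] by blast
  obtain b where b: "b \<in> \<Psi>" using Y.ne by blast
  obtain y0 where y0: "y0 \<in> Y.J" "aff b y0 = y0" using Y.fixed_point[OF b] by blast
  obtain \<alpha> \<beta> where J: "X.J = {\<alpha>..\<beta>}" "0 \<le> \<alpha>" "\<alpha> \<le> \<beta>" "\<beta> \<le> 1" by (rule X.J_Icc)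
  have "0 < X.sdim" using Y.sdim_le_1 dims by linarith
  then have \<alpha>\<beta>: "\<alpha> < \<beta>" using X.hull_nondegenerate J(1) by blast
  have x1J: "x1 \<in> {\<alpha>..\<beta>}" using x1(1) J(1) by simp
  have y01: "0 \<le> y0" "y0 \<le> 1" using y0(1) Y.J_unit by auto
  define x0 where "x0 = (1 - \<theta>) * x1 + \<theta> * ((\<alpha> + \<beta>) / 2)"
  have x0x1: "x0 - x1 = \<theta> * ((\<alpha> + \<beta>) / 2 - x1)" by (simp add: x0_def algebra_simps)
  have "\<bar>(\<alpha> + \<beta>) / 2 - x1\<bar> \<le> 1" using x1J J unfolding atLeastAtMost_iff by (simp add: abs_le_iff field_simps)
  then have x0x1le: "\<bar>x0 - x1\<bar> \<le> \<theta>" unfolding x0x1 abs_mult using \<theta> by (simp add: mult_left_le)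
  have x0: "x0 \<in> X.J"
    unfolding x0_def using convexD_alt[OF convex_convex_hull[of K], of x1 "(\<alpha> + \<beta>) / 2" \<theta>] x1(1) J \<theta> by simp
  define v0 where "v0 = \<theta> * (\<beta> - \<alpha>) / 2"
  have "\<theta> * (\<beta> - \<alpha>) \<le> \<theta> * 1" using J \<theta> by (intro mult_left_mono) auto
  then have v0: "0 < v0" "v0 \<le> \<theta> / 2" using \<theta> \<alpha>\<beta> by (auto simp: v0_def)
  define c1 where "c1 = X.rmin"
  have c1: "0 < c1" "c1 < 1" using X.rmin by (auto simp: c1_def)
  \<comment> \<open>Chosen so that a piece hitting within \<open>2 k \<rho>\<close> is off by at most \<open>v0 / 4\<close> after renormalization.\<close>
  define k where "k = c1 * v0 / 8"
  have "c1 * v0 \<le> 1 * v0" using c1 v0 by (intro mult_right_mono) auto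
  then have "k \<le> 1" "k \<le> v0 / 2 / 2" unfolding k_def using v0 \<theta> by linarith+
  moreover have "0 < k" using c1 v0 by (simp add: k_def)
  ultimately have k: "0 < k" "k \<le> 1" "k \<le> v0 / 2 / 2" by auto
  define q where "q = \<bar>fst b\<bar>"
  have q: "0 < q" "q < 1" using Y.ratio[OF b] by (auto simp: q_def)
  define N where "N = max (max M 2) (1 / q)"
  have N: "2 \<le> N" "M \<le> N" "1 / q \<le> N" by (auto simp: N_def)
  have Nq: "1 / N \<le> q" using N q by (simp add: field_simps)
  define \<kappa> where "\<kappa> = min (\<epsilon> / 2) (q * \<theta>)"
  have \<kappa>: "0 < \<kappa>" "\<kappa> \<le> q * \<theta>" "\<kappa> < \<epsilon>" using \<open>0 < \<epsilon>\<close> q \<theta> by (auto simp: \<kappa>_def min_def)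
  let ?e = "1 - X.sdim - Y.sdim"
  have N1: "1 \<le> N" and w: "0 < v0 / 2" using N v0 by auto
  obtain \<tau> c \<rho>0 where \<tau>: "0 < \<tau>" and c: "0 < c" and \<rho>0: "0 < \<rho>0" and data: "\<And>\<rho>. 0 < \<rho> \<Longrightarrow> \<rho> < \<rho>0 \<Longrightarrow>
      \<exists>A B E T. sliced x0 x1 y0 N (v0 / 2) k \<kappa> \<tau> c \<rho> A B E T"
    using transversal_slices[OF g x1 x0 b y0 N1 w k \<kappa>(1)] by blast
  \<comment> \<open>The success probability \<open>\<tau> \<theta> / \<bar>Box\<bar>\<close>; the minimum with 1 spares a proof that it is at most 1.\<close>
  define p where "p = min 1 (\<tau> / (4 * v0))"
  have p: "0 < p" "p \<le> 1" "p \<le> \<tau> / (4 * v0)" using \<tau> v0 by (auto simp: p_def)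
  define Bd where "Bd = N + 3"
  define C where "C = 24 * N * Bd / (k * c1)"
  have C: "0 < C" using N k c1 by (simp add: C_def Bd_def)
  \<comment> \<open>At scale \<open>\<rho>\<close> there are polynomially many demands, but each fails with super-polynomially small probability.\<close>
  have ev1: "eventually (\<lambda>\<rho>. (C / \<rho>\<^sup>2 + 3)\<^sup>2 * exp (- (p * c) * \<rho> powr (- (X.sdim + Y.sdim - 1))) < 1) (at_right 0)"
    using net_count_vs_decay[OF C, of "p * c" "X.sdim + Y.sdim - 1"] p c dims
    by (intro order_tendstoD(2)[of _ 0]) auto
  have ev2: "eventually (\<lambda>\<rho>. \<rho> < min \<rho>0 (1 / N)) (at_right 0)"
    using \<rho>0 N by (intro eventually_at_rightI[of 0 "min \<rho>0 (1 / N)"]) auto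
  have "eventually (\<lambda>\<rho>. (C / \<rho>\<^sup>2 + 3)\<^sup>2 * exp (- (p * c) * \<rho> powr (- (X.sdim + Y.sdim - 1))) < 1
      \<and> \<rho> < min \<rho>0 (1 / N) \<and> 0 < \<rho>) (at_right 0)"
    using ev1 ev2 eventually_at_right_less[of "0::real"] by eventually_elim auto
  then obtain \<rho> where "(C / \<rho>\<^sup>2 + 3)\<^sup>2 * exp (- (p * c) * \<rho> powr (- (X.sdim + Y.sdim - 1))) < 1"
      and \<rho>: "0 < \<rho>" "\<rho> < \<rho>0" "\<rho> < 1 / N"
    using eventually_happens'[of "at_right (0::real)"] by (auto simp: trivial_limit_at_right_real)
  then have few: "(C / \<rho>\<^sup>2 + 3)\<^sup>2 * exp (- (p * c * \<rho> powr ?e)) < 1" by (simp add: algebra_simps)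
  have "1 / N \<le> 1 / 2" using N by (intro divide_left_mono) auto
  then have \<rho>1: "\<rho> < 1" using \<rho> by linarith
  define \<delta> where "\<delta> = k * \<rho>"
  have \<delta>: "0 < \<delta>" "\<delta> \<le> \<rho>" using k \<rho> by (auto simp: \<delta>_def intro: mult_left_le_one_le)
  obtain A B E T where ABET: "sliced x0 x1 y0 N (v0 / 2) k \<kappa> \<tau> c \<rho> A B E T"
    using data[OF \<rho>(1,2)] by blast
  have A: "subdivision A K" "\<And>a. a \<in> A \<Longrightarrow> c1 * \<rho> \<le> \<bar>fst a\<bar>" "\<And>a. a \<in> A \<Longrightarrow> \<bar>fst a\<bar> \<le> \<rho>"
    and B: "subdivision B K'" "\<And>b. b \<in> B \<Longrightarrow> 2 * N * \<rho> \<le> \<bar>fst b\<bar>" "\<And>b. b \<in> B \<Longrightarrow> \<bar>fst b\<bar> \<le> 1"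
    and E: "E \<in> sets borel" "E \<subseteq> {-N..N}" "emeasure lborel ({-N..N} - E) \<le> ennreal \<kappa>"
    and T: "T \<in> sets borel"
    and slice: "\<And>r. r \<in> E \<Longrightarrow> {t. (r, t) \<in> T} \<subseteq> {x1 + r * y0 - v0 / 2..x1 + r * y0 + v0 / 2}"
      "\<And>r. r \<in> E \<Longrightarrow> \<tau> \<le> measure lborel {t. (r, t) \<in> T}"
    and many: "\<And>r t r' t'. \<lbrakk>(r, t) \<in> T; \<bar>r' - r\<bar> \<le> \<delta> / 2; \<bar>t' - t\<bar> \<le> \<delta> / 2; 1 / (2 * N) \<le> \<bar>r'\<bar>\<rbrakk> \<Longrightarrow>
        c * \<rho> powr ?e \<le> card {a\<in>A. \<exists>b\<in>B. \<bar>t' - (aff a x0 + r' * aff b y0)\<bar> \<le> 2 * \<delta>}"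
    using ABET unfolding sliced_def c1_def \<delta>_def mult.assoc[of 2 k \<rho>] by blast+
  have A0: "0 < \<bar>fst a\<bar>" if "a \<in> A" for a using A(2)[OF that] c1 \<rho> by (smt (verit) mult_pos_pos)
  have finA: "finite A" and KA: "K = (\<Union>a\<in>A. aff a ` K)" and dA: "disjoint_family_on (\<lambda>a. aff a ` X.J) A"
    using A(1) by (auto simp: subdivision_def)
  have A_ne: "A \<noteq> {}" using KA X.K_ne by auto
  \<comment> \<open>\<open>R0\<close> is the target of the renormalization; its neighbourhood \<open>R\<close> will be recurrent.\<close>
  define R0 where "R0 = {(r, t). r \<in> E \<and> 1 / N \<le> \<bar>r\<bar> \<and> (r, t) \<in> T}"
  define R where "R = {(r, t). \<exists>r0 t0. (r0, t0) \<in> R0 \<and> \<bar>r - r0\<bar> \<le> \<delta> / 2 \<and> \<bar>t - t0\<bar> \<le> \<delta> / 2}"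
  have R_bd: "\<bar>r\<bar> \<le> Bd \<and> \<bar>t\<bar> \<le> Bd \<and> 1 / (2 * N) \<le> \<bar>r\<bar>" if rt: "(r, t) \<in> R" for r t
  proof -
    obtain r0 t0 where r0: "r0 \<in> E" "1 / N \<le> \<bar>r0\<bar>" "(r0, t0) \<in> T" "\<bar>r - r0\<bar> \<le> \<delta> / 2" "\<bar>t - t0\<bar> \<le> \<delta> / 2"
      using rt unfolding R_def R0_def mem_Collect_eq case_prod_conv by blast
    have "r0 \<in> {-N..N}" using r0(1) E(2) by blast
    then have "\<bar>r0\<bar> \<le> N" by (simp add: abs_le_iff)
    then have "\<bar>r0 * y0\<bar> \<le> N * 1" unfolding abs_mult using y01 by (intro mult_mono) auto
    moreover have "t0 \<in> {x1 + r0 * y0 - v0 / 2..x1 + r0 * y0 + v0 / 2}" using slice(1)[OF r0(1)] r0(3) by blast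
    moreover have "0 \<le> x1" "x1 \<le> 1" using x1J J by auto
    moreover have "1 / (2 * N) = 1 / N / 2" by simp
    ultimately show ?thesis
      using r0 \<open>\<bar>r0\<bar> \<le> N\<close> \<delta> \<rho> \<rho>1 v0 \<theta> unfolding Bd_def atLeastAtMost_iff by linarith
  qed
  have R_many: "c * \<rho> powr ?e \<le> card {a\<in>A. \<exists>b\<in>B. \<bar>t - (aff a x0 + r * aff b y0)\<bar> \<le> 2 * \<delta>}" if "(r, t) \<in> R" for r t
    using that R_bd[OF that] many unfolding R_def R0_def mem_Collect_eq case_prod_conv by blast
  \<comment> \<open>Renormalization expands distances by a factor of order \<open>1 / \<rho>\<close>, so a net of mesh \<open>\<rho>^2\<close> controls all of \<open>R\<close>.\<close>
  define d where "d = k * c1 * \<rho>\<^sup>2 / (12 * N)"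
  have d: "0 < d" using k c1 \<rho> N by (simp add: d_def)
  have "0 \<le> Bd" using N by (simp add: Bd_def)
  then obtain U where U: "finite U" "U \<subseteq> R" "real (card U) \<le> (2 * Bd / d + 3)\<^sup>2"
     "\<And>r t. (r, t) \<in> R \<Longrightarrow> \<exists>r0 t0. (r0, t0) \<in> U \<and> \<bar>r - r0\<bar> \<le> d \<and> \<bar>t - t0\<bar> \<le> d"
    using finite_net[OF d, of R Bd] R_bd by metis
  have Cd: "2 * Bd / d = C / \<rho>\<^sup>2" using k c1 \<rho> N by (simp add: d_def C_def field_simps)
  define S where "S u = {a\<in>A. \<exists>b\<in>B. \<bar>snd u - (aff a x0 + fst u * aff b y0)\<bar> \<le> 2 * \<delta>}" for u :: "real \<times> real"
  define m where "m = nat \<lceil>c * \<rho> powr ?e\<rceil>"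
  have Sm: "m \<le> card (S u)" if "u \<in> U" for u
    using R_many[of "fst u" "snd u"] U(2) that by (auto simp: S_def m_def ceiling_le_iff)
  have "\<exists>e. aff e ` K' \<subseteq> K' \<and> \<bar>fst e\<bar> \<le> 1 \<and> \<bar>snd u - (aff a x0 + fst u * aff e y0)\<bar> \<le> 2 * \<delta> \<and>
      q \<le> \<bar>fst u * fst e / fst a\<bar> \<and> \<bar>fst u * fst e / fst a\<bar> \<le> 1" if u: "u \<in> U" "a \<in> S u" for u a
  proof -
    obtain b' where b': "b' \<in> B" "\<bar>snd u - (aff a x0 + fst u * aff b' y0)\<bar> \<le> 2 * \<delta>" and a: "a \<in> A"
      using u(2) by (auto simp: S_def)
    have "1 / (2 * N) \<le> \<bar>fst u\<bar>" using R_bd[of "fst u" "snd u"] u(1) U(2) by auto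
    then have "1 / (2 * N) * (2 * N * \<rho>) \<le> \<bar>fst u\<bar> * \<bar>fst b'\<bar>"
      using B(2)[OF b'(1)] N \<rho> by (intro mult_mono) auto
    moreover have "1 / (2 * N) * (2 * N * \<rho>) = \<rho>" using N by simp
    ultimately have "\<bar>fst a\<bar> \<le> \<bar>fst u\<bar> * \<bar>fst b'\<bar>" using A(3)[OF a] by linarith
    then have x: "1 \<le> \<bar>fst u / fst a * fst b'\<bar>" using A0[OF a] by (simp add: abs_mult field_simps)
    have sb: "aff b ` K' \<subseteq> K'" using Y.sub b by (auto simp: subdivision_def)
    have sb': "aff b' ` K' \<subseteq> K'" using B(1) b'(1) unfolding subdivision_def by blast
    obtain e where e: "aff e ` K' \<subseteq> K'" "aff e y0 = aff b' y0" "\<bar>fst e\<bar> \<le> 1"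
        "q \<le> \<bar>fst u / fst a * fst e\<bar>" "\<bar>fst u / fst a * fst e\<bar> \<le> 1"
      using compensating_word[OF sb y0(2) q[unfolded q_def] sb' B(3)[OF b'(1)] x] unfolding q_def by blast
    show ?thesis using e b'(2) by (intro exI[of _ e]) simp
  qed
  then have "\<exists>e. \<forall>u\<in>U. \<forall>a\<in>S u. aff (e u a) ` K' \<subseteq> K' \<and> \<bar>fst (e u a)\<bar> \<le> 1 \<and>
      \<bar>snd u - (aff a x0 + fst u * aff (e u a) y0)\<bar> \<le> 2 * \<delta> \<and>
      q \<le> \<bar>fst u * fst (e u a) / fst a\<bar> \<and> \<bar>fst u * fst (e u a) / fst a\<bar> \<le> 1"
    by metis
  then obtain e where e: "\<And>u a. u \<in> U \<Longrightarrow> a \<in> S u \<Longrightarrow> aff (e u a) ` K' \<subseteq> K' \<and> \<bar>fst (e u a)\<bar> \<le> 1 \<and>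
      \<bar>snd u - (aff a x0 + fst u * aff (e u a) y0)\<bar> \<le> 2 * \<delta> \<and>
      q \<le> \<bar>fst u * fst (e u a) / fst a\<bar> \<and> \<bar>fst u * fst (e u a) / fst a\<bar> \<le> 1"
    by blast
  \<comment> \<open>The slope and the target seen from the unperturbed piece \<open>a\<close> and its partner \<open>e u a\<close>.\<close>
  define r1 where "r1 u a = fst u * fst (e u a) / fst a" for u a
  define tt where "tt u a = (snd u - snd a - fst u * snd (e u a)) / fst a" for u a
  define G where "G u a = {(z, v). z \<in> {1 + 2 * \<theta>..1 + 4 * \<theta>} \<and> v \<in> {-v0..v0} \<and> r1 u a * z \<in> E \<and>
              (r1 u a * z, x1 + z * (tt u a - x0) - v) \<in> T}" for u a
  define Box where "Box = {1 + 2 * \<theta>..1 + 4 * \<theta>} \<times> {-v0..v0}"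
  have Box: "emeasure lborel Box = ennreal (4 * \<theta> * v0)"
    unfolding Box_def using \<theta> v0 by (subst measure_box) (auto simp: algebra_simps)
  have Boxm: "Box \<in> sets borel" unfolding Box_def by (intro borel_Times) auto
  let ?M = "uniform_measure lborel Box"
  have prob: "prob_space ?M"
    using Box \<theta> v0 by (intro prob_space_uniform_measure) auto
  have G: "G u a \<in> sets ?M \<and> p \<le> measure ?M (G u a)" if u: "u \<in> U" "a \<in> S u" for u a
  proof -
    have a: "a \<in> A" using u(2) by (simp add: S_def)
    note ee = e[OF u]
    have "tt u a - x0 - r1 u a * y0 = (snd u - (aff a x0 + fst u * aff (e u a) y0)) / fst a"
      using A0[OF a] by (simp add: tt_def r1_def aff_def field_simps)
    then have "\<bar>tt u a - x0 - r1 u a * y0\<bar> \<le> 2 * \<delta> / \<bar>fst a\<bar>"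
      using ee by (simp add: abs_divide divide_right_mono)
    also have "\<dots> \<le> 2 * \<delta> / (c1 * \<rho>)" using A(2)[OF a] A0[OF a] c1 \<rho> \<delta> by (intro divide_left_mono mult_pos_pos) auto
    also have "\<dots> = v0 / 4" using c1 \<rho> by (simp add: \<delta>_def k_def)
    finally have near: "\<bar>tt u a - x0 - r1 u a * y0\<bar> \<le> v0 / 4" .
    have gp: "G u a \<in> sets borel" "ennreal (\<theta> * \<tau>) \<le> emeasure lborel (G u a)"
      unfolding G_def
      using good_parameters[OF E T slice q(1) _ _ _ \<kappa>(2) \<theta>(1) _ N(1) v0(1) _ near] ee \<kappa> \<theta> \<tau>
      by (auto simp: r1_def)
    have sub: "G u a \<subseteq> Box" by (auto simp: G_def Box_def)
    have fin: "emeasure lborel (G u a) \<noteq> \<infinity>"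
      using emeasure_mono[OF sub, of lborel] Boxm Box by (auto simp: top_unique)
    have "\<theta> * \<tau> \<le> measure lborel (G u a)"
      using gp(2) fin \<theta> \<tau> by (simp add: emeasure_eq_ennreal_measure measure_nonneg)
    then have "\<theta> * \<tau> / (4 * \<theta> * v0) \<le> measure lborel (G u a) / (4 * \<theta> * v0)"
      using \<theta> v0 by (intro divide_right_mono) auto
    moreover have "measure ?M (G u a) = measure lborel (G u a) / (4 * \<theta> * v0)"
    proof -
      have "measure ?M (G u a) = measure lborel (Box \<inter> G u a) / measure lborel Box"
        using Boxm gp(1) Box \<theta> v0 by (intro measure_uniform_measure) auto
      moreover have "measure lborel Box = 4 * \<theta> * v0" using Box \<theta> v0 by (simp add: measure_def)
      ultimately show ?thesis using sub by (simp add: Int_absorb1)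
    qed
    moreover have "\<theta> * \<tau> / (4 * \<theta> * v0) = \<tau> / (4 * v0)" using \<theta> by simp
    ultimately show ?thesis using gp(1) p(3) by auto
  qed
  have small: "real (card U) * (1 - p) ^ m < 1"
  proof -
    have "(1 - p) ^ m \<le> exp (- p) ^ m" using p exp_ge_add_one_self[of "- p"] by (intro power_mono) auto
    also have "\<dots> = exp (- (p * real m))" by (simp add: exp_of_nat_mult[symmetric] mult.commute)
    also have "\<dots> \<le> exp (- (p * c * \<rho> powr ?e))"
    proof -
      have "c * \<rho> powr ?e \<le> real m" unfolding m_def by linarith
      then show ?thesis using p by (simp add: mult.assoc)
    qed
    finally have "real (card U) * (1 - p) ^ m \<le> (C / \<rho>\<^sup>2 + 3)\<^sup>2 * exp (- (p * c * \<rho> powr ?e))"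
      using U(3) p unfolding Cd by (intro mult_mono) auto
    then show ?thesis using few by linarith
  qed
  have "\<exists>\<omega>. (\<forall>a\<in>A. \<omega> a \<in> space ?M) \<and> (\<forall>u\<in>U. \<exists>a\<in>S u. \<omega> a \<in> G u a)"
    using prob finA U(1) _ Sm G[THEN conjunct1] G[THEN conjunct2] _ p(2) small
    by (rule independent_choice) (use p in \<open>auto simp: S_def\<close>)
  then obtain \<omega>' where \<omega>': "\<And>u. u \<in> U \<Longrightarrow> \<exists>a\<in>S u. \<omega>' a \<in> G u a" by blast
  \<comment> \<open>The random parameters lie in \<open>Box\<close> only almost surely; indices outside it are not used and can be reset.\<close>
  define \<omega> where "\<omega> a = (if \<omega>' a \<in> Box then \<omega>' a else (1 + 2 * \<theta>, 0))" for a
  have \<omega>Box: "\<omega> a \<in> Box" for a using \<theta> v0 by (auto simp: \<omega>_def Box_def)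
  have \<omega>: "\<exists>a\<in>S u. \<omega> a \<in> G u a" if u: "u \<in> U" for u
  proof -
    obtain a where a: "a \<in> S u" "\<omega>' a \<in> G u a" using \<omega>'[OF u] by blast
    then have "\<omega>' a \<in> Box" by (auto simp: G_def Box_def)
    then show ?thesis using a by (auto simp: \<omega>_def)
  qed
  define f where "f a = aff (aff_comp a (inward x0 x1 (\<omega> a)))" for a
  have inw: "aff (inward x0 x1 (\<omega> a)) ` X.J \<subseteq> X.J" for a
  proof
    fix y assume "y \<in> aff (inward x0 x1 (\<omega> a)) ` X.J"
    then obtain x where x: "x \<in> {\<alpha>..\<beta>}" "y = aff (inward x0 x1 (\<omega> a)) x" using J by auto
    have "aff (inward x0 x1 (fst (\<omega> a), snd (\<omega> a))) x \<in> {\<alpha>..\<beta>}"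
      using \<omega>Box[of a] by (intro inward_maps_to[OF \<theta> x1J x(1) x0_def]) (auto simp: Box_def v0_def)
    then show "y \<in> X.J" using x J by simp
  qed
  have fimg: "f a ` S = aff a ` (aff (inward x0 x1 (\<omega> a)) ` S)" for a S
    by (simp add: f_def image_image aff_aff_comp)
  have fJ: "f a ` X.J \<subseteq> aff a ` X.J" for a unfolding fimg using inw by (rule image_mono)
  have aJ: "aff a ` X.J \<subseteq> X.J" if "a \<in> A" for a using subdivision_hull[OF A(1) that] .
  have \<omega>1: "1 + 2 * \<theta> \<le> fst (\<omega> a)" "fst (\<omega> a) \<le> 1 + 4 * \<theta>" "\<bar>snd (\<omega> a)\<bar> \<le> v0" for a
    using \<omega>Box[of a] by (auto simp: Box_def)
  have "\<exists>L. compact L \<and> L \<noteq> {} \<and> L \<subseteq> X.J \<and> L = (\<Union>a\<in>A. f a ` L)"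
  proof (rule attractor_exists[OF finA A_ne])
    show "compact X.J" "X.J \<noteq> {}" using J by auto
    fix a assume a: "a \<in> A"
    show "continuous_on X.J (f a)" unfolding f_def aff_def by (intro continuous_intros)
    show "inj (f a)" using A0[OF a] \<omega>1[of a] \<theta> by (auto simp: f_def inj_def aff_def inward_def)
    show "f a ` X.J \<subseteq> X.J" using fJ aJ[OF a] by blast
  next
    have "f a ` X.J \<inter> f a' ` X.J = {}" if "a \<in> A" "a' \<in> A" "a \<noteq> a'" for a a'
      using disjoint_family_onD[OF dA that] fJ[of a] fJ[of a'] by blast
    then show "disjoint_family_on (\<lambda>a. f a ` X.J) A" by (simp add: disjoint_family_on_def)
  qed
  then obtain L where L: "compact L" "L \<noteq> {}" "L \<subseteq> X.J" "L = (\<Union>a\<in>A. f a ` L)" by blast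
  have recur: "\<exists>l r' t'. \<bar>l\<bar> \<le> \<rho> \<and> (r', t') \<in> R \<and>
       (\<forall>x\<in>L. \<forall>y\<in>K'. \<exists>x1\<in>L. \<exists>y1\<in>K'. x1 + r * y1 - t = l * (x + r' * y - t'))" if rt: "(r, t) \<in> R" for r t
  proof -
    obtain r0 t0 where u: "(r0, t0) \<in> U" "\<bar>r - r0\<bar> \<le> d" "\<bar>t - t0\<bar> \<le> d" using U(4)[OF rt] by blast
    let ?u = "(r0, t0)"
    obtain a where a: "a \<in> S ?u" "\<omega> a \<in> G ?u a" using \<omega>[OF u(1)] by blast
    then have aA: "a \<in> A" by (simp add: S_def)
    obtain z v where zv: "\<omega> a = (z, v)" by (cases "\<omega> a")
    have z: "1 \<le> z" "z \<le> 2" using \<omega>1[of a] \<theta> zv by auto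
    define b1 where "b1 = e ?u a"
    note ee = e[OF u(1) a(1), folded b1_def, simplified]
    \<comment> \<open>The net point \<open>(r0, t0)\<close> is sent into \<open>R0\<close>; the same renormalization sends \<open>(r, t)\<close> nearby, into \<open>R\<close>.\<close>
    define r' where "r' = r * fst b1 / fst a * z"
    define t' where "t' = x1 + z * ((t - snd a - r * snd b1) / fst a - x0) - v"
    define r0' where "r0' = r0 * fst b1 / fst a * z"
    define t0' where "t0' = x1 + z * ((t0 - snd a - r0 * snd b1) / fst a - x0) - v"
    have "(r0', t0') \<in> R0"
    proof -
      have "1 / N \<le> \<bar>r0 * fst b1 / fst a\<bar> * 1" using ee Nq by linarith
      also have "\<dots> \<le> \<bar>r0 * fst b1 / fst a\<bar> * z" using z by (intro mult_left_mono) auto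
      also have "\<dots> = \<bar>r0'\<bar>" using z by (simp add: r0'_def abs_mult)
      finally show ?thesis
        using a(2) unfolding R0_def G_def zv r1_def tt_def b1_def[symmetric] by (simp add: r0'_def t0'_def)
    qed
    have r0N: "1 / (2 * N) \<le> \<bar>r0\<bar>" using R_bd[of r0 t0] u(1) U(2) by auto
    have "\<bar>fst b1 / fst a\<bar> * (1 / (2 * N)) \<le> \<bar>fst b1 / fst a\<bar> * \<bar>r0\<bar>" using r0N by (intro mult_left_mono) auto
    also have "\<dots> \<le> 1" using ee by (simp add: abs_mult mult.commute)
    finally have fin: "\<bar>fst b1 / fst a\<bar> * (1 / (2 * N)) \<le> 1" .
    have "\<bar>fst b1 / fst a\<bar> = \<bar>fst b1 / fst a\<bar> * (1 / (2 * N)) * (2 * N)" using N by simp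
    also have "\<dots> \<le> 1 * (2 * N)" using N by (intro mult_right_mono fin) simp
    finally have ba: "\<bar>fst b1 / fst a\<bar> \<le> 2 * N" by simp
    have "r' - r0' = (r - r0) * (fst b1 / fst a) * z"
      by (simp add: r'_def r0'_def left_diff_distrib diff_divide_distrib)
    then have "\<bar>r' - r0'\<bar> \<le> d * (2 * N) * 2"
      using u(2) ba z d N by (simp only: abs_mult, intro mult_mono mult_nonneg_nonneg) (simp_all del: abs_divide)
    also have "\<dots> = \<delta> * (c1 * \<rho>) / 3" using N by (simp add: d_def \<delta>_def power2_eq_square)
    also have "\<dots> \<le> \<delta> / 2"
    proof -
      have "c1 * \<rho> \<le> 1" using c1 \<rho> \<rho>1 by (intro mult_le_one) auto
      then have "\<delta> * (c1 * \<rho>) \<le> \<delta>" using \<delta> by (intro mult_left_le) auto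
      then show ?thesis using \<delta> by simp
    qed
    finally have r'c: "\<bar>r' - r0'\<bar> \<le> \<delta> / 2" .
    have sb1: "\<bar>snd b1\<bar> \<le> 2"
    proof -
      obtain y where y: "y \<in> K'" using Y.K_ne by blast
      have "aff b1 y \<in> K'" using ee y by auto
      then have "aff b1 y \<in> {0..1}" "y \<in> {0..1}" using Y.K_unit y by auto
      moreover have "\<bar>fst b1 * y\<bar> \<le> 1"
        unfolding abs_mult using ee \<open>y \<in> {0..1}\<close> by (intro mult_le_one) auto
      ultimately show ?thesis by (auto simp: aff_def abs_le_iff)
    qed
    have "t' - t0' = z * (((t - t0) - (r - r0) * snd b1) / fst a)"
      using A0[OF aA] by (simp add: t'_def t0'_def field_simps)
    also have "\<bar>\<dots>\<bar> \<le> 2 * ((d + d * 2) / (c1 * \<rho>))"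
    proof -
      have "\<bar>(r - r0) * snd b1\<bar> \<le> d * 2" unfolding abs_mult using u sb1 d by (intro mult_mono) auto
      then have "\<bar>(t - t0) - (r - r0) * snd b1\<bar> \<le> d + d * 2" using u by linarith
      then have "\<bar>(t - t0) - (r - r0) * snd b1\<bar> / \<bar>fst a\<bar> \<le> (d + d * 2) / (c1 * \<rho>)"
        using A(2)[OF aA] c1 \<rho> by (intro frac_le) auto
      then show ?thesis unfolding abs_mult abs_divide using z d c1 \<rho> by (intro mult_mono) auto
    qed
    also have "\<dots> = \<delta> / (2 * N)" using c1 \<rho> N by (simp add: d_def \<delta>_def power2_eq_square)
    also have "\<dots> \<le> \<delta> / 2" using \<delta> N by (intro divide_left_mono) auto
    finally have t'c: "\<bar>t' - t0'\<bar> \<le> \<delta> / 2" .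
    have "(r', t') \<in> R" using \<open>(r0', t0') \<in> R0\<close> r'c t'c by (auto simp: R_def)
    moreover have "\<bar>fst a / z\<bar> \<le> \<rho>"
    proof -
      have "\<bar>fst a\<bar> / z \<le> \<bar>fst a\<bar> / 1" using z by (intro divide_left_mono) auto
      then show ?thesis using A(3)[OF aA] z by (simp add: abs_divide)
    qed
    moreover have "\<exists>x1\<in>L. \<exists>y1\<in>K'. x1 + r * y1 - t = fst a / z * (x + r' * y - t')" if xy: "x \<in> L" "y \<in> K'" for x y
    proof (intro bexI)
      have "f a x = fst a * (x0 + (x - x1 + v) / z) + snd a"
        unfolding f_def aff_aff_comp zv aff_inward by (simp add: aff_def)
      then have fx: "f a x = fst a * x0 + fst a / z * (x - x1 + v) + snd a"
        by (simp add: distrib_left add_divide_distrib)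
      define Q where "Q = z * ((t - snd a - r * snd b1) / fst a - x0)"
      have rb: "fst a / z * r' = r * fst b1" using A0[OF aA] z by (simp add: r'_def)
      have Q: "fst a / z * Q = t - snd a - r * snd b1 - fst a * x0"
      proof -
        have "fst a * ((t - snd a - r * snd b1) / fst a) = t - snd a - r * snd b1" using A0[OF aA] by simp
        then have "fst a * ((t - snd a - r * snd b1) / fst a - x0) = t - snd a - r * snd b1 - fst a * x0"
          by (simp only: right_diff_distrib)
        moreover have "fst a / z * Q = fst a * ((t - snd a - r * snd b1) / fst a - x0)"
          using z unfolding Q_def by (simp only: times_divide_eq_left mult.left_commute[of "fst a" z]) simp
        ultimately show ?thesis by simp
      qed
      have "c * (x + r' * y - (x1 + Q - v)) = c * (x - x1 + v) + c * r' * y - c * Q" for c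
        by (simp add: algebra_simps)
      from this[of "fst a / z"] show "f a x + r * aff b1 y - t = fst a / z * (x + r' * y - t')"
        unfolding t'_def Q_def[symmetric] rb Q fx by (simp add: aff_def algebra_simps)
      show "f a x \<in> L" using L(4) aA xy by blast
      show "aff b1 y \<in> K'" using ee xy by auto
    qed
    ultimately show ?thesis by blast
  qed
  have L01: "L \<subseteq> {0..1}" using L(3) X.J_unit by blast
  have inR: "t \<in> {x + r * y | x y. x \<in> L \<and> y \<in> K'}" if "(r, t) \<in> R" for r t
    by (rule recurrent_set_sum[OF L(1,2) L01 Y.compact_K Y.K_ne Y.K_unit _ recur _ \<rho>1 that, of Bd])
       (use R_bd \<rho> in auto)
  define E' where "E' = E \<inter> {inverse M<..<M}"
  have E'm: "E' \<in> sets borel" using E(1) by (simp add: E'_def)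
  have MN: "1 / N \<le> r \<and> r \<le> N" if "r \<in> {inverse M<..<M}" for r
  proof -
    have "1 / N \<le> 1 / M" using N \<open>0 < M\<close> by (intro divide_left_mono) auto
    then show ?thesis using that N by (auto simp: inverse_eq_divide)
  qed
  have "{inverse M<..<M} - E' \<subseteq> {-N..N} - E"
  proof
    fix r assume r: "r \<in> {inverse M<..<M} - E'"
    then have "inverse M < r" "r \<le> N" using MN by auto
    moreover have "0 < inverse M" using \<open>0 < M\<close> by simp
    ultimately have "- N \<le> r" "r \<le> N" using N by linarith+
    then have "r \<in> {-N..N}" by simp
    then show "r \<in> {-N..N} - E" using r unfolding E'_def by blast
  qed
  then have "emeasure lborel ({inverse M<..<M} - E') \<le> emeasure lborel ({-N..N} - E)"
    by (rule emeasure_mono) (use E(1) in simp)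
  also have "\<dots> \<le> ennreal \<kappa>" by fact
  also have "\<dots> < ennreal \<epsilon>" using \<kappa> by (intro ennreal_lessI) auto
  finally have E'bad: "emeasure lborel ({inverse M<..<M} - E') < ennreal \<epsilon>" .
  have ivl: "\<exists>a b. a < b \<and> {a..b} \<subseteq> {x + r * y | x y. x \<in> L \<and> y \<in> K'}" if r: "r \<in> E'" for r
  proof -
    have rE: "r \<in> E" and "1 / N \<le> r" using r MN by (auto simp: E'_def)
    have "{t. (r, t) \<in> T} \<noteq> {}"
    proof
      assume "{t. (r, t) \<in> T} = {}"
      then show False using slice(2)[OF rE] \<tau> by simp
    qed
    then obtain t0 where "(r, t0) \<in> T" by blast
    then have "(r, t0) \<in> R0" using rE \<open>1 / N \<le> r\<close> by (simp add: R0_def)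
    moreover have "\<bar>r - r\<bar> \<le> \<delta> / 2" "\<bar>t - t0\<bar> \<le> \<delta> / 2" if "t \<in> {t0..t0 + \<delta> / 2}" for t
      using that \<delta> by auto
    ultimately have "(r, t) \<in> R" if "t \<in> {t0..t0 + \<delta> / 2}" for t
      using that unfolding R_def by blast
    then have "{t0..t0 + \<delta> / 2} \<subseteq> {x + r * y | x y. x \<in> L \<and> y \<in> K'}" using inR by blast
    then show ?thesis using \<delta> by (intro exI[of _ t0] exI[of _ "t0 + \<delta> / 2"]) auto
  qed
  have x1u: "x1 \<in> {0..1}" using x1J J by auto
  have \<omega>2: "\<forall>a\<in>A. fst (\<omega> a) \<in> {1 + 2 * \<theta>..1 + 4 * \<theta>} \<and> \<bar>snd (\<omega> a)\<bar> \<le> \<theta>"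
  proof (intro ballI conjI)
    fix a
    show "fst (\<omega> a) \<in> {1 + 2 * \<theta>..1 + 4 * \<theta>}" using \<omega>1[of a] by simp
    show "\<bar>snd (\<omega> a)\<bar> \<le> \<theta>" using \<omega>1(3)[of a] v0 \<theta> by linarith
  qed
  have Ar: "\<forall>a\<in>A. 0 < \<bar>fst a\<bar> \<and> \<bar>fst a\<bar> < 1"
  proof
    fix a assume "a \<in> A"
    then show "0 < \<bar>fst a\<bar> \<and> \<bar>fst a\<bar> < 1" using A0 A(3)[of a] \<rho>1 by auto
  qed
  have E'M: "E' \<subseteq> {inverse M<..<M}" by (simp add: E'_def)
  have inwA: "\<forall>a\<in>A. aff (inward x0 x1 (\<omega> a)) ` X.J \<subseteq> X.J" using inw by blast
  have ivlA: "\<forall>r\<in>E'. \<exists>a b. a < b \<and> {a..b} \<subseteq> {x + r * y | x y. x \<in> L \<and> y \<in> K'}" using ivl by blast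
  show ?thesis
    by (intro exI[of _ A] exI[of _ \<omega>] exI[of _ x0] exI[of _ x1] exI[of _ L] exI[of _ E'] conjI
        A(1) Ar \<omega>2 x1u x0x1le inwA L(1) L(2) L(3) L(4)[unfolded f_def] E'm E'M E'bad ivlA)
qed

end

section \<open>Closeness of the perturbed set\<close>

lemma interval_center_aff: "interval_center (aff g ` {0..1}) = aff g (1/2)"
proof -
  have "aff g ` {0..1} = (if 0 \<le> fst g then {snd g..fst g + snd g} else {fst g + snd g..snd g})"
    unfolding aff_def by (auto simp: image_affinity_atLeastAtMost)
  then show ?thesis by (auto simp: interval_center_def aff_def)
qed

lemma eps_close_intervals_perturbed:
  assumes a: "fst a \<noteq> 0" and \<theta>: "0 < \<theta>" "\<theta> \<le> \<epsilon> / 16" "\<theta> \<le> 1 / 16"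
    and u: "fst u \<in> {1 + 2 * \<theta>..1 + 4 * \<theta>}" "\<bar>snd u\<bar> \<le> \<theta>"
    and x: "x1 \<in> {0..1}" "\<bar>x0 - x1\<bar> \<le> \<theta>"
  shows "eps_close_intervals \<epsilon> (aff a ` {0..1}) (aff (aff_comp a (inward x0 x1 u)) ` {0..1})"
proof -
  obtain z v where zv: "u = (z, v)" by (cases u)
  have z: "1 + 2 * \<theta> \<le> z" "z \<le> 1 + 4 * \<theta>" "\<bar>v\<bar> \<le> \<theta>" using u zv by auto
  then have z12: "1 \<le> z" "z \<le> 2" using \<theta> by auto
  let ?l = "\<bar>fst a\<bar>"
  have m1: "measure lborel (aff a ` {0..1}) = ?l" by (simp add: measure_aff)
  have m2: "measure lborel (aff (aff_comp a (inward x0 x1 u)) ` {0..1}) = ?l / z"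
    using z12 by (simp add: measure_aff inward_def zv)
  have ratio: "?l / (?l / z) = z" using a z12 by simp
  have min: "min ?l (?l / z) = ?l / z"
  proof -
    have "?l / z \<le> ?l / 1" using z12 by (intro divide_left_mono) auto
    then show ?thesis by simp
  qed
  have "z * (aff (inward x0 x1 u) (1/2) - 1/2) = z * (x0 - x1) + (1 - z) * (1/2 - x1) + v"
    using z12 by (simp add: zv aff_inward field_simps)
  also have "\<bar>\<dots>\<bar> \<le> 2 * \<theta> + 4 * \<theta> * (1/2) + \<theta>"
  proof -
    have "\<bar>z * (x0 - x1)\<bar> \<le> 2 * \<theta>" unfolding abs_mult using z12 x by (intro mult_mono) auto
    moreover have "\<bar>1/2 - x1\<bar> \<le> 1/2" using x(1) unfolding atLeastAtMost_iff by linarith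
    then have "\<bar>(1 - z) * (1/2 - x1)\<bar> \<le> 4 * \<theta> * (1/2)"
      unfolding abs_mult using z z12 \<theta> by (intro mult_mono) auto
    ultimately show ?thesis using z(3) by linarith
  qed
  also have "\<dots> < \<epsilon>" using \<theta> by linarith
  finally have zc: "\<bar>z * (aff (inward x0 x1 u) (1/2) - 1/2)\<bar> < \<epsilon>" .
  have "dist (aff a (1/2)) (aff (aff_comp a (inward x0 x1 u)) (1/2)) = ?l * \<bar>aff (inward x0 x1 u) (1/2) - 1/2\<bar>"
    by (simp only: dist_real_def aff_aff_comp aff_diff abs_mult abs_minus_commute[of "1/2"])
  also have "\<dots> = ?l / z * \<bar>z * (aff (inward x0 x1 u) (1/2) - 1/2)\<bar>"
    using z12 by (simp add: abs_mult)
  also have "\<dots> < ?l / z * \<epsilon>" using zc a z12 by (intro mult_strict_left_mono) auto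
  finally have "dist (aff a (1/2)) (aff (aff_comp a (inward x0 x1 u)) (1/2)) < \<epsilon> * (?l / z)" by (simp add: mult.commute)
  moreover have "1 - \<epsilon> < z" "z < 1 + \<epsilon>" using z \<theta> by linarith+
  ultimately show ?thesis
    unfolding eps_close_intervals_def interval_center_aff m1 m2 ratio min by simp
qed

text \<open>Relabelling a family by natural numbers.\<close>
lemma generates_nat:
  assumes A: "finite A" "\<And>a. a \<in> A \<Longrightarrow> 0 < \<bar>fst (p a)\<bar> \<and> \<bar>fst (p a)\<bar> < 1"
    and L: "L = (\<Union>a\<in>A. aff (p a) ` L)"
    and disj: "disjoint_family_on (\<lambda>a. aff (p a) ` (convex hull L)) A"
    and e: "bij_betw e I A"
  shows "generates I (\<lambda>i. aff (p (e i))) L"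
  unfolding generates_def
proof (intro conjI ballI)
  show "finite I" using A e by (simp add: bij_betw_finite)
  show "contracting_similarity (aff (p (e i)))" if "i \<in> I" for i
    using A(2)[OF bij_betwE[OF e, rule_format, OF that]]
    by (auto simp: contracting_similarity_def aff_def fun_eq_iff)
  have "L = (\<Union>a\<in>e ` I. aff (p a) ` L)" using L bij_betw_imp_surj_on[OF e] by simp
  then show "L = (\<Union>i\<in>I. aff (p (e i)) ` L)" by (simp add: image_image)
  show "disjoint_family_on (\<lambda>i. aff (p (e i)) ` (convex hull L)) I"
    unfolding disjoint_family_on_def
  proof (intro ballI impI)
    fix i j assume ij: "i \<in> I" "j \<in> I" "i \<noteq> j"
    then have "e i \<in> A" "e j \<in> A" "e i \<noteq> e j" using e by (auto simp: bij_betw_def inj_on_def)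
    then show "aff (p (e i)) ` (convex hull L) \<inter> aff (p (e j)) ` (convex hull L) = {}"
      by (rule disjoint_family_onD[OF disj])
  qed
qed

theorem theorem1p1:
  fixes K K' :: "real set" and \<epsilon> M :: real
  assumes "self_similar_cantor_set K"
    and "self_similar_cantor_set K'"
    and "hausdorff_dim K + hausdorff_dim K' > 1"
    and "\<epsilon> > 0"
    and "M > 0"
  shows "\<exists>(L :: real set) (E :: real set).
      self_similar_cantor_set L \<and>
      E \<in> sets lebesgue \<and> E \<subseteq> {inverse M <..< M} \<and>
      emeasure lebesgue ({inverse M <..< M} - E) < ennreal \<epsilon> \<and>
      eps_close \<epsilon> K L \<and>
      (\<forall>r\<in>E. \<exists>a b. a < b \<and> {a..b} \<subseteq> {x + r * y | x y. x \<in> L \<and> y \<in> K'})"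
proof -
  obtain \<Phi> \<Psi> where X: "ifs \<Phi> K" and Y: "ifs \<Psi> K'"
    using self_similar_ifs assms(1,2) by blast
  interpret X: ifs \<Phi> K by fact
  interpret Y: ifs \<Psi> K' by fact
  have "1 < hausdorff_dim K + hausdorff_dim K'" by fact
  also have "\<dots> \<le> ennreal X.sdim + ennreal Y.sdim"
    by (intro add_mono X.hausdorff_dim_le Y.hausdorff_dim_le)
  also have "\<dots> = ennreal (X.sdim + Y.sdim)" using X.sdim(1) Y.sdim(1) by simp
  finally have "ennreal 1 < ennreal (X.sdim + Y.sdim)" by simp
  then have dims: "1 < X.sdim + Y.sdim" by (simp add: ennreal_less_iff del: ennreal_1)
  interpret ifs_pair \<Phi> K \<Psi> K' using dims by unfold_locales
  define \<theta> where "\<theta> = min (\<epsilon> / 16) (1 / 16)"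
  have \<theta>: "0 < \<theta>" "\<theta> \<le> \<epsilon> / 16" "\<theta> \<le> 1 / 16" using assms(4) by (auto simp: \<theta>_def)
  obtain A \<omega> x0 x1 L E where A: "subdivision A K" "\<forall>a\<in>A. 0 < \<bar>fst a\<bar> \<and> \<bar>fst a\<bar> < 1"
    and \<omega>: "\<forall>a\<in>A. fst (\<omega> a) \<in> {1 + 2 * \<theta>..1 + 4 * \<theta>} \<and> \<bar>snd (\<omega> a)\<bar> \<le> \<theta>"
    and x01: "x1 \<in> {0..1}" "\<bar>x0 - x1\<bar> \<le> \<theta>"
    and inw: "\<forall>a\<in>A. aff (inward x0 x1 (\<omega> a)) ` X.J \<subseteq> X.J"
    and L: "compact L" "L \<noteq> {}" "L \<subseteq> X.J" "L = (\<Union>a\<in>A. aff (aff_comp a (inward x0 x1 (\<omega> a))) ` L)"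
    and E: "E \<in> sets borel" "E \<subseteq> {inverse M<..<M}" "emeasure lborel ({inverse M<..<M} - E) < ennreal \<epsilon>"
      "\<forall>r\<in>E. \<exists>a b. a < b \<and> {a..b} \<subseteq> {x + r * y | x y. x \<in> L \<and> y \<in> K'}"
    using perturbation[OF assms(4,5) \<theta>(1,3)] by blast
  have finA: "finite A" and KA: "K = (\<Union>a\<in>A. aff a ` K)" and dA: "disjoint_family_on (\<lambda>a. aff a ` X.J) A"
    using A(1) by (auto simp: subdivision_def)
  obtain e where e: "bij_betw e {0..<card A} A" using ex_bij_betw_nat_finite[OF finA] by blast
  have hullL: "convex hull L \<subseteq> X.J" using L(3) by (simp add: hull_minimal)
  have genK: "generates {0..<card A} (\<lambda>i. aff (e i)) K"
    using generates_nat[of A "\<lambda>a. a", OF finA _ KA dA e] A(2) by simp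
  have genL: "generates {0..<card A} (\<lambda>i. aff (aff_comp (e i) (inward x0 x1 (\<omega> (e i))))) L"
  proof (rule generates_nat[of A "\<lambda>a. aff_comp a (inward x0 x1 (\<omega> a))", OF finA _ L(4) _ e])
    fix a assume a: "a \<in> A"
    have z: "1 < fst (\<omega> a)" using \<omega> a \<theta> by force
    have "\<bar>fst a\<bar> / fst (\<omega> a) \<le> \<bar>fst a\<bar> / 1"
      using z by (intro divide_left_mono) auto
    then show "0 < \<bar>fst (aff_comp a (inward x0 x1 (\<omega> a)))\<bar> \<and> \<bar>fst (aff_comp a (inward x0 x1 (\<omega> a)))\<bar> < 1"
      using A(2) a z by (force simp: inward_def abs_mult)
  next
    have sub: "aff (aff_comp a (inward x0 x1 (\<omega> a))) ` (convex hull L) \<subseteq> aff a ` X.J" if a: "a \<in> A" for a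
    proof -
      have "aff (aff_comp a (inward x0 x1 (\<omega> a))) ` (convex hull L) = aff a ` (aff (inward x0 x1 (\<omega> a)) ` (convex hull L))"
        by (simp add: image_image aff_aff_comp)
      then show ?thesis using inw a hullL by blast
    qed
    have "aff (aff_comp a (inward x0 x1 (\<omega> a))) ` (convex hull L) \<inter> aff (aff_comp a' (inward x0 x1 (\<omega> a'))) ` (convex hull L) = {}"
      if "a \<in> A" "a' \<in> A" "a \<noteq> a'" for a a'
      using disjoint_family_onD[OF dA that] sub[OF that(1)] sub[OF that(2)] by blast
    then show "disjoint_family_on (\<lambda>a. aff (aff_comp a (inward x0 x1 (\<omega> a))) ` (convex hull L)) A"
      by (simp add: disjoint_family_on_def)
  qed
  have "eps_close_intervals \<epsilon> (aff (e i) ` {0..1}) (aff (aff_comp (e i) (inward x0 x1 (\<omega> (e i)))) ` {0..1})"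
    if "i \<in> {0..<card A}" for i
  proof -
    have "e i \<in> A" using e that by (rule bij_betw_apply)
    then show ?thesis using A(2) \<omega> x01 \<theta> by (intro eps_close_intervals_perturbed) auto
  qed
  then have "eps_close \<epsilon> K L" unfolding eps_close_def using genK genL by blast
  moreover have "L \<subseteq> {0..1}" using L(3) X.J_unit by blast
  then have "self_similar_cantor_set L"
    unfolding self_similar_cantor_set_def using L(1,2) genL by blast
  moreover have "E \<in> sets lebesgue" using E(1) by simp
  moreover have "emeasure lebesgue ({inverse M<..<M} - E) < ennreal \<epsilon>" using E(1,3) by simp
  ultimately show ?thesis using E(2,4) by blast
qed

end
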